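(* Let $g\in C^{\omega}(\mathbb{R})$ be a real-analytic function such that $$g(v)>0,\qquad \frac{d g}{d v}(v)\ge 0,\qquad \frac{d^2}{dv^2}\big(v^2 g(v^2)\big)>0\qquad\text{for all } v>0,\qquad \lim_{v\to\infty} v\,g(v^2)=\infty .$$ Then there exists $\beta>0$ such that the toy model with this $g$ and this $\beta$ has a unique toy steady tip growth solution.
   Context: Toy model: for a real-analytic $g:\mathbb{R}\to\mathbb{R}$ with $g(v)>0$ for $v>0$ and a parameter $\beta$, the toy model is the planar ODE (independent variable $s$, prime denotes $d/ds$) $$\rho'=\frac32\,\frac{1-\rho^2}{r}\left(-1+\frac{\sqrt{1-\rho^2}\,\big(\beta r^2 g(r^2)+\rho\big)}{r}\right),\qquad r'=\rho,$$ on the phase space $M_0=(-1,1)\times\mathbb{R}_{>0}$. Consider solutions $(\rho,r)$ defined on an interval of the form $(0,s_{\max})$. Conditions: (S1) $\lim_{s\to0^+}\rho(s)=1$, $\lim_{s\to0^+}r(s)=0$, and $\lim_{s\to0^+}\sqrt{1-\rho(s)^2}/r(s)=\eta_0$ for some $\eta_0>0$. (S2) there exist $s_0>0$ and a real-analytic $G:(-a,a)\to\mathbb{R}_{>0}$ with $a=r(s_0)^2$ such that $\rho(s)=G(r(s)^2)$ for all $s\in(0,s_0)$. (S3) the solution is defined on $(0,\infty)$ and $\rho'(s)<0$, $\rho(s)>0$ for all $s>0$. (S4) $\lim_{s\to\infty}\rho(s)=0$ and $\lim_{s\to\infty}r(s)=r_\infty$ for some $r_\infty>0$. A toy steady tip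 growth solution is a solution of the toy model satisfying (S1)–(S4). *)

theory Defs
  imports "HOL-Analysis.Analysis"
begin

definition real_analytic_on :: "(real \<Rightarrow> real) \<Rightarrow> real set \<Rightarrow> bool" where
  "real_analytic_on f S \<longleftrightarrow>
     (\<forall>x\<in>S. \<exists>\<delta>>0. \<exists>c :: nat \<Rightarrow> real.
        \<forall>y. \<bar>y - x\<bar> < \<delta> \<longrightarrow> (\<lambda>n. c n * (y - x) ^ n) sums f y)"

definition toy_rhs :: "(real \<Rightarrow> real) \<Rightarrow> real \<Rightarrow> real \<Rightarrow> real \<Rightarrow> real" where
  "toy_rhs g \<beta> \<rho> r =
     3/2 * (1 - \<rho>^2) / r *
       (-1 + sqrt (1 - \<rho>^2) * (\<beta> * r^2 * g (r^2) + \<rho>) / r)"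

text \<open>Toy steady tip growth solution: a solution of the toy model satisfying (S1)--(S4).
 Because of (S3) it is a solution on (0,\<infinity>).\<close>
definition toy_steady_tip_growth ::
  "(real \<Rightarrow> real) \<Rightarrow> real \<Rightarrow> (real \<Rightarrow> real) \<Rightarrow> (real \<Rightarrow> real) \<Rightarrow> bool" where
  "toy_steady_tip_growth g \<beta> \<rho> r \<longleftrightarrow>
     (\<forall>s>0. -1 < \<rho> s \<and> \<rho> s < 1 \<and> 0 < r s \<and>
        (\<rho> has_real_derivative toy_rhs g \<beta> (\<rho> s) (r s)) (at s) \<and>
        (r has_real_derivative \<rho> s) (at s))
   \<comment> \<open>(S1)\<close>
   \<and> (\<rho> \<longlongrightarrow> 1) (at_right 0) \<and> (r \<longlongrightarrow> 0) (at_right 0)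
   \<and> (\<exists>\<eta>0>0. ((\<lambda>s. sqrt (1 - \<rho> s ^ 2) / r s) \<longlongrightarrow> \<eta>0) (at_right 0))
   \<comment> \<open>(S2)\<close>
   \<and> (\<exists>s0>0. \<exists>G. real_analytic_on G {- (r s0 ^ 2)<..<r s0 ^ 2}
        \<and> (\<forall>v\<in>{- (r s0 ^ 2)<..<r s0 ^ 2}. G v > 0)
        \<and> (\<forall>s\<in>{0<..<s0}. \<rho> s = G (r s ^ 2)))
   \<comment> \<open>(S3)\<close>
   \<and> (\<forall>s>0. deriv \<rho> s < 0 \<and> \<rho> s > 0)
   \<comment> \<open>(S4)\<close>
   \<and> (\<rho> \<longlongrightarrow> 0) at_top \<and> (\<exists>r_inf>0. (r \<longlongrightarrow> r_inf) at_top)"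

end

theory Submission
  imports Defs "HOL-Complex_Analysis.Complex_Analysis"
begin

text \<open>
  In the variables \<open>v = r\<^sup>2\<close> and \<open>\<eta> = \<surd>(1 - \<rho>\<^sup>2) / r\<close> the model reads
  \<open>4 v \<eta>' = \<eta> (1 - 3 \<eta> (\<beta> v g(v) + \<rho>))\<close> with \<open>\<rho> = \<surd>(1 - v \<eta>\<^sup>2)\<close>. At the singular point \<open>v = 0\<close> the
  only admissible value is \<open>\<eta> = 1/3\<close>, where the linearisation has the negative exponent \<open>-1/4\<close>.
  Hence (S1) alone determines the trajectory for given \<open>\<beta>\<close>, and a contraction on holomorphic
  functions produces it as an analytic function of \<open>v\<close>, Lipschitz in \<open>\<beta>\<close>.

  The parameter is found by shooting. Write \<open>\<rho>' = (3/2) r \<eta>\<^sup>2 (N - 1)\<close> with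
  \<open>N = \<eta> (\<beta> r\<^sup>2 g(r\<^sup>2) + \<rho>)\<close>. The set of \<open>\<beta>\<close> for which \<open>N\<close> exceeds \<open>1\<close> while still \<open>\<rho> > 0\<close>, and
  the set for which \<open>\<rho>\<close> becomes negative while still \<open>N < 1\<close>, are disjoint and open; the first omits
  small \<open>\<beta>\<close>, the second omits large \<open>\<beta>\<close>. So some \<open>\<beta>\<close> lies in neither set. Convexity of
  \<open>f(r) = r\<^sup>2 g(r\<^sup>2)\<close> excludes that \<open>N = 1\<close> is reached tangentially, and backward uniqueness that the
  equilibrium is reached in finite time, so for this \<open>\<beta>\<close> both \<open>\<rho> > 0\<close> and \<open>\<rho>' < 0\<close> persist for ever.
  Since \<open>N < 1\<close> and \<open>r g(r\<^sup>2) \<longlongrightarrow> \<infinity>\<close>, the radius stays bounded, which forces \<open>\<rho> \<longlongrightarrow> 0\<close>.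
\<close>

section \<open>Ordinary differential equations with bounded Lipschitz right-hand side\<close>

text \<open>The tip is a singular point, so no initial value problem can be posed at r = 0. Shooting
  has to start at a positive radius, and that radius must be the same for all \<beta>: the range
  [\<beta>1, \<beta>2] is therefore fixed first, and the contraction at the tip then works on one
  disc for all \<beta> up to \<beta>2. No monotonicity of the trajectories in \<beta> is
  established; connectedness of the interval replaces it and yields one suitable \<beta>, with
  uniqueness of the solution for this \<beta>.

  The constants are linked. The contraction keeps \<eta> within 1/24 of 1/3, that is in [7/24, 3/8].
  Both ends return as barriers for \<beta>1: if \<beta>1 f(r) \<le> 1/7, then \<eta> \<le> 7/24
  gives N \<le> (7/24)(8/7) = 1/3 and hence \<eta>' \<ge> 0, and the radius 5 is a convenient number
  above 24/7. For \<beta>2 the pair 3/5, 4/5 supplies a rational cosine and sine.\<close>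

lemma indefinite_integral_has_vector_derivative:
  fixes F :: "real \<Rightarrow> 'a::banach"
  assumes "continuous_on {0..} F" "t \<ge> 0"
  shows "((\<lambda>t. integral {0..t} F) has_vector_derivative F t) (at t within {0..})"
proof -
  have "((\<lambda>t. integral {0..t} F) has_vector_derivative F t) (at t within {0..t+1})"
    using assms by (intro integral_has_vector_derivative) (auto intro: continuous_on_subset)
  moreover have "at t within {0..t+1} = at t within {0..}"
    by (rule at_within_nhd[where S="{..<t+1}"]) auto
  ultimately show ?thesis by simp
qed

text \<open>Picard iteration in an exponentially weighted norm: the unknown is \<psi>(t) = e^(-kt)
  x(t). With k = 2L the integral operator contracts by L/k = 1/2 on the whole half-line, so one
  fixed point gives a global solution without continuation. Boundedness of \<open>f\<close> makes
  the integral grow at most linearly, and the weight turns this into a bounded function.\<close>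

lemma ode_solution_exists:
  fixes f :: "'a::banach \<Rightarrow> 'a"
  assumes L: "L > 0" and lip: "\<And>x y. norm (f x - f y) \<le> L * norm (x - y)"
    and bd: "\<And>x. norm (f x) \<le> M"
  obtains x where "x 0 = x0"
    and "\<And>t. t \<ge> 0 \<Longrightarrow> (x has_vector_derivative f (x t)) (at t within {0..})"
proof -
  define k where "k = 2 * L"
  have k: "k > 0" using L by (simp add: k_def)
  have M: "M \<ge> 0" using bd[of 0] norm_ge_zero order_trans by blast
  have contf: "continuous_on UNIV f"
  proof (rule lipschitz_on_continuous_on)
    show "L-lipschitz_on UNIV f"
      using L lip by (auto simp: lipschitz_on_def dist_norm)
  qed
  define I where "I = (\<lambda>(\<psi>::real \<Rightarrow>\<^sub>C 'a) t. integral {0..t} (\<lambda>u. f (exp (k*u) *\<^sub>R \<psi> u)))"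
  \<comment> \<open>Bounded continuous functions live on all of the reals; \<open>max 0 t\<close>
    extends the iterate by the constant \<open>x0\<close> to negative times.\<close>
  define T where "T = (\<lambda>(\<psi>::real \<Rightarrow>\<^sub>C 'a) t. exp (- k * max 0 t) *\<^sub>R (x0 + I \<psi> (max 0 t)))"
  have cF: "continuous_on S (\<lambda>u. f (exp (k*u) *\<^sub>R apply_bcontfun \<psi> u))" for \<psi> S
    by (rule continuous_on_compose2[OF contf]) (auto intro!: continuous_intros)
  have iF: "(\<lambda>u. f (exp (k*u) *\<^sub>R apply_bcontfun \<psi> u)) integrable_on {0..t}" for \<psi> t
    by (rule integrable_continuous_interval[OF cF])
  have dI: "(I \<psi> has_vector_derivative f (exp (k*t) *\<^sub>R \<psi> t)) (at t within {0..})" if "t \<ge> 0" for \<psi> t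
    unfolding I_def using indefinite_integral_has_vector_derivative[OF cF that] .
  have cI: "continuous_on {0..} (I \<psi>)" for \<psi>
    using dI by (meson atLeast_iff continuous_on_eq_continuous_within has_vector_derivative_continuous)
  have Ib: "norm (I \<psi> t) \<le> M * t" if "t \<ge> 0" for \<psi> t
  proof -
    have "norm (I \<psi> t) \<le> integral {0..t} (\<lambda>u. M)"
      unfolding I_def by (rule integral_norm_bound_integral[OF iF]) (auto intro: bd)
    then show ?thesis using that by (simp add: mult.commute)
  qed
  have Tb: "T \<psi> \<in> bcontfun" for \<psi>
  proof (rule bcontfun_normI)
    show "continuous_on UNIV (T \<psi>)"
      unfolding T_def
      by (intro continuous_intros continuous_on_compose2[OF cI]) auto
    fix t :: real
    define s where "s = max 0 t"
    have s: "s \<ge> 0" by (simp add: s_def)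
    have "k * s \<le> exp (k * s)" using exp_ge_add_one_self[of "k * s"] by linarith
    then have "s \<le> exp (k * s) / k" using k by (simp add: field_simps)
    then have "M * s \<le> M * (exp (k * s) / k)" using M by (rule mult_left_mono)
    then have "exp (-k * s) * (M * s) \<le> exp (-k * s) * (M * (exp (k * s) / k))"
      by (rule mult_left_mono) simp
    also have "\<dots> = M / k" by (simp add: exp_minus field_simps)
    finally have 1: "exp (-k * s) * (M * s) \<le> M / k" .
    have 2: "exp (-k * s) * norm x0 \<le> norm x0"
      using k s by (simp add: mult_left_le_one_le)
    have "norm (T \<psi> t) = exp (-k * s) * norm (x0 + I \<psi> s)" by (simp add: T_def s_def)
    also have "\<dots> \<le> exp (-k * s) * (norm x0 + M * s)"
      using Ib[OF s, of \<psi>] norm_triangle_ineq[of x0 "I \<psi> s"] by (intro mult_left_mono) auto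
    also have "\<dots> \<le> norm x0 + M / k" using 1 2 by (simp add: distrib_left)
    finally show "norm (T \<psi> t) \<le> norm x0 + M / k" .
  qed
  have contr: "\<forall>\<psi> \<phi>. dist (Bcontfun (T \<psi>)) (Bcontfun (T \<phi>)) \<le> 1/2 * dist \<psi> \<phi>"
  proof (intro allI dist_bound)
    fix \<psi> \<phi> :: "real \<Rightarrow>\<^sub>C 'a" and t :: real
    define s where "s = max 0 t"
    define d where "d = dist \<psi> \<phi>"
    have s: "s \<ge> 0" by (simp add: s_def)
    have hi: "((\<lambda>u. L * d * exp (k*u)) has_integral (L * d * exp (k * s) / k - L * d * exp (k*0) / k)) {0..s}"
      by (rule fundamental_theorem_of_calculus[OF s])
        (use k in \<open>auto intro!: derivative_eq_intros simp: has_real_derivative_iff_has_vector_derivative[symmetric]\<close>)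
    have "norm (I \<psi> s - I \<phi> s) = norm (integral {0..s} (\<lambda>u. f (exp (k*u) *\<^sub>R \<psi> u) - f (exp (k*u) *\<^sub>R \<phi> u)))"
      unfolding I_def by (simp add: integral_diff iF)
    also have "\<dots> \<le> integral {0..s} (\<lambda>u. L * d * exp (k*u))"
    proof (rule integral_norm_bound_integral)
      show "(\<lambda>u. f (exp (k*u) *\<^sub>R \<psi> u) - f (exp (k*u) *\<^sub>R \<phi> u)) integrable_on {0..s}"
        by (intro integrable_diff iF)
      show "(\<lambda>u. L * d * exp (k * u)) integrable_on {0..s}" using hi by blast
      fix u
      have "norm (f (exp (k*u) *\<^sub>R \<psi> u) - f (exp (k*u) *\<^sub>R \<phi> u)) \<le> L * norm (exp (k*u) *\<^sub>R (\<psi> u - \<phi> u))"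
        using lip[of "exp (k*u) *\<^sub>R \<psi> u" "exp (k*u) *\<^sub>R \<phi> u"] by (simp add: scaleR_diff_right)
      also have "\<dots> = L * (exp (k*u) * dist (\<psi> u) (\<phi> u))" by (simp add: dist_norm)
      also have "\<dots> \<le> L * (exp (k*u) * d)"
        unfolding d_def using L by (intro mult_left_mono dist_bounded) auto
      finally show "norm (f (exp (k*u) *\<^sub>R \<psi> u) - f (exp (k*u) *\<^sub>R \<phi> u)) \<le> L * d * exp (k*u)"
        by (simp add: mult_ac)
    qed
    also have "\<dots> = L * d * exp (k * s) / k - L * d / k" using integral_unique[OF hi] by simp
    also have "\<dots> \<le> L * d * exp (k * s) / k" using k L by (simp add: d_def)
    also have "\<dots> = d / 2 * exp (k * s)" using L by (simp add: k_def)
    finally have "norm (I \<psi> s - I \<phi> s) \<le> d / 2 * exp (k * s)" .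
    then have "exp (-k * s) * norm (I \<psi> s - I \<phi> s) \<le> exp (-k * s) * (d / 2 * exp (k * s))"
      by (rule mult_left_mono) simp
    also have "\<dots> = d / 2" by (simp add: exp_minus field_simps)
    finally have "norm (T \<psi> t - T \<phi> t) \<le> d / 2"
      unfolding T_def s_def[symmetric] by (simp add: scaleR_diff_right[symmetric])
    then show "dist (apply_bcontfun (Bcontfun (T \<psi>)) t) (apply_bcontfun (Bcontfun (T \<phi>)) t) \<le> 1/2 * dist \<psi> \<phi>"
      by (simp add: Bcontfun_inverse[OF Tb] dist_norm d_def)
  qed
  obtain \<psi> where \<psi>: "Bcontfun (T \<psi>) = \<psi>"
    using banach_fix_type[OF _ _ contr] by auto
  have \<psi>': "apply_bcontfun \<psi> t = T \<psi> t" for t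
    using arg_cong[OF \<psi>, of apply_bcontfun] by (simp add: Bcontfun_inverse[OF Tb])
  define x where "x = (\<lambda>t. x0 + I \<psi> t)"
  have xT: "exp (k*t) *\<^sub>R \<psi> t = x t" if "t \<ge> 0" for t
    using that by (simp add: \<psi>' T_def x_def max_def exp_minus)
  show thesis
  proof
    show "x 0 = x0" by (simp add: x_def I_def)
    fix t :: real assume t: "t \<ge> 0"
    show "(x has_vector_derivative f (x t)) (at t within {0..})"
      unfolding x_def using dI[OF t, of \<psi>] xT[OF t]
      by (auto intro!: derivative_eq_intros simp: x_def)
  qed
qed

lemma at_within_atLeast_interior: "(t::real) > a \<Longrightarrow> at t within {a..} = at t"
  by (rule at_within_interior) (simp add: interior_real_atLeast)

text \<open>The function e^(-ct) u(t) is nonincreasing. No sign is imposed on c or u; the crossing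
  argument uses the bound with c < 0 and u < 0.\<close>

lemma linear_growth_bound:
  fixes u :: "real \<Rightarrow> real"
  assumes ab: "a \<le> b" and cont: "continuous_on {a..b} u"
    and der: "\<And>t. a < t \<Longrightarrow> t < b \<Longrightarrow> (u has_real_derivative u' t) (at t)"
    and le: "\<And>t. a < t \<Longrightarrow> t < b \<Longrightarrow> u' t \<le> c * u t"
  shows "u b \<le> exp (c * (b - a)) * u a"
proof -
  have "exp (- (c*b)) * u b \<le> exp (- (c*a)) * u a"
  proof (rule DERIV_nonpos_imp_decreasing_open[OF ab, where f = "\<lambda>t. exp (- (c*t)) * u t"])
    show "continuous_on {a..b} (\<lambda>t. exp (- (c*t)) * u t)"
      by (intro continuous_intros cont)
    fix t assume t: "a < t" "t < b"
    have "((\<lambda>t. exp (- (c*t)) * u t) has_real_derivative exp (-(c*t)) * (u' t - c * u t)) (at t)"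
      by (rule derivative_eq_intros refl der t)+ (simp add: algebra_simps)
    moreover have "exp (-(c*t)) * (u' t - c * u t) \<le> 0"
      using le[OF t] by (simp add: mult_nonneg_nonpos)
    ultimately show "\<exists>y. ((\<lambda>t. exp (- (c*t)) * u t) has_real_derivative y) (at t) \<and> y \<le> 0" by blast
  qed
  then have "exp (c*b) * (exp (- (c*b)) * u b) \<le> exp (c*b) * (exp (- (c*a)) * u a)"
    by (intro mult_left_mono) auto
  moreover have "exp (c*b) * (exp (- (c*b)) * u b) = u b" by (simp add: exp_minus)
  moreover have "exp (c*b) * (exp (- (c*a)) * u a) = exp (c * (b - a)) * u a"
    by (simp add: exp_minus exp_diff right_diff_distrib field_simps)
  ultimately show ?thesis by simp
qed

text \<open>The squared distance u is differentiable, and its derivative is bounded by 2 L u in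
  absolute value. The lower bound on u' makes the estimate run backwards in time as well, so
  distinct solutions never meet.\<close>

lemma ode_gronwall:
  fixes f :: "'a::euclidean_space \<Rightarrow> 'a"
  assumes L: "L \<ge> 0" and lip: "\<And>x y. norm (f x - f y) \<le> L * norm (x - y)"
    and x: "\<And>t. t \<ge> 0 \<Longrightarrow> (x has_vector_derivative f (x t)) (at t within {0..})"
    and y: "\<And>t. t \<ge> 0 \<Longrightarrow> (y has_vector_derivative f (y t)) (at t within {0..})"
    and t: "t \<ge> 0"
  shows "norm (x t - y t) \<le> exp (L * t) * norm (x 0 - y 0)"
    and "norm (x 0 - y 0) \<le> exp (L * t) * norm (x t - y t)"
proof -
  define u where "u = (\<lambda>t. (x t - y t) \<bullet> (x t - y t))"
  define u' where "u' = (\<lambda>t. 2 * ((x t - y t) \<bullet> (f (x t) - f (y t))))"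
  have u_norm: "u s = (norm (x s - y s))^2" for s by (simp add: u_def power2_norm_eq_inner)
  have cont: "continuous_on {0..t} u"
  proof -
    have "continuous_on {0..} x" "continuous_on {0..} y"
      using x y by (meson atLeast_iff continuous_on_eq_continuous_within has_vector_derivative_continuous)+
    then show ?thesis unfolding u_def
      by (intro continuous_intros) (auto intro: continuous_on_subset)
  qed
  have der: "(u has_real_derivative u' s) (at s)" if s: "0 < s" for s
  proof -
    have "(x has_vector_derivative f (x s)) (at s)" "(y has_vector_derivative f (y s)) (at s)"
      using x[of s] y[of s] s by (auto simp: at_within_atLeast_interior)
    then have "((\<lambda>s. x s - y s) has_derivative (\<lambda>h. h *\<^sub>R (f (x s) - f (y s)))) (at s)"
      using has_vector_derivative_diff has_vector_derivative_def by blast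
    from has_derivative_inner[OF this this]
    have "(u has_derivative (\<lambda>h. u' s * h)) (at s)"
      unfolding u_def u'_def by (rule has_derivative_eq_rhs) (auto simp: inner_commute)
    then show ?thesis by (simp add: has_field_derivative_def)
  qed
  have bd: "\<bar>u' s\<bar> \<le> 2 * L * u s" for s
  proof -
    have "\<bar>u' s\<bar> \<le> 2 * (norm (x s - y s) * norm (f (x s) - f (y s)))"
      unfolding u'_def using Cauchy_Schwarz_ineq2[of "x s - y s" "f (x s) - f (y s)"] by simp
    also have "\<dots> \<le> 2 * (norm (x s - y s) * (L * norm (x s - y s)))"
      by (intro mult_left_mono lip) auto
    finally show ?thesis by (simp add: u_norm power2_eq_square mult_ac)
  qed
  have conv: "a \<le> exp (L * t) * b"
    if "a^2 \<le> exp (2 * L * t) * b^2" "b \<ge> 0" for a b :: real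
  proof -
    have "a^2 \<le> (exp (L*t) * b)^2" using that(1)
      using exp_double[of "L * t"] by (simp add: power_mult_distrib mult.assoc)
    then show ?thesis by (rule power2_le_imp_le) (use that(2) in simp)
  qed
  have "u t \<le> exp (2 * L * (t - 0)) * u 0"
    using bd by (intro linear_growth_bound[OF t cont der]) (auto simp: abs_le_iff)
  then show "norm (x t - y t) \<le> exp (L * t) * norm (x 0 - y 0)"
    by (intro conv) (auto simp: u_norm)
  \<comment> \<open>Time reversal: the same growth bound, applied to s \<mapsto> u(t - s).\<close>
  have "(\<lambda>s. u (t - s)) t \<le> exp (2 * L * (t - 0)) * (\<lambda>s. u (t - s)) 0"
  proof (rule linear_growth_bound[OF t, where u' = "\<lambda>s. - u' (t - s)"])
    show "continuous_on {0..t} (\<lambda>s. u (t - s))"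
      by (rule continuous_on_compose2[OF cont]) (auto intro!: continuous_intros)
    fix s assume s: "0 < s" "s < t"
    have "(u has_real_derivative u' (t - s)) (at (t - s))" using s by (intro der) simp
    moreover have "((\<lambda>s. t - s) has_real_derivative -1) (at s)"
      by (auto intro!: derivative_eq_intros)
    ultimately show "((\<lambda>s. u (t - s)) has_real_derivative - u' (t - s)) (at s)"
      using DERIV_chain2[where f = u and g = "\<lambda>s. t - s"] by fastforce
    show "- u' (t - s) \<le> 2 * L * u (t - s)" using bd[of "t-s"] by (auto simp: abs_le_iff)
  qed
  then show "norm (x 0 - y 0) \<le> exp (L * t) * norm (x t - y t)"
    by (intro conv) (auto simp: u_norm)
qed

section \<open>Real-analytic functions and the singular Euler operator\<close>

lemma power_series_differentiable:
  fixes f :: "real \<Rightarrow> real"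
  assumes sums: "\<And>y. \<bar>y - x\<bar> < \<delta> \<Longrightarrow> (\<lambda>n. c n * (y - x) ^ n) sums f y"
    and y: "\<bar>y - x\<bar> < \<delta>"
  shows "\<exists>D. (f has_real_derivative D) (at y) \<and> (\<lambda>n. diffs c n * (y - x) ^ n) sums D"
proof -
  define F where "F = (\<lambda>z. f (x + z))"
  have sF: "(\<lambda>n. c n * z ^ n) sums F z" if "norm z < \<delta>" for z
    using sums[of "x + z"] that by (simp add: F_def)
  obtain K where K: "\<bar>y - x\<bar> < K" "K < \<delta>" using y dense by blast
  have "summable (\<lambda>n. c n * K ^ n)" using sF[of K] K by (auto simp: sums_iff)
  then have "((\<lambda>z. \<Sum>n. c n * z ^ n) has_real_derivative (\<Sum>n. diffs c n * (y - x) ^ n)) (at (y - x))"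
    using K by (intro termdiffs_strong) auto
  then have dF: "(F has_real_derivative (\<Sum>n. diffs c n * (y - x) ^ n)) (at (y - x))"
    by (rule has_field_derivative_transform_within_open[where S = "ball 0 \<delta>"])
       (use y sF in \<open>auto simp: sums_iff\<close>)
  have "(\<lambda>n. diffs c n * (y - x) ^ n) sums (\<Sum>n. diffs c n * (y - x) ^ n)"
    by (rule termdiffs_sums_strong[OF sF dF]) (use y in auto)
  moreover have "((\<lambda>y. F (y - x)) has_real_derivative (\<Sum>n. diffs c n * (y - x) ^ n)) (at y)"
    using DERIV_shift[of F _ y "-x"] dF by simp
  moreover have "(\<lambda>y. F (y - x)) = f" by (simp add: F_def)
  ultimately show ?thesis by auto
qed

lemma real_analytic_has_derivative:
  assumes "real_analytic_on f S" "x \<in> S"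
  shows "(f has_real_derivative deriv f x) (at x)"
proof -
  obtain \<delta> c where "\<delta> > 0" and s: "\<And>y. \<bar>y - x\<bar> < \<delta> \<Longrightarrow> (\<lambda>n. c n * (y - x) ^ n) sums f y"
    using assms unfolding real_analytic_on_def by blast
  then obtain D where "(f has_real_derivative D) (at x)"
    using power_series_differentiable[where y = x, OF s] by auto
  then show ?thesis using DERIV_imp_deriv by blast
qed

lemma real_analytic_deriv:
  assumes "real_analytic_on f S"
  shows "real_analytic_on (deriv f) S"
  unfolding real_analytic_on_def
proof
  fix x assume "x \<in> S"
  then obtain \<delta> c where "\<delta> > 0" and s: "\<And>y. \<bar>y - x\<bar> < \<delta> \<Longrightarrow> (\<lambda>n. c n * (y - x) ^ n) sums f y"
    using assms unfolding real_analytic_on_def by blast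
  moreover have "(\<lambda>n. diffs c n * (y - x) ^ n) sums deriv f y" if "\<bar>y - x\<bar> < \<delta>" for y
    using power_series_differentiable[OF s that] DERIV_imp_deriv by blast
  ultimately show "\<exists>\<delta>>0. \<exists>c. \<forall>y. \<bar>y - x\<bar> < \<delta> \<longrightarrow> (\<lambda>n. c n * (y - x) ^ n) sums deriv f y"
    by blast
qed

lemma real_analytic_on_subset:
  "real_analytic_on f S \<Longrightarrow> T \<subseteq> S \<Longrightarrow> real_analytic_on f T"
  unfolding real_analytic_on_def by blast

text \<open>At a real centre the powers of y - x are real, so the real parts of the complex Taylor
  coefficients are the coefficients of the real part; \<open>F\<close> may take nonreal values on
  the axis.\<close>

lemma holomorphic_imp_real_analytic:
  assumes F: "F holomorphic_on ball 0 R"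
  shows "real_analytic_on (\<lambda>v. Re (F (of_real v))) {-R<..<R}"
  unfolding real_analytic_on_def
proof
  fix x assume x: "x \<in> {-R<..<R}"
  define \<delta> where "\<delta> = R - \<bar>x\<bar>"
  have "\<delta> > 0" using x by (auto simp: \<delta>_def abs_if)
  have sub: "ball (complex_of_real x) \<delta> \<subseteq> ball 0 R"
    by (simp add: ball_subset_ball_iff \<delta>_def)
  define c where "c = (\<lambda>n. Re ((deriv ^^ n) F (of_real x) / fact n))"
  have "(\<lambda>n. c n * (y - x) ^ n) sums Re (F (of_real y))" if y: "\<bar>y - x\<bar> < \<delta>" for y
  proof -
    have "complex_of_real y \<in> ball (of_real x) \<delta>"
      using y by (simp add: dist_norm norm_minus_commute flip: of_real_diff)
    from holomorphic_power_series[OF holomorphic_on_subset[OF F sub] this]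
    have "(\<lambda>n. Re ((deriv ^^ n) F (of_real x) / fact n * (of_real y - of_real x) ^ n)) sums Re (F (of_real y))"
      by (rule sums_Re)
    moreover have "Re (A * (of_real y - of_real x) ^ n) = Re A * (y - x) ^ n" for A n
      by (simp flip: of_real_diff of_real_power)
    ultimately show ?thesis by (simp only: c_def)
  qed
  then show "\<exists>\<delta>>0. \<exists>c. \<forall>y. \<bar>y - x\<bar> < \<delta> \<longrightarrow> (\<lambda>n. c n * (y - x) ^ n) sums Re (F (of_real y))"
    using \<open>\<delta> > 0\<close> by blast
qed

text \<open>The real Taylor coefficients at 0 define \<open>\<gamma>\<close>; convergence at a real
  point v > |z| gives convergence at z.\<close>

lemma real_analytic_complexify:
  assumes "real_analytic_on g S" "0 \<in> S"
  obtains \<delta> \<gamma> where "\<delta> > 0" "\<gamma> holomorphic_on ball 0 \<delta>"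
    "\<And>v. \<bar>v\<bar> < \<delta> \<Longrightarrow> \<gamma> (of_real v) = of_real (g v)"
proof -
  obtain \<delta> c where \<delta>: "\<delta> > 0" and s: "\<And>y. \<bar>y\<bar> < \<delta> \<Longrightarrow> (\<lambda>n. c n * y ^ n) sums g y"
    using assms unfolding real_analytic_on_def by fastforce
  define \<gamma> where "\<gamma> = (\<lambda>z::complex. \<Sum>n. of_real (c n) * z ^ n)"
  have "(\<lambda>n. of_real (c n) * (z - 0) ^ n) sums \<gamma> z" if z: "z \<in> ball 0 \<delta>" for z
  proof -
    obtain v where v: "norm z < v" "v < \<delta>" using z dense[of "norm z" \<delta>] by auto
    have "0 < v" using v(1) norm_ge_zero le_less_trans by blast
    have "summable (\<lambda>n. complex_of_real (c n * v ^ n))"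
      using s[of v] v \<open>0 < v\<close> by (intro summable_of_real) (auto simp: sums_iff)
    then have "summable (\<lambda>n. of_real (c n) * (complex_of_real v) ^ n)" by simp
    then have "summable (\<lambda>n. of_real (c n) * z ^ n)"
      by (rule powser_inside) (use v \<open>0 < v\<close> in simp)
    then show ?thesis by (simp add: \<gamma>_def summable_sums)
  qed
  then have "\<gamma> holomorphic_on ball 0 \<delta>" by (rule power_series_holomorphic)
  moreover have "\<gamma> (of_real v) = of_real (g v)" if "\<bar>v\<bar> < \<delta>" for v
  proof -
    have "(\<lambda>n. complex_of_real (c n * v ^ n)) sums of_real (g v)"
      using s[OF that] by (rule sums_of_real)
    then show ?thesis by (simp add: \<gamma>_def sums_iff)
  qed
  ultimately show thesis using \<delta> that by blast
qed

lemma has_field_derivative_Re_of_real: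
  assumes "(F has_field_derivative D) (at (complex_of_real v))"
  shows "((\<lambda>x. Re (F (of_real x))) has_real_derivative Re D) (at v)"
  unfolding has_real_derivative_iff_has_vector_derivative
  by (rule bounded_linear.has_vector_derivative[OF bounded_linear_Re has_vector_derivative_real_field[OF assms]])

text \<open>Substituting \<open>t = z \<sigma>\<^sup>4\<close> in the variation-of-constants formula
  \<open>y(z) = z\<^sup>-\<^sup>1\<^sup>/\<^sup>4 \<integral>\<^sub>0\<^sup>z t\<^sup>-\<^sup>3\<^sup>/\<^sup>4 H(t) dt\<close> for \<open>z y' + y/4 = H\<close> removes the singularity.\<close>

definition euler_inverse :: "(complex \<Rightarrow> complex) \<Rightarrow> complex \<Rightarrow> complex" where
  "euler_inverse H z = integral {0..1} (\<lambda>\<sigma>. 4 * H (z * of_real (\<sigma> ^ 4)))"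

lemma ball_scale4:
  assumes "norm (z::complex) < \<delta>" "\<sigma> \<in> {0..1}"
  shows "norm (z * of_real (\<sigma> ^ 4)) < \<delta>"
proof -
  have "\<bar>\<sigma> ^ 4\<bar> \<le> 1" using assms(2) by (simp add: power_le_one)
  then have "norm (z * of_real (\<sigma> ^ 4)) \<le> norm z"
    unfolding norm_mult norm_of_real by (rule mult_right_le_one_le[rotated 2]) auto
  then show ?thesis using assms(1) by simp
qed

lemma continuous_on_scale4:
  assumes "continuous_on (ball 0 \<delta>) H" "norm z < \<delta>"
  shows "continuous_on {0..1} (\<lambda>\<sigma>. H (z * complex_of_real (\<sigma> ^ 4)))"
  by (rule continuous_on_compose2[OF assms(1)])
     (use ball_scale4[OF assms(2)] in \<open>auto intro!: continuous_intros\<close>)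

lemma euler_inverse_integrable:
  fixes H :: "complex \<Rightarrow> complex"
  assumes "continuous_on (ball 0 \<delta>) H" "norm z < \<delta>"
  shows "(\<lambda>\<sigma>. 4 * H (z * complex_of_real (\<sigma> ^ 4))) integrable_on {0..1}"
  by (intro integrable_continuous_interval continuous_intros continuous_on_scale4[OF assms])

text \<open>Differentiation under the integral gives D. The equation is the fundamental theorem of
  calculus for \<sigma> \<mapsto> \<sigma> H(z \<sigma>^4), whose derivative H + 4 z \<sigma>^4 H'
  integrates to one quarter of the solution plus z D.\<close>

lemma euler_inverse_derivative:
  assumes H: "H holomorphic_on ball 0 \<delta>" and z: "norm z < \<delta>"
  obtains D where "(euler_inverse H has_field_derivative D) (at z)"
    "z * D + euler_inverse H z / 4 = H z"
proof -
  define H' where "H' = deriv H"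
  have dH: "(H has_field_derivative H' w) (at w)" if "norm w < \<delta>" for w
    unfolding H'_def by (rule holomorphic_derivI[OF H open_ball]) (use that in simp)
  have cH': "continuous_on (ball 0 \<delta>) H'"
    unfolding H'_def by (intro holomorphic_on_imp_continuous_on holomorphic_deriv H) auto
  have cH: "continuous_on (ball 0 \<delta>) H" using H by (rule holomorphic_on_imp_continuous_on)
  define D where "D = integral {0..1} (\<lambda>\<sigma>. 4 * (H' (z * of_real (\<sigma> ^ 4)) * of_real (\<sigma> ^ 4)))"
  have "((\<lambda>x. integral (cbox 0 1) (\<lambda>\<sigma>. 4 * H (x * complex_of_real (\<sigma> ^ 4)))) has_field_derivative
        integral (cbox 0 1) (\<lambda>\<sigma>. 4 * (H' (z * of_real (\<sigma> ^ 4)) * of_real (\<sigma> ^ 4)))) (at z within ball 0 \<delta>)"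
  proof (rule leibniz_rule_field_derivative)
    fix x :: complex and t :: real assume x: "x \<in> ball 0 \<delta>" and t: "t \<in> cbox 0 1"
    have "norm (x * of_real (t ^ 4)) < \<delta>" using ball_scale4[of x \<delta> t] x t by simp
    then have "(H has_field_derivative H' (x * of_real (t ^ 4))) (at (x * of_real (t ^ 4)))" by (rule dH)
    then have "((\<lambda>x. H (x * of_real (t ^ 4))) has_field_derivative H' (x * of_real (t ^ 4)) * of_real (t ^ 4)) (at x)"
      by (rule DERIV_chain2) (auto intro!: derivative_eq_intros)
    then show "((\<lambda>x. 4 * H (x * of_real (t ^ 4))) has_field_derivative
        4 * (H' (x * of_real (t ^ 4)) * of_real (t ^ 4))) (at x within ball 0 \<delta>)"
      by (intro DERIV_cmult) (rule DERIV_subset, auto)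
  next
    fix x :: complex assume "x \<in> ball 0 \<delta>"
    then show "(\<lambda>\<sigma>. 4 * H (x * complex_of_real (\<sigma> ^ 4))) integrable_on cbox 0 1"
      using euler_inverse_integrable[OF cH, of x] by simp
  next
    have "continuous_on (ball 0 \<delta> \<times> cbox 0 1) (\<lambda>p. H' (fst p * complex_of_real (snd p ^ 4)))"
      by (rule continuous_on_compose2[OF cH'])
         (use ball_scale4[of _ \<delta>] in \<open>auto intro!: continuous_intros\<close>)
    then show "continuous_on (ball 0 \<delta> \<times> cbox 0 1) (\<lambda>(x, t). 4 * (H' (x * complex_of_real (t ^ 4)) * of_real (t ^ 4)))"
      unfolding split_beta by (intro continuous_intros)
  qed (use z in auto)
  then have "(euler_inverse H has_field_derivative D) (at z within ball 0 \<delta>)"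
    unfolding euler_inverse_def[abs_def] D_def by (simp only: box_real)
  then have D: "(euler_inverse H has_field_derivative D) (at z)"
    using z by (simp add: at_within_open[of z "ball 0 \<delta>"])
  have "((\<lambda>\<sigma>. H (z * of_real (\<sigma> ^ 4)) + z * (4 * (H' (z * of_real (\<sigma> ^ 4)) * of_real (\<sigma> ^ 4))))
      has_integral (of_real 1 * H (z * of_real (1 ^ 4)) - of_real 0 * H (z * of_real (0 ^ 4)))) {0..1}"
  proof (rule fundamental_theorem_of_calculus)
    fix \<sigma> :: real assume \<sigma>: "\<sigma> \<in> {0..1}"
    define h where "h = (\<lambda>w::complex. w * H (z * w ^ 4))"
    have "(H has_field_derivative H' (z * of_real \<sigma> ^ 4)) (at (z * of_real \<sigma> ^ 4))"
      using dH[OF ball_scale4[OF z \<sigma>]] by simp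
    then have "((\<lambda>w. H (z * w ^ 4)) has_field_derivative H' (z * of_real \<sigma> ^ 4) * (z * (4 * of_real \<sigma> ^ 3))) (at (of_real \<sigma>))"
      by (rule DERIV_chain2) (auto intro!: derivative_eq_intros)
    then have "(h has_field_derivative (H (z * of_real \<sigma> ^ 4) + of_real \<sigma> * (H' (z * of_real \<sigma> ^ 4) * (z * (4 * of_real \<sigma> ^ 3))))) (at (of_real \<sigma>))"
      unfolding h_def by (auto intro!: derivative_eq_intros)
    from has_vector_derivative_real_field[OF this]
    show "((\<lambda>\<sigma>. of_real \<sigma> * H (z * of_real (\<sigma> ^ 4))) has_vector_derivative
      H (z * of_real (\<sigma> ^ 4)) + z * (4 * (H' (z * of_real (\<sigma> ^ 4)) * of_real (\<sigma> ^ 4)))) (at \<sigma> within {0..1})"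
      by (simp add: h_def power4_eq_xxxx power3_eq_cube mult_ac)
  qed simp
  then have 1: "integral {0..1} (\<lambda>\<sigma>. H (z * of_real (\<sigma> ^ 4)) + z * (4 * (H' (z * of_real (\<sigma> ^ 4)) * of_real (\<sigma> ^ 4)))) = H z"
    by (simp add: integral_unique)
  have i1: "(\<lambda>\<sigma>. H (z * complex_of_real (\<sigma> ^ 4))) integrable_on {0..1}"
    by (intro integrable_continuous_interval continuous_on_scale4[OF cH z])
  have i2: "(\<lambda>\<sigma>. z * (4 * (H' (z * of_real (\<sigma> ^ 4)) * of_real (\<sigma> ^ 4)))) integrable_on {0..1}"
    by (intro integrable_continuous_interval continuous_intros continuous_on_scale4[OF cH' z])
  have "integral {0..1} (\<lambda>\<sigma>. H (z * of_real (\<sigma> ^ 4))) + z * D = H z"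
    using 1 unfolding integral_add[OF i1 i2] D_def by simp
  then have "z * D + euler_inverse H z / 4 = H z"
    by (simp add: euler_inverse_def add.commute)
  then show thesis using D that by blast
qed

text \<open>The operator multiplies constants by 4, and 4 is also its norm for the supremum. Hence
  the estimates for \<open>tip_rhs\<close> are stated for four times that function.\<close>

lemma euler_inverse_diff_bound:
  assumes "continuous_on (ball 0 \<delta>) H" "continuous_on (ball 0 \<delta>) K" "norm z < \<delta>"
    and "\<And>w. norm w < \<delta> \<Longrightarrow> norm (4 * H w - 4 * K w) \<le> e"
  shows "norm (euler_inverse H z - euler_inverse K z) \<le> e"
proof -
  have "norm (euler_inverse H z - euler_inverse K z) =
      norm (integral {0..1} (\<lambda>\<sigma>. 4 * H (z * complex_of_real (\<sigma> ^ 4)) - 4 * K (z * complex_of_real (\<sigma> ^ 4))))"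
    unfolding euler_inverse_def
    by (subst integral_diff) (use assms euler_inverse_integrable in auto)
  also have "\<dots> \<le> integral {0..1::real} (\<lambda>\<sigma>. e)"
    by (rule integral_norm_bound_integral)
       (use assms ball_scale4[OF assms(3)] euler_inverse_integrable[OF assms(1) assms(3)]
          euler_inverse_integrable[OF assms(2) assms(3)] in \<open>auto intro!: integrable_diff\<close>)
  finally show ?thesis by simp
qed

lemma euler_inverse_const: "euler_inverse (\<lambda>_. c) z = 4 * c"
  by (simp add: euler_inverse_def)

lemma euler_inverse_Reals:
  assumes "continuous_on (ball 0 \<delta>) H" "\<bar>v\<bar> < \<delta>" "\<And>u. \<bar>u\<bar> < \<delta> \<Longrightarrow> H (of_real u) \<in> \<real>"
  shows "euler_inverse H (of_real v) \<in> \<real>"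
proof -
  have v: "norm (complex_of_real v) < \<delta>" using assms(2) by simp
  have "Im (euler_inverse H (of_real v)) = integral {0..1} (Im \<circ> (\<lambda>\<sigma>. 4 * H (of_real v * of_real (\<sigma> ^ 4))))"
    unfolding euler_inverse_def
    by (rule integral_linear[symmetric, OF euler_inverse_integrable[OF assms(1) v] bounded_linear_Im])
  also have "\<dots> = integral {0..1} (\<lambda>\<sigma>::real. 0::real)"
  proof (rule integral_cong)
    fix \<sigma> :: real assume "\<sigma> \<in> {0..1}"
    then have "\<bar>v * \<sigma> ^ 4\<bar> < \<delta>" using ball_scale4[OF v, of \<sigma>] by (simp add: norm_mult abs_mult norm_power power_abs)
    then have "H (of_real (v * \<sigma> ^ 4)) \<in> \<real>" by (rule assms(3))
    then show "(Im \<circ> (\<lambda>\<sigma>. 4 * H (of_real v * of_real (\<sigma> ^ 4)))) \<sigma> = 0"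
      by (simp add: complex_is_Real_iff)
  qed
  finally show ?thesis by (simp add: complex_is_Real_iff)
qed

section \<open>The analytic solution at the tip\<close>

text \<open>The equation for \<open>\<eta>\<close> reads \<open>z w' + w/4 = tip_rhs b \<gamma> z w\<close>. The derivative of \<open>tip_rhs\<close> in \<open>w\<close>
  vanishes at \<open>(z, w) = (0, 1/3)\<close>, which makes the fixed-point iteration contract near this point.\<close>

definition tip_rhs :: "complex \<Rightarrow> (complex \<Rightarrow> complex) \<Rightarrow> complex \<Rightarrow> complex \<Rightarrow> complex" where
  "tip_rhs b \<gamma> z w = w / 2 - 3/4 * w^2 * (b * (z * \<gamma> z) + csqrt (1 - z * w^2))"

primrec tip_iter :: "complex \<Rightarrow> (complex \<Rightarrow> complex) \<Rightarrow> nat \<Rightarrow> complex \<Rightarrow> complex" where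
  "tip_iter b \<gamma> 0 = (\<lambda>_. 1/3)"
| "tip_iter b \<gamma> (Suc k) = euler_inverse (\<lambda>z. tip_rhs b \<gamma> z (tip_iter b \<gamma> k z))"

lemma norm_near_third:
  assumes "norm (w - 1/3 :: complex) \<le> 1/24"
  shows "norm w \<le> 3/8"
proof -
  have "norm w \<le> norm (w - 1/3) + norm (1/3 :: complex)" using norm_triangle_ineq[of "w - 1/3" "1/3"] by simp
  then show ?thesis using assms by (simp add: norm_divide)
qed

text \<open>For the root s everything rests on (s - 1)(s + 1) = - z w^2, where |s + 1| \<ge> 1
  because \<open>csqrt\<close> has nonnegative real part, and on |w|^2 \<le> (3/8)^2 < 1/4. The last
  claim keeps the argument off the branch cut, as holomorphy of the root requires.\<close>

lemma csqrt_near_one: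
  fixes z w :: complex
  assumes z: "norm z \<le> 1/24" and w: "norm (w - 1/3) \<le> 1/24"
  shows "norm (csqrt (1 - z * w^2) - 1) \<le> norm z / 4" "Re (csqrt (1 - z * w^2)) \<ge> 1/2"
    "1 - z * w^2 \<notin> \<real>\<^sub>\<le>\<^sub>0"
proof -
  define s where "s = csqrt (1 - z * w^2)"
  have "norm w ^ 2 \<le> (3/8) ^ 2" using norm_near_third[OF w] by (intro power_mono) auto
  then have w2: "norm w ^ 2 \<le> 1/4" by (simp add: power2_eq_square)
  have zw: "norm (z * w^2) \<le> norm z / 4"
    using mult_left_mono[OF w2, of "norm z"] by (simp add: norm_mult norm_power)
  have "(s - 1) * (s + 1) = - (z * w^2)"
    using power2_csqrt[of "1 - z * w^2"] by (simp add: s_def algebra_simps power2_eq_square)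
  then have "norm (s - 1) * norm (s + 1) = norm (z * w^2)" by (metis norm_minus_cancel norm_mult)
  moreover have "1 \<le> norm (s + 1)"
    using Re_csqrt[of "1 - z * w^2"] complex_Re_le_cmod[of "s + 1"]
    by (simp add: s_def del: csqrt.sel)
  then have "norm (s - 1) * 1 \<le> norm (s - 1) * norm (s + 1)" by (intro mult_left_mono) auto
  ultimately show 1: "norm (csqrt (1 - z * w^2) - 1) \<le> norm z / 4" using zw by (simp add: s_def)
  show "Re (csqrt (1 - z * w^2)) \<ge> 1/2"
    using abs_Re_le_cmod[of "csqrt (1 - z * w^2) - 1"] 1 z by (simp del: csqrt.sel)
  show "1 - z * w^2 \<notin> \<real>\<^sub>\<le>\<^sub>0"
    using abs_Re_le_cmod[of "z * w^2"] zw z by (auto simp: complex_nonpos_Reals_iff)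
qed

lemma tip_kappa_bound:
  fixes z w :: complex
  assumes "norm z \<le> 1/24" "norm (w - 1/3) \<le> 1/24" "norm (b * (z * \<gamma> z)) \<le> 1/48"
  shows "norm (b * (z * \<gamma> z) + csqrt (1 - z * w^2) - 1) \<le> 1/32"
proof -
  have "norm (b * (z * \<gamma> z) + (csqrt (1 - z * w^2) - 1)) \<le> 1/48 + norm z / 4"
    using norm_triangle_ineq[of "b * (z * \<gamma> z)" "csqrt (1 - z * w^2) - 1"] csqrt_near_one(1)[OF assms(1,2)] assms(3)
    by linarith
  then show ?thesis using assms(1) by (simp add: algebra_simps)
qed

text \<open>Write 1 + \<kappa> for the bracket in \<open>tip_rhs\<close>. Four times the deviation
  from 1/12 equals -3 (w - 1/3)^2 - 3 w^2 \<kappa>: no linear term in w - 1/3 is left, so the ball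
  of radius 1/24 is mapped into itself once \<kappa> is small.\<close>

lemma tip_rhs_self_map:
  fixes z w :: complex
  assumes "norm z \<le> 1/24" "norm (w - 1/3) \<le> 1/24" "norm (b * (z * \<gamma> z)) \<le> 1/48"
  shows "norm (4 * tip_rhs b \<gamma> z w - 4 * (1/12)) \<le> 1/24"
proof -
  define \<kappa> where "\<kappa> = b * (z * \<gamma> z) + csqrt (1 - z * w^2) - 1"
  have "4 * tip_rhs b \<gamma> z w - 4 * (1/12) = - (3 * (w - 1/3)^2) - 3 * (w^2 * \<kappa>)"
    by (simp add: tip_rhs_def \<kappa>_def field_simps power2_eq_square)
  also have "norm \<dots> \<le> norm (3 * (w - 1/3)^2) + norm (3 * (w^2 * \<kappa>))"
    using norm_triangle_ineq4[of "- (3 * (w - 1/3)^2)" "3 * (w^2 * \<kappa>)"] by simp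
  also have "\<dots> = 3 * norm (w - 1/3) ^ 2 + 3 * (norm w ^ 2 * norm \<kappa>)"
    by (simp add: norm_mult norm_power)
  also have "\<dots> \<le> 3 * (1/24) ^ 2 + 3 * ((3/8) ^ 2 * (1/32))"
    using tip_kappa_bound[of z w b \<gamma>] assms norm_near_third[OF assms(2)]
    by (intro add_mono mult_mono power_mono) (auto simp: \<kappa>_def)
  also have "\<dots> \<le> 1/24" by (simp add: power2_eq_square)
  finally show ?thesis .
qed

text \<open>The difference splits into a part with the factor (w - 1/3) + (w' - 1/3), a part with
  the small \<kappa>, and the change of the bracket. The first contributes 1/4 and the others
  little, so 1/2 is reached with room to spare. Two parameters in one estimate serve both the
  contraction, with b = b', and the dependence on the parameter.\<close>

lemma tip_rhs_lipschitz:
  fixes z w w' :: complex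
  assumes z: "norm z \<le> 1/24" and w: "norm (w - 1/3) \<le> 1/24" and w': "norm (w' - 1/3) \<le> 1/24"
    and b: "norm (b * (z * \<gamma> z)) \<le> 1/48" and zg: "norm (z * \<gamma> z) \<le> 1"
  shows "norm (4 * tip_rhs b \<gamma> z w - 4 * tip_rhs b' \<gamma> z w') \<le> 1/2 * norm (w - w') + norm (b - b')"
proof -
  define d where "d = norm (w - w')"
  define \<Delta> where "\<Delta> = norm (b - b')"
  define s where "s = csqrt (1 - z * w^2)"
  define s' where "s' = csqrt (1 - z * w'^2)"
  define \<kappa> where "\<kappa> = b * (z * \<gamma> z) + s - 1"
  define E where "E = (b - b') * (z * \<gamma> z) + (s - s')"
  have "4 * tip_rhs b \<gamma> z w - 4 * tip_rhs b' \<gamma> z w' =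
      (w - w') * (- 3 * ((w - 1/3) + (w' - 1/3))) - 3 * ((w^2 - w'^2) * \<kappa>) - 3 * (w'^2 * E)"
    unfolding tip_rhs_def s_def[symmetric] s'_def[symmetric] \<kappa>_def E_def
    by (simp add: field_simps power2_eq_square)
  also have "norm \<dots> \<le> norm ((w - w') * (- 3 * ((w - 1/3) + (w' - 1/3)))) + norm (3 * ((w^2 - w'^2) * \<kappa>)) + norm (3 * (w'^2 * E))"
    by (smt (verit) norm_triangle_ineq4)
  finally have tri: "norm (4 * tip_rhs b \<gamma> z w - 4 * tip_rhs b' \<gamma> z w') \<le>
      norm ((w - w') * (- 3 * ((w - 1/3) + (w' - 1/3)))) + norm (3 * ((w^2 - w'^2) * \<kappa>)) + norm (3 * (w'^2 * E))" .
  have l: "norm ((w - w') * (- 3 * ((w - 1/3) + (w' - 1/3)))) \<le> d * (3 * (1/12))"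
  proof -
    have "norm ((w - 1/3) + (w' - 1/3)) \<le> 1/12"
      using norm_triangle_ineq[of "w - 1/3" "w' - 1/3"] w w' by linarith
    then show ?thesis unfolding norm_mult d_def by (intro mult_left_mono) auto
  qed
  have sq: "norm (w^2 - w'^2) \<le> 3/4 * d"
  proof -
    have "norm (w + w') \<le> 3/4"
      using norm_triangle_ineq[of w w'] norm_near_third[OF w] norm_near_third[OF w'] by linarith
    then have "norm (w + w') * norm (w - w') \<le> 3/4 * norm (w - w')" by (rule mult_right_mono) simp
    moreover have "norm (w^2 - w'^2) = norm (w + w') * norm (w - w')"
      unfolding norm_mult[symmetric] by (simp add: algebra_simps power2_eq_square)
    ultimately show ?thesis by (simp add: d_def)
  qed
  have k: "norm (3 * ((w^2 - w'^2) * \<kappa>)) \<le> 3 * ((3/4 * d) * (1/32))"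
    using sq tip_kappa_bound[of z w b \<gamma>] z w b unfolding norm_mult
    by (intro mult_mono) (auto simp: \<kappa>_def s_def d_def)
  have "norm (s - s') \<le> 1/24 * (3/4 * d)"
  proof -
    have "(s - s') * (s + s') = - z * (w^2 - w'^2)"
      using power2_csqrt[of "1 - z * w^2"] power2_csqrt[of "1 - z * w'^2"]
      by (simp add: s_def s'_def algebra_simps power2_eq_square)
    then have "norm (s - s') * norm (s + s') = norm z * norm (w^2 - w'^2)"
      by (metis norm_minus_cancel norm_mult)
    moreover have "1 \<le> norm (s + s')"
      using csqrt_near_one(2)[OF z w] csqrt_near_one(2)[OF z w'] complex_Re_le_cmod[of "s + s'"]
      by (simp add: s_def s'_def del: csqrt.sel)
    then have "norm (s - s') * 1 \<le> norm (s - s') * norm (s + s')" by (intro mult_left_mono) auto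
    moreover have "norm z * norm (w^2 - w'^2) \<le> 1/24 * (3/4 * d)" using z sq by (intro mult_mono) auto
    ultimately show ?thesis by simp
  qed
  moreover have "norm ((b - b') * (z * \<gamma> z)) \<le> \<Delta>"
    using mult_left_mono[OF zg, of "norm (b - b')"] by (simp add: norm_mult \<Delta>_def)
  ultimately have "norm E \<le> \<Delta> + 1/24 * (3/4 * d)"
    unfolding E_def using norm_triangle_ineq[of "(b - b') * (z * \<gamma> z)" "s - s'"] by linarith
  then have "norm (3 * (w'^2 * E)) \<le> 3 * ((3/8)^2 * (\<Delta> + 1/24 * (3/4 * d)))"
    using norm_near_third[OF w'] unfolding norm_mult norm_power
    by (intro mult_mono power_mono) (auto simp: \<Delta>_def d_def)
  then have "norm (4 * tip_rhs b \<gamma> z w - 4 * tip_rhs b' \<gamma> z w')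
      \<le> d * (3 * (1/12)) + 3 * ((3/4 * d) * (1/32)) + 3 * ((3/8)^2 * (\<Delta> + 1/24 * (3/4 * d)))"
    using tri l k by linarith
  also have "\<dots> \<le> 1/2 * d + \<Delta>"
  proof -
    have "d \<ge> 0" "\<Delta> \<ge> 0" by (auto simp: d_def \<Delta>_def)
    then show ?thesis by (simp add: power2_eq_square field_simps)
  qed
  finally show ?thesis by (simp add: d_def \<Delta>_def)
qed

section \<open>Convergence of the fixed-point iteration and its dependence on the parameter\<close>

definition tip_limit :: "complex \<Rightarrow> (complex \<Rightarrow> complex) \<Rightarrow> complex \<Rightarrow> complex" where
  "tip_limit b \<gamma> z = lim (\<lambda>k. tip_iter b \<gamma> k z)"

lemma tip_rhs_holomorphic:
  assumes \<gamma>: "\<gamma> holomorphic_on ball 0 \<delta>" and \<delta>: "\<delta> \<le> 1/24"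
    and \<phi>: "\<phi> holomorphic_on ball 0 \<delta>" and near: "\<And>z. norm z < \<delta> \<Longrightarrow> norm (\<phi> z - 1/3) \<le> 1/24"
  shows "(\<lambda>z. tip_rhs b \<gamma> z (\<phi> z)) holomorphic_on ball 0 \<delta>"
  unfolding tip_rhs_def
  by (intro holomorphic_intros \<gamma> \<phi> csqrt_near_one(3) near) (use \<delta> in auto)

lemma euler_inverse_holomorphic:
  assumes "H holomorphic_on ball 0 \<delta>"
  shows "euler_inverse H holomorphic_on ball 0 \<delta>"
proof -
  have "euler_inverse H field_differentiable at z" if "z \<in> ball 0 \<delta>" for z
    using euler_inverse_derivative[OF assms, of z] that unfolding field_differentiable_def
    by (metis mem_ball_0)
  then show ?thesis by (simp add: field_differentiable_at_within holomorphic_on_def)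
qed

definition tip_small :: "(complex \<Rightarrow> complex) \<Rightarrow> real \<Rightarrow> complex \<Rightarrow> bool" where
  "tip_small \<gamma> \<delta> b \<longleftrightarrow> (\<forall>z. norm z < \<delta> \<longrightarrow> norm (b * (z * \<gamma> z)) \<le> 1/48)"

lemma tip_smallD: "tip_small \<gamma> \<delta> b \<Longrightarrow> norm z < \<delta> \<Longrightarrow> norm (b * (z * \<gamma> z)) \<le> 1/48"
  by (simp add: tip_small_def)

context
  fixes \<gamma> :: "complex \<Rightarrow> complex" and \<delta> :: real
  assumes \<gamma>: "\<gamma> holomorphic_on ball 0 \<delta>" and \<delta>: "0 < \<delta>" "\<delta> \<le> 1/24"
    and zg: "\<And>z. norm z < \<delta> \<Longrightarrow> norm (z * \<gamma> z) \<le> 1"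
begin

lemma tip_step_near:
  assumes b: "tip_small \<gamma> \<delta> b"
    and \<phi>: "\<phi> holomorphic_on ball 0 \<delta>" and near: "\<And>z. norm z < \<delta> \<Longrightarrow> norm (\<phi> z - 1/3) \<le> 1/24"
    and z: "norm z < \<delta>"
  shows "norm (euler_inverse (\<lambda>z. tip_rhs b \<gamma> z (\<phi> z)) z - 1/3) \<le> 1/24"
proof -
  have "norm (euler_inverse (\<lambda>z. tip_rhs b \<gamma> z (\<phi> z)) z - euler_inverse (\<lambda>_. 1/12) z) \<le> 1/24"
  proof (rule euler_inverse_diff_bound)
    show "continuous_on (ball 0 \<delta>) (\<lambda>z. tip_rhs b \<gamma> z (\<phi> z))"
      by (intro holomorphic_on_imp_continuous_on tip_rhs_holomorphic \<gamma> \<delta> \<phi> near)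
    fix w :: complex assume w: "norm w < \<delta>"
    then show "norm (4 * tip_rhs b \<gamma> w (\<phi> w) - 4 * (1/12)) \<le> 1/24"
      using \<delta> by (intro tip_rhs_self_map near tip_smallD[OF b]) auto
  qed (use z in auto)
  then show ?thesis by (simp add: euler_inverse_const)
qed

lemma tip_step_lipschitz:
  assumes b: "tip_small \<gamma> \<delta> b"
    and \<phi>: "\<phi> holomorphic_on ball 0 \<delta>" and near: "\<And>z. norm z < \<delta> \<Longrightarrow> norm (\<phi> z - 1/3) \<le> 1/24"
    and \<phi>': "\<phi>' holomorphic_on ball 0 \<delta>" and near': "\<And>z. norm z < \<delta> \<Longrightarrow> norm (\<phi>' z - 1/3) \<le> 1/24"
    and le: "\<And>z. norm z < \<delta> \<Longrightarrow> norm (\<phi> z - \<phi>' z) \<le> e"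
    and z: "norm z < \<delta>"
  shows "norm (euler_inverse (\<lambda>z. tip_rhs b \<gamma> z (\<phi> z)) z - euler_inverse (\<lambda>z. tip_rhs b' \<gamma> z (\<phi>' z)) z)
    \<le> 1/2 * e + norm (b - b')"
proof (rule euler_inverse_diff_bound)
  show "continuous_on (ball 0 \<delta>) (\<lambda>z. tip_rhs b \<gamma> z (\<phi> z))"
    "continuous_on (ball 0 \<delta>) (\<lambda>z. tip_rhs b' \<gamma> z (\<phi>' z))"
    by (intro holomorphic_on_imp_continuous_on tip_rhs_holomorphic \<gamma> \<delta> \<phi> near \<phi>' near'; simp)+
  fix w :: complex assume w: "norm w < \<delta>"
  then have "norm (4 * tip_rhs b \<gamma> w (\<phi> w) - 4 * tip_rhs b' \<gamma> w (\<phi>' w)) \<le> 1/2 * norm (\<phi> w - \<phi>' w) + norm (b - b')"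
    using \<delta> by (intro tip_rhs_lipschitz near near' tip_smallD[OF b] zg) auto
  then show "norm (4 * tip_rhs b \<gamma> w (\<phi> w) - 4 * tip_rhs b' \<gamma> w (\<phi>' w)) \<le> 1/2 * e + norm (b - b')"
    using le[OF w] by linarith
qed (use z in auto)

lemma tip_iter_props:
  assumes b: "tip_small \<gamma> \<delta> b"
  shows "tip_iter b \<gamma> k holomorphic_on ball 0 \<delta> \<and> (\<forall>z. norm z < \<delta> \<longrightarrow> norm (tip_iter b \<gamma> k z - 1/3) \<le> 1/24)"
proof (induction k)
  case (Suc k)
  then show ?case
    using tip_step_near[OF b, of "tip_iter b \<gamma> k"] tip_rhs_holomorphic[OF \<gamma> \<delta>(2), of "tip_iter b \<gamma> k" b]
    by (auto intro: euler_inverse_holomorphic)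
qed auto

lemma tip_iter_holomorphic:
  assumes "tip_small \<gamma> \<delta> b"
  shows "tip_iter b \<gamma> k holomorphic_on ball 0 \<delta>"
  using tip_iter_props[OF assms] by blast

lemma tip_iter_near:
  assumes "tip_small \<gamma> \<delta> b" "norm z < \<delta>"
  shows "norm (tip_iter b \<gamma> k z - 1/3) \<le> 1/24"
  using tip_iter_props[of b k] assms by blast

lemma tip_iter_step:
  assumes b: "tip_small \<gamma> \<delta> b" and z: "norm z < \<delta>"
  shows "norm (tip_iter b \<gamma> (Suc k) z - tip_iter b \<gamma> k z) \<le> (1/2) ^ k * (1/24)"
  using z
proof (induction k arbitrary: z)
  case 0
  show ?case using tip_iter_near[OF b 0, of 1] by simp
next
  case (Suc k)
  show ?case
    unfolding tip_iter.simps(2)[of b \<gamma> "Suc k"]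
    using tip_step_lipschitz[OF b tip_iter_holomorphic[OF b] tip_iter_near[OF b]
        tip_iter_holomorphic[OF b] tip_iter_near[OF b] Suc.IH Suc.prems, of b]
    by simp
qed

text \<open>Each iterate is the telescoping sum of its increments, which the geometric series of
  \<open>tip_iter_step\<close> dominates. Uniformity is what makes the limit holomorphic.\<close>

lemma tip_iter_uniform_limit:
  assumes b: "tip_small \<gamma> \<delta> b"
  shows "uniform_limit (ball 0 \<delta>) (tip_iter b \<gamma>) (tip_limit b \<gamma>) sequentially"
proof -
  define L where "L = (\<lambda>z. 1/3 + (\<Sum>i. tip_iter b \<gamma> (Suc i) z - tip_iter b \<gamma> i z))"
  have "uniform_limit (ball 0 \<delta>) (\<lambda>n z. \<Sum>i<n. tip_iter b \<gamma> (Suc i) z - tip_iter b \<gamma> i z)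
      (\<lambda>z. \<Sum>i. tip_iter b \<gamma> (Suc i) z - tip_iter b \<gamma> i z) sequentially"
  proof (rule Weierstrass_m_test)
    show "summable (\<lambda>k. (1/2) ^ k * (1/24::real))"
      by (intro summable_mult2 summable_geometric) simp
  qed (use tip_iter_step[OF b] in auto)
  then have "uniform_limit (ball 0 \<delta>) (\<lambda>n z. 1/3 + (\<Sum>i<n. tip_iter b \<gamma> (Suc i) z - tip_iter b \<gamma> i z)) L sequentially"
    unfolding L_def by (intro uniform_limit_intros)
  moreover have "1/3 + (\<Sum>i<n. tip_iter b \<gamma> (Suc i) z - tip_iter b \<gamma> i z) = tip_iter b \<gamma> n z" for n z
    by (subst sum_lessThan_telescope[of "\<lambda>i. tip_iter b \<gamma> i z"]) simp
  ultimately have u: "uniform_limit (ball 0 \<delta>) (tip_iter b \<gamma>) L sequentially" by simp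
  have "tip_limit b \<gamma> z = L z" if "z \<in> ball 0 \<delta>" for z
    unfolding tip_limit_def using tendsto_uniform_limitI[OF u that] by (rule limI)
  then show ?thesis
    using u uniform_limit_cong'[of "ball 0 \<delta>" "tip_iter b \<gamma>" "tip_iter b \<gamma>" "tip_limit b \<gamma>" L] by blast
qed

lemma tip_iter_tendsto:
  assumes "tip_small \<gamma> \<delta> b" "norm z < \<delta>"
  shows "(\<lambda>k. tip_iter b \<gamma> k z) \<longlonglongrightarrow> tip_limit b \<gamma> z"
  using tendsto_uniform_limitI[OF tip_iter_uniform_limit[OF assms(1)], of z] assms(2) by simp

lemma tip_limit_holomorphic:
  assumes b: "tip_small \<gamma> \<delta> b"
  shows "tip_limit b \<gamma> holomorphic_on ball 0 \<delta>"
proof (rule holomorphic_uniform_sequence[OF open_ball tip_iter_holomorphic[OF b]])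
  fix x :: complex assume "x \<in> ball 0 \<delta>"
  then obtain d where "d > 0" "cball x d \<subseteq> ball 0 \<delta>" using open_contains_cball[of "ball 0 \<delta>"] open_ball by blast
  then show "\<exists>d>0. cball x d \<subseteq> ball 0 \<delta> \<and> uniform_limit (cball x d) (tip_iter b \<gamma>) (tip_limit b \<gamma>) sequentially"
    using uniform_limit_on_subset[OF tip_iter_uniform_limit[OF b]] by blast
qed

lemma tip_limit_near:
  assumes b: "tip_small \<gamma> \<delta> b" and z: "norm z < \<delta>"
  shows "norm (tip_limit b \<gamma> z - 1/3) \<le> 1/24"
proof (rule tendsto_upperbound)
  show "(\<lambda>k. norm (tip_iter b \<gamma> k z - 1/3)) \<longlonglongrightarrow> norm (tip_limit b \<gamma> z - 1/3)"
    by (intro tendsto_intros tip_iter_tendsto[OF b z])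
qed (use tip_iter_near[OF b z] in auto)

text \<open>The Lipschitz estimate with b = b' carries the uniform convergence of the iterates
  through the integral operator, so the shifted sequence of iterates converges to both
  sides.\<close>

lemma tip_limit_fixpoint:
  assumes b: "tip_small \<gamma> \<delta> b" and z: "norm z < \<delta>"
  shows "euler_inverse (\<lambda>z. tip_rhs b \<gamma> z (tip_limit b \<gamma> z)) z = tip_limit b \<gamma> z" (is "?I = _")
proof -
  have "(\<lambda>k. tip_iter b \<gamma> (Suc k) z) \<longlonglongrightarrow> ?I"
  proof (rule metric_LIMSEQ_I)
    fix e :: real assume e: "e > 0"
    obtain N where "\<forall>n\<ge>N. \<forall>w\<in>ball 0 \<delta>. dist (tip_iter b \<gamma> n w) (tip_limit b \<gamma> w) < e"
      using uniform_limitD[OF tip_iter_uniform_limit[OF b] e] unfolding eventually_sequentially by blast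
    then have N: "norm (tip_iter b \<gamma> n w - tip_limit b \<gamma> w) < e" if "n \<ge> N" "norm w < \<delta>" for n w
      using that by (simp add: dist_norm)
    have "norm (tip_iter b \<gamma> (Suc n) z - ?I) < e" if "n \<ge> N" for n
    proof -
      have "norm (tip_iter b \<gamma> (Suc n) z - ?I) \<le> 1/2 * e + norm (b - b)"
        unfolding tip_iter.simps(2)
        by (rule tip_step_lipschitz[OF b tip_iter_holomorphic[OF b] tip_iter_near[OF b]
            tip_limit_holomorphic[OF b] tip_limit_near[OF b] less_imp_le[OF N[OF that]] z])
      then show ?thesis using e by simp
    qed
    then show "\<exists>N. \<forall>n\<ge>N. dist (tip_iter b \<gamma> (Suc n) z) ?I < e" unfolding dist_norm by blast
  qed
  moreover have "(\<lambda>k. tip_iter b \<gamma> (Suc k) z) \<longlonglongrightarrow> tip_limit b \<gamma> z"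
    using tip_iter_tendsto[OF b z] by (rule LIMSEQ_Suc)
  ultimately show ?thesis by (rule LIMSEQ_unique)
qed

text \<open>One iteration turns a distance e into at most e/2 + |b - b'|. The bound 2 |b - b'| is
  the fixed point of this map, so all iterates inherit it, and with them the limit.\<close>

lemma tip_limit_parameter:
  assumes b: "tip_small \<gamma> \<delta> b"
    and b': "tip_small \<gamma> \<delta> b'" and z: "norm z < \<delta>"
  shows "norm (tip_limit b \<gamma> z - tip_limit b' \<gamma> z) \<le> 2 * norm (b - b')"
proof (rule tendsto_upperbound)
  show "(\<lambda>k. norm (tip_iter b \<gamma> k z - tip_iter b' \<gamma> k z)) \<longlonglongrightarrow> norm (tip_limit b \<gamma> z - tip_limit b' \<gamma> z)"
    by (intro tendsto_intros tip_iter_tendsto b b' z)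
  have "norm (tip_iter b \<gamma> k z - tip_iter b' \<gamma> k z) \<le> 2 * norm (b - b')" for k
    using z
  proof (induction k arbitrary: z)
    case (Suc k)
    show ?case
      using tip_step_lipschitz[OF b tip_iter_holomorphic[OF b] tip_iter_near[OF b]
          tip_iter_holomorphic[OF b'] tip_iter_near[OF b'] Suc.IH Suc.prems, of b']
      by simp
  qed auto
  then show "\<forall>\<^sub>F k in sequentially. norm (tip_iter b \<gamma> k z - tip_iter b' \<gamma> k z) \<le> 2 * norm (b - b')"
    by simp
qed auto

lemma tip_rhs_Reals:
  assumes "\<bar>v\<bar> < \<delta>" "\<gamma> (of_real v) \<in> \<real>" "w \<in> \<real>" "b \<in> \<real>" "norm (w - 1/3) \<le> 1/24"
  shows "tip_rhs b \<gamma> (of_real v) w \<in> \<real>"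
proof -
  obtain y where y: "w = of_real y" using assms(3) by (auto elim: Reals_cases)
  have "1 - complex_of_real v * w^2 \<notin> \<real>\<^sub>\<le>\<^sub>0" using assms \<delta> by (intro csqrt_near_one) auto
  moreover have *: "1 - complex_of_real v * w^2 = of_real (1 - v * y^2)" by (simp add: y)
  ultimately have "1 - v * y^2 > 0" by (metis nonpos_Reals_of_real_iff not_less)
  then have "csqrt (1 - complex_of_real v * w^2) = of_real (sqrt (1 - v * y^2))"
    unfolding * by (subst of_real_sqrt) auto
  then show ?thesis using assms unfolding tip_rhs_def by auto
qed

text \<open>Real values pass through every iteration. This is what lets the holomorphic solution be
  read as a solution of the real, nonlinear equation.\<close>

lemma tip_limit_Reals:
  assumes b: "tip_small \<gamma> \<delta> b" and v: "\<bar>v\<bar> < \<delta>" and "b \<in> \<real>"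
    and \<gamma>R: "\<And>v. \<bar>v\<bar> < \<delta> \<Longrightarrow> \<gamma> (of_real v) \<in> \<real>"
  shows "tip_limit b \<gamma> (of_real v) \<in> \<real>"
proof -
  have "tip_iter b \<gamma> k (of_real v) \<in> \<real>" for k
    using v
  proof (induction k arbitrary: v)
    case (Suc k)
    show ?case unfolding tip_iter.simps
    proof (rule euler_inverse_Reals[OF _ Suc.prems])
      show "continuous_on (ball 0 \<delta>) (\<lambda>z. tip_rhs b \<gamma> z (tip_iter b \<gamma> k z))"
        by (intro holomorphic_on_imp_continuous_on tip_rhs_holomorphic \<gamma> \<delta>
            tip_iter_holomorphic tip_iter_near b)
      fix u assume "\<bar>u\<bar> < \<delta>"
      then show "tip_rhs b \<gamma> (of_real u) (tip_iter b \<gamma> k (of_real u)) \<in> \<real>"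
        by (intro tip_rhs_Reals \<gamma>R Suc.IH assms tip_iter_near b) auto
    qed
  qed auto
  moreover have "(\<lambda>k. tip_iter b \<gamma> k (of_real v)) \<longlonglongrightarrow> tip_limit b \<gamma> (of_real v)"
    using v by (intro tip_iter_tendsto b) auto
  ultimately show ?thesis
    using closed_sequentially[OF closed_complex_Reals, of "\<lambda>k. tip_iter b \<gamma> k (of_real v)"] by simp
qed

end

text \<open>What the rest of the proof uses about the tip: \<open>e \<beta>\<close> is \<eta> and
  \<open>G \<beta>\<close> is \<rho>, both as functions of v = r^2. One \<delta> serves all \<beta>
  in [0, B], so shooting can leave from a common radius, and \<open>e_par\<close> makes the starting
  point continuous in \<beta>. The bound \<open>\<kappa>\<close> together with \<eta> \<le> 3/8
  gives N < 1 near the tip.\<close>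

locale tip_family =
  fixes g :: "real \<Rightarrow> real" and B \<delta> :: real and e G :: "real \<Rightarrow> real \<Rightarrow> real"
  assumes \<delta>: "0 < \<delta>" "\<delta> \<le> 1/24"
    and e: "\<And>\<beta> v. 0 \<le> \<beta> \<Longrightarrow> \<beta> \<le> B \<Longrightarrow> \<bar>v\<bar> < \<delta> \<Longrightarrow> 7/24 \<le> e \<beta> v \<and> e \<beta> v \<le> 3/8"
    and e0: "\<And>\<beta>. 0 \<le> \<beta> \<Longrightarrow> \<beta> \<le> B \<Longrightarrow> e \<beta> 0 = 1/3"
    and e_cont: "\<And>\<beta> v. 0 \<le> \<beta> \<Longrightarrow> \<beta> \<le> B \<Longrightarrow> \<bar>v\<bar> < \<delta> \<Longrightarrow> isCont (e \<beta>) v"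
    and e': "\<And>\<beta> v. 0 \<le> \<beta> \<Longrightarrow> \<beta> \<le> B \<Longrightarrow> 0 < v \<Longrightarrow> v < \<delta> \<Longrightarrow>
       (e \<beta> has_real_derivative e \<beta> v / (4 * v) * (1 - 3 * e \<beta> v * (\<beta> * v * g v + G \<beta> v))) (at v)"
    and G_an: "\<And>\<beta>. 0 \<le> \<beta> \<Longrightarrow> \<beta> \<le> B \<Longrightarrow> real_analytic_on (G \<beta>) {-\<delta><..<\<delta>}"
    and G: "\<And>\<beta> v. 0 \<le> \<beta> \<Longrightarrow> \<beta> \<le> B \<Longrightarrow> \<bar>v\<bar> < \<delta> \<Longrightarrow> (G \<beta> v)^2 = 1 - v * (e \<beta> v)^2 \<and> 95/96 \<le> G \<beta> v"
    and \<kappa>: "\<And>\<beta> v. 0 \<le> \<beta> \<Longrightarrow> \<beta> \<le> B \<Longrightarrow> \<bar>v\<bar> < \<delta> \<Longrightarrow> \<bar>\<beta> * v * g v + G \<beta> v - 1\<bar> \<le> 1/32"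
    and e_par: "\<And>\<beta> \<beta>' v. 0 \<le> \<beta> \<Longrightarrow> \<beta> \<le> B \<Longrightarrow> 0 \<le> \<beta>' \<Longrightarrow> \<beta>' \<le> B \<Longrightarrow> \<bar>v\<bar> < \<delta> \<Longrightarrow>
       \<bar>e \<beta> v - e \<beta>' v\<bar> \<le> 2 * \<bar>\<beta> - \<beta>'\<bar>"

lemma local_tip_solution:
  fixes g :: "real \<Rightarrow> real"
  assumes an: "real_analytic_on g UNIV" and B: "B \<ge> 1"
  obtains \<delta> e G where "tip_family g B \<delta> e G"
proof -
  obtain \<delta>0 \<gamma> where \<delta>0: "\<delta>0 > 0" and \<gamma>0: "\<gamma> holomorphic_on ball 0 \<delta>0"
    and \<gamma>g: "\<And>v. \<bar>v\<bar> < \<delta>0 \<Longrightarrow> \<gamma> (of_real v) = of_real (g v)"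
    using real_analytic_complexify[OF an] by auto
  have "continuous_on (cball 0 (\<delta>0/2)) \<gamma>"
    by (rule continuous_on_subset[OF holomorphic_on_imp_continuous_on[OF \<gamma>0]]) (use \<delta>0 in auto)
  then have "compact (\<gamma> ` cball 0 (\<delta>0/2))" by (intro compact_continuous_image) auto
  then obtain M where M: "M > 0" "\<And>z. norm z \<le> \<delta>0/2 \<Longrightarrow> norm (\<gamma> z) \<le> M"
    using compact_imp_bounded bounded_pos by (metis imageI mem_cball_0)
  \<comment> \<open>Half of \<open>\<delta>0\<close> keeps \<open>\<gamma>\<close> bounded by
    \<open>M\<close>, 1/24 is the range of the estimates for \<open>tip_rhs\<close>, and 1/(48 B M)
    makes \<beta> z \<gamma>(z) at most 1/48 for all \<beta> \<le> B.\<close>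
  define \<delta> where "\<delta> = min (\<delta>0/2) (min (1/24) (1 / (48 * B * M)))"
  have \<delta>: "0 < \<delta>" "\<delta> \<le> 1/24" "\<delta> \<le> \<delta>0/2" "\<delta> \<le> 1 / (48 * B * M)"
    using \<delta>0 B M by (auto simp: \<delta>_def)
  have \<gamma>: "\<gamma> holomorphic_on ball 0 \<delta>" using \<gamma>0 by (rule holomorphic_on_subset) (use \<delta> \<delta>0 in auto)
  have zgB: "norm (z * \<gamma> z) \<le> 1 / (48 * B)" if "norm z < \<delta>" for z
  proof -
    have "norm (z * \<gamma> z) \<le> 1 / (48 * B * M) * M"
      unfolding norm_mult using that \<delta> M(2)[of z] M(1) B by (intro mult_mono) auto
    then show ?thesis using M(1) by simp
  qed
  have zg: "norm (z * \<gamma> z) \<le> 1" if "norm z < \<delta>" for z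
    by (rule order_trans[OF zgB[OF that]]) (use B in auto)
  have b: "norm (of_real \<beta> * (z * \<gamma> z)) \<le> 1/48" if \<beta>: "0 \<le> \<beta>" "\<beta> \<le> B" and z: "norm z < \<delta>" for \<beta> z
  proof -
    have "norm (complex_of_real \<beta>) * norm (z * \<gamma> z) \<le> B * (1 / (48 * B))"
      using \<beta> zgB[OF z] B by (intro mult_mono) auto
    then show ?thesis using B by (simp add: norm_mult)
  qed
  have bs: "tip_small \<gamma> \<delta> (of_real \<beta>)" if "0 \<le> \<beta>" "\<beta> \<le> B" for \<beta>
    unfolding tip_small_def using b[OF that] by simp
  define \<phi> where "\<phi> = (\<lambda>\<beta>::real. tip_limit (of_real \<beta>) \<gamma>)"
  define e where "e = (\<lambda>\<beta> v. Re (\<phi> \<beta> (of_real v)))"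
  define G where "G = (\<lambda>\<beta> v. Re (csqrt (1 - of_real v * (\<phi> \<beta> (of_real v))^2)))"
  note lim = tip_limit_holomorphic[OF \<gamma> \<delta>(1,2) zg bs] tip_limit_near[OF \<gamma> \<delta>(1,2) zg bs]
    tip_limit_fixpoint[OF \<gamma> \<delta>(1,2) zg bs] tip_limit_parameter[OF \<gamma> \<delta>(1,2) zg bs bs]
    tip_limit_Reals[OF \<gamma> \<delta>(1,2) zg bs]
  have \<phi>e: "\<phi> \<beta> (of_real v) = of_real (e \<beta> v)" if "0 \<le> \<beta>" "\<beta> \<le> B" "\<bar>v\<bar> < \<delta>" for \<beta> v
    using lim(5)[of \<beta> v] that \<gamma>g \<delta> unfolding e_def \<phi>_def by auto
  have near: "norm (\<phi> \<beta> z - 1/3) \<le> 1/24" if "0 \<le> \<beta>" "\<beta> \<le> B" "norm z < \<delta>" for \<beta> z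
    unfolding \<phi>_def by (rule lim(2)) (use that in auto)
  have near_e: "\<bar>e \<beta> v - 1/3\<bar> \<le> 1/24" if "0 \<le> \<beta>" "\<beta> \<le> B" "\<bar>v\<bar> < \<delta>" for \<beta> v
    using near[of \<beta> "of_real v"] abs_Re_le_cmod[of "\<phi> \<beta> (of_real v) - 1/3"] that by (simp add: e_def)
  have sq: "csqrt (1 - of_real v * (\<phi> \<beta> (of_real v))^2) = of_real (sqrt (1 - v * (e \<beta> v)^2))"
    "1 - v * (e \<beta> v)^2 > 0" if "0 \<le> \<beta>" "\<beta> \<le> B" "\<bar>v\<bar> < \<delta>" for \<beta> v
  proof -
    have "1 - of_real v * (\<phi> \<beta> (of_real v))^2 \<notin> \<real>\<^sub>\<le>\<^sub>0"
      by (rule csqrt_near_one) (use that \<delta> near in auto)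
    moreover have *: "1 - of_real v * (\<phi> \<beta> (of_real v))^2 = of_real (1 - v * (e \<beta> v)^2)"
      using \<phi>e[OF that] by simp
    ultimately show 1: "1 - v * (e \<beta> v)^2 > 0" by (metis nonpos_Reals_of_real_iff not_less)
    show "csqrt (1 - of_real v * (\<phi> \<beta> (of_real v))^2) = of_real (sqrt (1 - v * (e \<beta> v)^2))"
      unfolding * using 1 by (subst of_real_sqrt) auto
  qed
  have Gsq: "G \<beta> v = sqrt (1 - v * (e \<beta> v)^2)"
    "csqrt (1 - of_real v * (\<phi> \<beta> (of_real v))^2) = of_real (G \<beta> v)"
    if "0 \<le> \<beta>" "\<beta> \<le> B" "\<bar>v\<bar> < \<delta>" for \<beta> v
    using sq(1)[OF that] by (simp_all add: G_def del: csqrt.sel)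
  have hol_rhs: "(\<lambda>z. tip_rhs (of_real \<beta>) \<gamma> z (\<phi> \<beta> z)) holomorphic_on ball 0 \<delta>"
    if "0 \<le> \<beta>" "\<beta> \<le> B" for \<beta>
    unfolding \<phi>_def by (rule tip_rhs_holomorphic[OF \<gamma> \<delta>(2) lim(1) lim(2)]) (use that in auto)
  have der: "(e \<beta> has_real_derivative D) (at v) \<and>
      v * D + e \<beta> v / 4 = e \<beta> v / 2 - 3/4 * (e \<beta> v)^2 * (\<beta> * (v * g v) + G \<beta> v)"
    if \<beta>: "0 \<le> \<beta>" "\<beta> \<le> B" and av: "\<bar>v\<bar> < \<delta>" and D: "D = Re (deriv (\<phi> \<beta>) (of_real v))" for \<beta> v D
  proof -
    define H where "H = (\<lambda>z. tip_rhs (of_real \<beta>) \<gamma> z (\<phi> \<beta> z))"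
    have v: "norm (complex_of_real v) < \<delta>" using av by simp
    have fixp: "euler_inverse H z = \<phi> \<beta> z" if "norm z < \<delta>" for z
      unfolding H_def \<phi>_def by (rule lim(3)) (use that \<beta> in auto)
    obtain D' where D': "(euler_inverse H has_field_derivative D') (at (of_real v))"
      "of_real v * D' + euler_inverse H (of_real v) / 4 = H (of_real v)"
      using euler_inverse_derivative[OF hol_rhs[OF \<beta>] v] unfolding H_def by blast
    have d: "(\<phi> \<beta> has_field_derivative D') (at (of_real v))"
      by (rule has_field_derivative_transform_within_open[OF D'(1), of "ball 0 \<delta>"]) (use v fixp in auto)
    have "D = Re D'" using DERIV_imp_deriv[OF d] D by simp
    then have "(e \<beta> has_real_derivative D) (at v)"
      unfolding e_def using has_field_derivative_Re_of_real[OF d] by simp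
    moreover have "H (of_real v) = of_real (e \<beta> v / 2 - 3/4 * (e \<beta> v)^2 * (\<beta> * (v * g v) + G \<beta> v))"
      unfolding H_def tip_rhs_def Gsq(2)[OF \<beta> av] using \<phi>e[OF \<beta> av] \<gamma>g[of v] av \<delta> \<delta>0
      by simp
    then have "Re (of_real v * D' + of_real (e \<beta> v) / 4) = e \<beta> v / 2 - 3/4 * (e \<beta> v)^2 * (\<beta> * (v * g v) + G \<beta> v)"
      using D'(2) fixp[OF v] \<phi>e[OF \<beta> av] by simp
    ultimately show ?thesis using \<open>D = Re D'\<close> by simp
  qed
  have "tip_family g B \<delta> e G"
  proof
    fix \<beta> :: real assume \<beta>: "0 \<le> \<beta>" "\<beta> \<le> B"
    \<comment> \<open>At v = 0 the derivative term drops out and an algebraic equation remains; its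
      root 0 is too far from 1/3.\<close>
    have "e \<beta> 0 / 4 = e \<beta> 0 / 2 - 3/4 * (e \<beta> 0)^2"
      using der[OF \<beta> _ refl, of 0] \<delta>(1) Gsq(1)[OF \<beta>, of 0] by simp
    then have "e \<beta> 0 * (e \<beta> 0 - 1/3) = 0" by (simp add: field_simps power2_eq_square)
    then show "e \<beta> 0 = 1/3" using near_e[OF \<beta>, of 0] \<delta>(1) by (auto simp: abs_if split: if_splits)
    have "(\<lambda>z. csqrt (1 - z * (\<phi> \<beta> z)^2)) holomorphic_on ball 0 \<delta>"
      using lim(1)[of \<beta>] \<beta> \<delta> near[OF \<beta>] unfolding \<phi>_def[symmetric]
      by (intro holomorphic_intros csqrt_near_one) (auto simp: \<phi>_def)
    then show "real_analytic_on (G \<beta>) {-\<delta><..<\<delta>}"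
      unfolding G_def by (rule holomorphic_imp_real_analytic)
    fix v :: real assume v: "\<bar>v\<bar> < \<delta>"
    show "7/24 \<le> e \<beta> v \<and> e \<beta> v \<le> 3/8" using near_e[OF \<beta> v] unfolding abs_le_iff by linarith
    show "isCont (e \<beta>) v" using der[OF \<beta> v refl] DERIV_isCont by blast
    have n: "norm (csqrt (1 - of_real v * (\<phi> \<beta> (of_real v))^2) - 1) \<le> norm (complex_of_real v) / 4"
      by (rule csqrt_near_one) (use v \<delta> near[OF \<beta>] in auto)
    have "norm (complex_of_real (G \<beta> v) - 1) = \<bar>G \<beta> v - 1\<bar>"
      by (metis norm_of_real of_real_1 of_real_diff)
    then have "95/96 \<le> G \<beta> v" using n[unfolded Gsq(2)[OF \<beta> v]] v \<delta> unfolding norm_of_real by linarith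
    then show "(G \<beta> v)^2 = 1 - v * (e \<beta> v)^2 \<and> 95/96 \<le> G \<beta> v"
      using Gsq(1)[OF \<beta> v] sq(2)[OF \<beta> v] by simp
    have "norm (of_real \<beta> * (of_real v * \<gamma> (of_real v)) + csqrt (1 - of_real v * (\<phi> \<beta> (of_real v))^2) - 1) \<le> 1/32"
      by (rule tip_kappa_bound) (use v \<delta> near[OF \<beta>] b[OF \<beta>] in auto)
    moreover have "of_real \<beta> * (of_real v * \<gamma> (of_real v)) + csqrt (1 - of_real v * (\<phi> \<beta> (of_real v))^2) - 1
       = complex_of_real (\<beta> * v * g v + G \<beta> v - 1)"
      unfolding Gsq(2)[OF \<beta> v] using \<gamma>g[of v] v \<delta> \<delta>0 by simp
    ultimately show "\<bar>\<beta> * v * g v + G \<beta> v - 1\<bar> \<le> 1/32" by (simp only: norm_of_real)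
  next
    fix \<beta> v :: real assume \<beta>: "0 \<le> \<beta>" "\<beta> \<le> B" and v: "0 < v" "v < \<delta>"
    have "v * (e \<beta> v / (4 * v) * (1 - 3 * e \<beta> v * (\<beta> * v * g v + G \<beta> v)))
        = e \<beta> v / 2 - 3/4 * (e \<beta> v)^2 * (\<beta> * (v * g v) + G \<beta> v) - e \<beta> v / 4"
      using v by (simp add: field_simps power2_eq_square)
    then have "v * (e \<beta> v / (4 * v) * (1 - 3 * e \<beta> v * (\<beta> * v * g v + G \<beta> v))) = v * Re (deriv (\<phi> \<beta>) (of_real v))"
      using der[OF \<beta> _ refl, of v] v by auto
    then have "e \<beta> v / (4 * v) * (1 - 3 * e \<beta> v * (\<beta> * v * g v + G \<beta> v)) = Re (deriv (\<phi> \<beta>) (of_real v))"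
      using v by (metis less_irrefl mult_left_cancel)
    then show "(e \<beta> has_real_derivative e \<beta> v / (4 * v) * (1 - 3 * e \<beta> v * (\<beta> * v * g v + G \<beta> v))) (at v)"
      using der[OF \<beta> _ refl, of v] v by auto
  next
    fix \<beta> \<beta>' v :: real assume "0 \<le> \<beta>" "\<beta> \<le> B" "0 \<le> \<beta>'" "\<beta>' \<le> B" "\<bar>v\<bar> < \<delta>"
    then have "norm (\<phi> \<beta> (of_real v) - \<phi> \<beta>' (of_real v)) \<le> 2 * norm (complex_of_real \<beta> - of_real \<beta>')"
      unfolding \<phi>_def by (intro lim(4)) auto
    moreover have "\<bar>e \<beta> v - e \<beta>' v\<bar> \<le> norm (\<phi> \<beta> (of_real v) - \<phi> \<beta>' (of_real v))"
      using abs_Re_le_cmod[of "\<phi> \<beta> (of_real v) - \<phi> \<beta>' (of_real v)"] by (simp add: e_def)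
    ultimately show "\<bar>e \<beta> v - e \<beta>' v\<bar> \<le> 2 * \<bar>\<beta> - \<beta>'\<bar>"
      by (simp flip: of_real_diff)
  qed (use \<delta> in auto)
  then show thesis by (rule that)
qed

section \<open>Uniqueness\<close>

lemma toy_eta_derivative:
  fixes \<rho> r :: "real \<Rightarrow> real"
  assumes \<rho>: "(\<rho> has_real_derivative toy_rhs g \<beta> (\<rho> s) (r s)) (at s)"
    and r: "(r has_real_derivative \<rho> s) (at s)" and pos: "r s > 0" "\<bar>\<rho> s\<bar> < 1"
    and \<eta>: "\<eta> = sqrt (1 - (\<rho> s)^2) / r s"
  shows "((\<lambda>s. sqrt (1 - (\<rho> s)^2) / r s) has_real_derivative
      \<rho> s * (\<eta> * (1 - 3 * \<eta> * (\<beta> * (r s)^2 * g ((r s)^2) + \<rho> s))) / (2 * r s)) (at s)"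
proof -
  define q where "q = sqrt (1 - (\<rho> s)^2)"
  have "(\<rho> s)^2 < 1" using pos(2) by (simp add: abs_square_less_1)
  then have q: "q > 0" "q^2 = 1 - (\<rho> s)^2" by (auto simp: q_def)
  define X where "X = \<beta> * (r s)^2 * g ((r s)^2) + \<rho> s"
  have T: "toy_rhs g \<beta> (\<rho> s) (r s) = 3/2 * q^2 / r s * (-1 + q * X / r s)"
    by (simp add: toy_rhs_def q(2) X_def) (simp add: q_def)
  have "((\<lambda>s. sqrt (1 - (\<rho> s)^2) / r s) has_real_derivative
      ((inverse q / 2 * (- (2 * \<rho> s * toy_rhs g \<beta> (\<rho> s) (r s)))) * r s - q * \<rho> s) / (r s * r s)) (at s)"
    using q pos(1) \<open>(\<rho> s)\<^sup>2 < 1\<close>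
    by (auto intro!: derivative_eq_intros \<rho> r simp: q_def)
  moreover have "((inverse q / 2 * (- (2 * \<rho> s * toy_rhs g \<beta> (\<rho> s) (r s)))) * r s - q * \<rho> s) / (r s * r s)
     = \<rho> s * (\<eta> * (1 - 3 * \<eta> * X)) / (2 * r s)"
    unfolding T \<eta> q_def[symmetric] using q(1) pos(1) by (simp add: field_simps power2_eq_square)
  ultimately show ?thesis by (simp add: X_def)
qed

text \<open>Otherwise \<eta> (1 - 3 \<eta> (\<beta> r^2 g(r^2) + \<rho>)) tends to some c \<noteq>
  0, and \<eta>' behaves like (c/2) (ln r)'. Then \<eta> would change by a logarithmically divergent
  amount on the way to the tip, contrary to the finite limit in (S1).\<close>

lemma toy_eta_limit:
  assumes toy: "toy_steady_tip_growth g \<beta> \<rho> r" and g: "isCont g 0"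
  shows "((\<lambda>s. sqrt (1 - (\<rho> s)^2) / r s) \<longlongrightarrow> 1/3) (at_right 0)"
proof -
  have S: "-1 < \<rho> s" "\<rho> s < 1" "0 < r s" "(\<rho> has_real_derivative toy_rhs g \<beta> (\<rho> s) (r s)) (at s)"
    "(r has_real_derivative \<rho> s) (at s)" "0 < \<rho> s" if "s > 0" for s
    using toy that by (auto simp: toy_steady_tip_growth_def)
  have lim: "(\<rho> \<longlongrightarrow> 1) (at_right 0)" "(r \<longlongrightarrow> 0) (at_right 0)"
    using toy by (auto simp: toy_steady_tip_growth_def)
  define \<eta> where "\<eta> = (\<lambda>s. sqrt (1 - (\<rho> s)^2) / r s)"
  obtain \<eta>0 where \<eta>0: "\<eta>0 > 0" "(\<eta> \<longlongrightarrow> \<eta>0) (at_right 0)"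
    using toy by (auto simp: toy_steady_tip_growth_def \<eta>_def)
  define w where "w = (\<lambda>s. \<eta> s * (1 - 3 * \<eta> s * (\<beta> * (r s)^2 * g ((r s)^2) + \<rho> s)))"
  have "((\<lambda>s. (r s)^2) \<longlongrightarrow> 0) (at_right 0)" using tendsto_power[OF lim(2), of 2] by simp
  then have "((\<lambda>s. g ((r s)^2)) \<longlongrightarrow> g 0) (at_right 0)" by (rule isCont_tendsto_compose[OF g])
  then have "(w \<longlongrightarrow> \<eta>0 * (1 - 3 * \<eta>0 * (\<beta> * 0^2 * g 0 + 1))) (at_right 0)"
    unfolding w_def by (intro tendsto_intros \<eta>0 lim)
  then have w: "(w \<longlongrightarrow> \<eta>0 * (1 - 3 * \<eta>0)) (at_right 0)" by simp
  have "\<eta>0 = 1/3"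
  proof (rule ccontr)
    assume "\<eta>0 \<noteq> 1/3"
    define c where "c = \<eta>0 * (1 - 3 * \<eta>0)"
    have c: "c \<noteq> 0" using \<open>\<eta>0 \<noteq> 1/3\<close> \<eta>0 by (auto simp: c_def)
    define \<zeta> where "\<zeta> = sgn c"
    have "\<zeta> * c = \<bar>c\<bar>" by (simp add: \<zeta>_def abs_sgn mult.commute)
    then have "((\<lambda>s. \<zeta> * w s) \<longlongrightarrow> \<bar>c\<bar>) (at_right 0)"
      using tendsto_mult_left[OF w, of \<zeta>] by (simp add: c_def)
    then have "\<forall>\<^sub>F s in at_right 0. \<bar>c\<bar> / 2 < \<zeta> * w s"
      by (rule order_tendstoD) (use c in simp)
    then obtain s1 where s1: "s1 > 0" "\<And>s. 0 < s \<Longrightarrow> s < s1 \<Longrightarrow> \<bar>c\<bar> / 2 < \<zeta> * w s"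
      by (auto simp: eventually_at_right_field)
    \<comment> \<open>Since \<zeta> w > |c|/2 near the tip, \<zeta> \<eta> grows at least as fast as
      (|c|/4) ln r. So V is nondecreasing there, although it tends to infinity at 0.\<close>
    define V where "V = (\<lambda>s. \<zeta> * \<eta> s + (\<bar>c\<bar> / 4) * (- ln (r s)))"
    define s2 where "s2 = s1 / 2"
    have s2: "0 < s2" "s2 < s1" using s1 by (auto simp: s2_def)
    have mono: "V s \<le> V s2" if s: "0 < s" "s \<le> s2" for s
    proof (rule DERIV_nonneg_imp_nondecreasing[OF s(2)])
      fix x assume x: "s \<le> x" "x \<le> s2"
      then have x0: "0 < x" "x < s1" using s s2 by auto
      have d: "(\<eta> has_real_derivative \<rho> x * w x / (2 * r x)) (at x)"
        unfolding \<eta>_def w_def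
        by (rule toy_eta_derivative) (use S[OF x0(1)] in auto)
      have l: "((\<lambda>s. - ln (r s)) has_real_derivative - (\<rho> x / r x)) (at x)"
        using S(3,5)[OF x0(1)] by (auto intro!: derivative_eq_intros)
      have "(V has_real_derivative (\<zeta> * (\<rho> x * w x / (2 * r x)) + (\<bar>c\<bar> / 4) * (- (\<rho> x / r x)))) (at x)"
        unfolding V_def by (intro DERIV_add DERIV_cmult d l)
      moreover have "\<zeta> * (\<rho> x * w x / (2 * r x)) + (\<bar>c\<bar> / 4) * (- (\<rho> x / r x))
          = \<rho> x / (2 * r x) * (\<zeta> * w x - \<bar>c\<bar> / 2)"
        using S[OF x0(1)] by (simp add: field_simps)
      moreover have "0 \<le> \<rho> x / (2 * r x) * (\<zeta> * w x - \<bar>c\<bar> / 2)"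
        using S[OF x0(1)] s1(2)[OF x0] by (intro mult_nonneg_nonneg) auto
      ultimately show "\<exists>y. (V has_real_derivative y) (at x) \<and> 0 \<le> y" by metis
    qed
    have "\<forall>\<^sub>F s in at_right 0. r s \<in> {0<..} \<and> r s \<noteq> 0"
      using eventually_at_right_less[of "0::real"] by eventually_elim (use S(3) in force)
    then have "filterlim r (at_right 0) (at_right 0)"
      unfolding filterlim_at using lim(2) by simp
    then have "filterlim (\<lambda>s. ln (r s)) at_bot (at_right 0)"
      by (rule filterlim_compose[OF ln_at_0])
    then have "filterlim (\<lambda>s. - ln (r s)) at_top (at_right 0)"
      by (simp add: filterlim_uminus_at_bot)
    then have "filterlim (\<lambda>s. (\<bar>c\<bar> / 4) * (- ln (r s))) at_top (at_right 0)"
      by (intro filterlim_tendsto_pos_mult_at_top[OF tendsto_const]) (use c in auto)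
    moreover have "((\<lambda>s. \<zeta> * \<eta> s) \<longlongrightarrow> \<zeta> * \<eta>0) (at_right 0)" by (intro tendsto_intros \<eta>0)
    ultimately have "filterlim V at_top (at_right 0)"
      unfolding V_def by (intro filterlim_tendsto_add_at_top)
    then have "\<forall>\<^sub>F s in at_right 0. V s2 < V s" by (simp add: filterlim_at_top_dense)
    then obtain s3 where s3: "s3 > 0" "\<And>s. 0 < s \<Longrightarrow> s < s3 \<Longrightarrow> V s2 < V s"
      by (auto simp: eventually_at_right_field)
    define s where "s = min s2 (s3/2)"
    have "0 < s" "s \<le> s2" "s < s3" using s2 s3 by (auto simp: s_def)
    then show False using mono[of s] s3(2)[of s] by simp
  qed
  then show ?thesis using \<eta>0(2) unfolding \<eta>_def by (simp only:)
qed

text \<open>By \<rho> > 0 the radius increases strictly from 0 to its limit, so it can replace s as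
  independent variable. Two solutions then become comparable point by point.\<close>

lemma toy_radial_inverse:
  assumes toy: "toy_steady_tip_growth g \<beta> \<rho> r"
  obtains \<sigma> R where "R > 0" "(r \<longlongrightarrow> R) at_top"
    "\<And>s. s > 0 \<Longrightarrow> 0 < r s \<and> r s < R \<and> \<sigma> (r s) = s"
    "\<And>x. 0 < x \<Longrightarrow> x < R \<Longrightarrow> 0 < \<sigma> x \<and> r (\<sigma> x) = x \<and> (\<sigma> has_real_derivative 1 / \<rho> (\<sigma> x)) (at x)"
    "filterlim \<sigma> (at_right 0) (at_right 0)"
proof -
  have S: "0 < r s" "(r has_real_derivative \<rho> s) (at s)" "0 < \<rho> s" if "s > 0" for s
    using toy that by (auto simp: toy_steady_tip_growth_def)
  have lim: "(r \<longlongrightarrow> 0) (at_right 0)" using toy by (auto simp: toy_steady_tip_growth_def)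
  obtain R where R: "R > 0" "(r \<longlongrightarrow> R) at_top" using toy by (auto simp: toy_steady_tip_growth_def)
  have inc: "r a < r b" if "0 < a" "a < b" for a b
  proof (rule DERIV_pos_imp_increasing[OF that(2)])
    fix x assume "a \<le> x"
    then show "\<exists>y. (r has_real_derivative y) (at x) \<and> 0 < y"
      using S[of x] that by (intro exI[of _ "\<rho> x"]) auto
  qed
  have rR: "r s < R" if "s > 0" for s
  proof -
    have "r (s+1) \<le> R"
      by (rule tendsto_lowerbound[OF R(2)])
         (use inc[of "s+1"] that in \<open>auto intro!: eventually_mono[OF eventually_gt_at_top[of "s+1"]] less_imp_le\<close>)
    then show ?thesis using inc[of s "s+1"] that by simp
  qed
  have surj: "\<exists>s>0. r s = x" if x: "0 < x" "x < R" for x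
  proof -
    have "\<forall>\<^sub>F s in at_right 0. r s < x" by (rule order_tendstoD(2)[OF lim x(1)])
    then obtain d where d: "d > 0" "\<And>s. 0 < s \<Longrightarrow> s < d \<Longrightarrow> r s < x" by (auto simp: eventually_at_right_field)
    have "\<forall>\<^sub>F s in at_top. x < r s" by (rule order_tendstoD(1)[OF R(2) x(2)])
    then obtain b where b: "\<And>s. s \<ge> b \<Longrightarrow> x < r s" by (auto simp: eventually_at_top_linorder)
    define a where "a = d/2" define b' where "b' = max b (a+1)"
    have "0 < a" "r a < x" "x < r b'" using d b by (auto simp: a_def b'_def)
    moreover have "a \<le> b'" by (simp add: b'_def le_max_iff_disj)
    moreover have "isCont r s" if "a \<le> s" for s
      using S(2)[of s] that \<open>0 < a\<close> DERIV_isCont by force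
    ultimately have "\<exists>s\<ge>a. s \<le> b' \<and> r s = x" by (intro IVT) auto
    then show ?thesis using \<open>0 < a\<close> less_le_trans by blast
  qed
  define \<sigma> where "\<sigma> = inv_into {0<..} r"
  have inj: "inj_on r {0<..}" by (rule strict_mono_on_imp_inj_on) (auto simp: strict_mono_on_def inc)
  have \<sigma>r: "\<sigma> (r s) = s" if "s > 0" for s
    unfolding \<sigma>_def by (rule inv_into_f_f[OF inj]) (use that in simp)
  have r\<sigma>: "0 < \<sigma> x \<and> r (\<sigma> x) = x" if "0 < x" "x < R" for x
    using surj[OF that] \<sigma>r by force
  show thesis
  proof
    show "R > 0" "(r \<longlongrightarrow> R) at_top" by fact+
    show "0 < r s \<and> r s < R \<and> \<sigma> (r s) = s" if "s > 0" for s using S rR \<sigma>r that by blast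
    show "0 < \<sigma> x \<and> r (\<sigma> x) = x \<and> (\<sigma> has_real_derivative 1 / \<rho> (\<sigma> x)) (at x)"
      if x: "0 < x" "x < R" for x
    proof -
      have "(\<sigma> has_real_derivative inverse (\<rho> (\<sigma> x))) (at x)"
      proof (rule has_field_derivative_inverse_strong_x[where S = "{0<..}"])
        show "(r has_real_derivative \<rho> (\<sigma> x)) (at (\<sigma> x))" "\<rho> (\<sigma> x) \<noteq> 0"
          using S[of "\<sigma> x"] r\<sigma>[OF x] by auto
        show "continuous_on {0<..} r"
          using S(2) by (intro continuous_at_imp_continuous_on ballI) (auto intro: DERIV_isCont)
      qed (use r\<sigma>[OF x] \<sigma>r in auto)
      then show ?thesis using r\<sigma>[OF x] by (simp add: inverse_eq_divide)
    qed
    show "filterlim \<sigma> (at_right 0) (at_right 0)"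
    proof -
      have "(\<sigma> \<longlongrightarrow> 0) (at_right 0)"
      proof (rule tendstoI)
        fix e :: real assume e: "e > 0"
        have "\<bar>\<sigma> x\<bar> < e" if "0 < x" "x < r e" for x
        proof -
          have "x < R" using that rR[OF e] by simp
          then have "0 < \<sigma> x" "r (\<sigma> x) = x" using r\<sigma> that by auto
          then show ?thesis using inc[OF e, of "\<sigma> x"] that by (cases "e < \<sigma> x"; cases "e = \<sigma> x") auto
        qed
        then show "\<forall>\<^sub>F x in at_right 0. dist (\<sigma> x) 0 < e"
          unfolding eventually_at_right_field using S(1)[OF e] by (auto simp: dist_norm)
      qed
      moreover have "\<forall>\<^sub>F x in at_right 0. 0 < \<sigma> x"
        unfolding eventually_at_right_field using R(1) r\<sigma> by blast
      ultimately show ?thesis unfolding filterlim_at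
        by (auto elim: eventually_mono)
    qed
  qed
qed

text \<open>The right-hand side contains \<eta> also through \<rho> = H. Writing H1 - H2 = - x^2
  (E1^2 - E2^2) / (H1 + H2) brings out the factor E1 - E2 exactly, with a coefficient that stays
  regular at the tip.\<close>

lemma toy_difference_factor:
  fixes E1 E2 H1 H2 F x :: real
  assumes H: "H1^2 = 1 - x^2 * E1^2" "H2^2 = 1 - x^2 * E2^2" "H1 > 0" "H2 > 0"
  shows "E1 * (1 - 3 * E1 * (F + H1)) - E2 * (1 - 3 * E2 * (F + H2)) =
    (1 - 3 * (E1 + E2) * (F + H1 - E2^2 * x^2 / (H1 + H2))) * (E1 - E2)"
proof -
  have "(H1 - H2) * (H1 + H2) = - (x^2 * (E1^2 - E2^2))"
    using H(1,2) by (simp add: algebra_simps power2_eq_square)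
  moreover define h where "h = 1 / (H1 + H2)"
  moreover have "(H1 - H2) * (H1 + H2) * h = H1 - H2" using H(3,4) by (simp add: h_def)
  ultimately have eq: "H1 - H2 = - (x^2 * (E1^2 - E2^2)) * h" by simp
  define Y where "Y = E2^2 * x^2 * h"
  have key: "E2^2 * (H1 - H2) = - ((E1^2 - E2^2) * Y)"
    unfolding eq Y_def by (simp add: algebra_simps)
  have "E1 * (1 - 3 * E1 * (F + H1)) - E2 * (1 - 3 * E2 * (F + H2)) =
     (E1 - E2) - 3 * (E1^2 - E2^2) * (F + H1) - 3 * (E2^2 * (H1 - H2))"
    by (simp add: algebra_simps power2_eq_square)
  also have "\<dots> = (1 - 3 * (E1 + E2) * (F + H1 - Y)) * (E1 - E2)"
    unfolding key by (simp add: algebra_simps power2_eq_square)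
  finally show ?thesis by (simp add: Y_def h_def)
qed

text \<open>A solution parametrised by its radius x: \<open>\<sigma>\<close> is the time s,
  \<open>E\<close> is \<eta> and \<open>H\<close> is \<rho>.\<close>

locale radial_profile =
  fixes g :: "real \<Rightarrow> real" and \<beta> :: real and \<rho> r :: "real \<Rightarrow> real" and R :: real
    and \<sigma> E H :: "real \<Rightarrow> real"
  assumes radius: "R > 0" "(r \<longlongrightarrow> R) at_top"
    and position: "\<And>s. s > 0 \<Longrightarrow> 0 < r s \<and> r s < R \<and> \<sigma> (r s) = s \<and> H (r s) = \<rho> s"
    and time: "\<And>x. 0 < x \<Longrightarrow> x < R \<Longrightarrow> 0 < \<sigma> x \<and> r (\<sigma> x) = x \<and> (\<sigma> has_real_derivative 1 / H x) (at x)"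
    and speed: "\<And>x. 0 < x \<Longrightarrow> x < R \<Longrightarrow> 0 < H x \<and> (H x)^2 = 1 - x^2 * (E x)^2 \<and> isCont H x"
    and eta: "\<And>x. 0 < x \<Longrightarrow> x < R \<Longrightarrow>
      (E has_real_derivative E x * (1 - 3 * E x * (\<beta> * x^2 * g (x^2) + H x)) / (2 * x)) (at x)"
    and limits: "(\<sigma> \<longlongrightarrow> 0) (at_right 0)" "(E \<longlongrightarrow> 1/3) (at_right 0)" "(H \<longlongrightarrow> 1) (at_right 0)"

lemma toy_radial_profile:
  assumes toy: "toy_steady_tip_growth g \<beta> \<rho> r" and g: "isCont g 0"
  obtains R \<sigma> E H where "radial_profile g \<beta> \<rho> r R \<sigma> E H"
proof -
  have S: "-1 < \<rho> s" "\<rho> s < 1" "0 < r s" "(\<rho> has_real_derivative toy_rhs g \<beta> (\<rho> s) (r s)) (at s)"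
    "(r has_real_derivative \<rho> s) (at s)" "0 < \<rho> s" if "s > 0" for s
    using toy that by (auto simp: toy_steady_tip_growth_def)
  obtain \<sigma> R where R: "R > 0" "(r \<longlongrightarrow> R) at_top"
    and r: "\<And>s. s > 0 \<Longrightarrow> 0 < r s \<and> r s < R \<and> \<sigma> (r s) = s"
    and \<sigma>: "\<And>x. 0 < x \<Longrightarrow> x < R \<Longrightarrow> 0 < \<sigma> x \<and> r (\<sigma> x) = x \<and> (\<sigma> has_real_derivative 1 / \<rho> (\<sigma> x)) (at x)"
    and \<sigma>0: "filterlim \<sigma> (at_right 0) (at_right 0)"
    by (rule toy_radial_inverse[OF toy]) (rule that)
  define \<eta> where "\<eta> = (\<lambda>s. sqrt (1 - (\<rho> s)^2) / r s)"
  define E where "E = (\<lambda>x. \<eta> (\<sigma> x))"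
  define H where "H = (\<lambda>x. \<rho> (\<sigma> x))"
  have "radial_profile g \<beta> \<rho> r R \<sigma> E H"
  proof
    show "R > 0" "(r \<longlongrightarrow> R) at_top" by fact+
    show "0 < r s \<and> r s < R \<and> \<sigma> (r s) = s \<and> H (r s) = \<rho> s" if "s > 0" for s
      using r[OF that] by (simp add: H_def)
    show "(\<sigma> \<longlongrightarrow> 0) (at_right 0)" using \<sigma>0 by (simp add: filterlim_at)
    show "(E \<longlongrightarrow> 1/3) (at_right 0)"
      unfolding E_def \<eta>_def by (rule filterlim_compose[OF toy_eta_limit[OF toy g] \<sigma>0])
    have "(\<rho> \<longlongrightarrow> 1) (at_right 0)" using toy by (auto simp: toy_steady_tip_growth_def)
    then show "(H \<longlongrightarrow> 1) (at_right 0)" unfolding H_def by (rule filterlim_compose[OF _ \<sigma>0])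
    fix x assume x: "0 < x" "x < R"
    have \<sigma>x: "0 < \<sigma> x" "r (\<sigma> x) = x" "(\<sigma> has_real_derivative 1 / \<rho> (\<sigma> x)) (at x)" using \<sigma>[OF x] by auto
    note Sx = S[OF \<sigma>x(1)]
    show "0 < \<sigma> x \<and> r (\<sigma> x) = x \<and> (\<sigma> has_real_derivative 1 / H x) (at x)"
      using \<sigma>x by (simp add: H_def)
    have "isCont H x" unfolding H_def
      by (rule isCont_o2[OF DERIV_isCont[OF \<sigma>x(3)] DERIV_isCont[OF Sx(4)]])
    moreover have "(\<rho> (\<sigma> x))^2 \<le> 1" using Sx(1,2) by (simp add: abs_square_le_1)
    then have "(H x)^2 = 1 - x^2 * (E x)^2"
      using x by (simp add: H_def E_def \<eta>_def \<sigma>x(2) power_divide)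
    ultimately show "0 < H x \<and> (H x)^2 = 1 - x^2 * (E x)^2 \<and> isCont H x"
      using Sx(6) by (simp add: H_def)
    have "(\<eta> has_real_derivative \<rho> (\<sigma> x) * (E x * (1 - 3 * E x * (\<beta> * (r (\<sigma> x))^2 * g ((r (\<sigma> x))^2) + \<rho> (\<sigma> x)))) / (2 * r (\<sigma> x))) (at (\<sigma> x))"
      unfolding \<eta>_def by (rule toy_eta_derivative) (use Sx in \<open>auto simp: E_def \<eta>_def\<close>)
    from DERIV_chain2[where f = \<eta> and g = \<sigma>, OF this \<sigma>x(3)]
    show "(E has_real_derivative E x * (1 - 3 * E x * (\<beta> * x^2 * g (x^2) + H x)) / (2 * x)) (at x)"
      using Sx(6) by (simp add: E_def H_def \<sigma>x(2))
  qed
  then show thesis by (rule that)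
qed

text \<open>For u = (E1 - E2)^2 one has u' = (Q0/x) u, and Q0 tends to 1 - 3 (2/3) = -1 at the tip.
  So u is nonincreasing near 0, where its limit is 0, and must vanish; the growth bound carries this
  to all common radii. It remains to identify the limiting radii and the time
  parametrisations.\<close>

lemma toy_solutions_equal:
  assumes toy1: "toy_steady_tip_growth g \<beta> \<rho>1 r1" and toy2: "toy_steady_tip_growth g \<beta> \<rho>2 r2"
    and g: "\<And>x. isCont g x" and s: "s > 0"
  shows "\<rho>1 s = \<rho>2 s \<and> r1 s = r2 s"
proof -
  obtain R1 \<sigma>1 E1 H1 where "radial_profile g \<beta> \<rho>1 r1 R1 \<sigma>1 E1 H1" by (rule toy_radial_profile[OF toy1 g])
  then interpret P1: radial_profile g \<beta> \<rho>1 r1 R1 \<sigma>1 E1 H1 .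
  note R1 = P1.radius and r1 = P1.position and \<sigma>1 = P1.time and H1 = P1.speed and E1 = P1.eta
    and lim1 = P1.limits
  obtain R2 \<sigma>2 E2 H2 where "radial_profile g \<beta> \<rho>2 r2 R2 \<sigma>2 E2 H2" by (rule toy_radial_profile[OF toy2 g])
  then interpret P2: radial_profile g \<beta> \<rho>2 r2 R2 \<sigma>2 E2 H2 .
  note R2 = P2.radius and r2 = P2.position and \<sigma>2 = P2.time and H2 = P2.speed and E2 = P2.eta
    and lim2 = P2.limits
  define m where "m = min R1 R2"
  have m: "m > 0" "\<And>x. x < m \<Longrightarrow> x < R1" "\<And>x. x < m \<Longrightarrow> x < R2" using R1 R2 by (auto simp: m_def)
  define Q0 where "Q0 = (\<lambda>x. 1 - 3 * (E1 x + E2 x) * (\<beta> * x^2 * g (x^2) + H1 x - (E2 x)^2 * x^2 / (H1 x + H2 x)))"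
  define Q where "Q = (\<lambda>x. Q0 x / (2 * x))"
  define u where "u = (\<lambda>x. (E1 x - E2 x)^2)"
  have du: "(u has_real_derivative 2 * Q x * u x) (at x)" if x: "0 < x" "x < m" for x
  proof -
    have "(u has_real_derivative 2 * (E1 x - E2 x) * (E1 x * (1 - 3 * E1 x * (\<beta> * x^2 * g (x^2) + H1 x)) / (2 * x)
        - E2 x * (1 - 3 * E2 x * (\<beta> * x^2 * g (x^2) + H2 x)) / (2 * x))) (at x)"
      unfolding u_def using E1[OF x(1) m(2)[OF x(2)]] E2[OF x(1) m(3)[OF x(2)]]
      by (auto intro!: derivative_eq_intros)
    moreover have "E1 x * (1 - 3 * E1 x * (\<beta> * x^2 * g (x^2) + H1 x)) / (2 * x)
        - E2 x * (1 - 3 * E2 x * (\<beta> * x^2 * g (x^2) + H2 x)) / (2 * x) = Q x * (E1 x - E2 x)"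
      unfolding Q_def Q0_def diff_divide_distrib[symmetric] times_divide_eq_left
      using H1[OF x(1) m(2)[OF x(2)]] H2[OF x(1) m(3)[OF x(2)]]
      by (subst toy_difference_factor) auto
    ultimately show ?thesis by (simp add: u_def power2_eq_square mult_ac)
  qed
  have cont: "isCont E1 x" "isCont E2 x" "isCont H1 x" "isCont H2 x" if "0 < x" "x < m" for x
    using E1[OF that(1) m(2)[OF that(2)]] E2[OF that(1) m(3)[OF that(2)]]
      H1[OF that(1) m(2)[OF that(2)]] H2[OF that(1) m(3)[OF that(2)]] by (auto intro: DERIV_isCont)
  have contQ: "isCont Q x" if x: "0 < x" "x < m" for x
    unfolding Q_def Q0_def
    using cont[OF x] H1[OF x(1) m(2)[OF x(2)]] H2[OF x(1) m(3)[OF x(2)]] x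
    by (intro continuous_intros isCont_o2[OF _ g]) auto
  have "((\<lambda>x. g (x^2)) \<longlongrightarrow> g (0^2)) (at_right 0)"
    by (intro isCont_tendsto_compose[OF g] tendsto_intros)
  then have "(Q0 \<longlongrightarrow> 1 - 3 * (1/3 + 1/3) * (\<beta> * 0^2 * g (0^2) + 1 - (1/3)^2 * 0^2 / (1 + 1))) (at_right 0)"
    unfolding Q0_def by (intro tendsto_intros lim1 lim2) auto
  then have "(Q0 \<longlongrightarrow> -1) (at_right 0)" by simp
  then have "\<forall>\<^sub>F x in at_right 0. Q0 x < 0" by (rule order_tendstoD) simp
  then obtain \<epsilon>0 where \<epsilon>0: "\<epsilon>0 > 0" "\<And>x. 0 < x \<Longrightarrow> x < \<epsilon>0 \<Longrightarrow> Q0 x < 0"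
    by (auto simp: eventually_at_right_field)
  define \<epsilon> where "\<epsilon> = min \<epsilon>0 m / 2"
  have \<epsilon>: "0 < \<epsilon>" "\<epsilon> < \<epsilon>0" "\<epsilon> < m" using \<epsilon>0(1) m(1) by (auto simp: \<epsilon>_def min_def)
  have u0': "u x \<le> 0" if x: "0 < x" "x \<le> \<epsilon>" for x
  proof (rule tendsto_lowerbound)
    have "(u \<longlongrightarrow> (1/3 - 1/3)^2) (at_right 0)" unfolding u_def by (intro tendsto_intros lim1 lim2)
    then show "(u \<longlongrightarrow> 0) (at_right 0)" by simp
    have "u x \<le> u y" if y: "0 < y" "y < x" for y
    proof (rule DERIV_nonpos_imp_nonincreasing[where f = u])
      fix z assume z: "y \<le> z" "z \<le> x"
      then have z': "0 < z" "z < \<epsilon>0" "z < m" using y x \<epsilon> by auto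
      have "Q z \<le> 0" using \<epsilon>0(2)[OF z'(1,2)] z'(1) by (simp add: Q_def divide_nonpos_pos)
      then have "2 * Q z * u z \<le> 0" by (simp add: u_def mult_nonpos_nonneg)
      then show "\<exists>w. (u has_real_derivative w) (at z) \<and> w \<le> 0" using du[OF z'(1,3)] by blast
    qed (use y in simp)
    then show "\<forall>\<^sub>F y in at_right 0. u x \<le> u y"
      unfolding eventually_at_right_field using x(1) by blast
  qed simp
  have u0: "u x \<le> 0" if x: "\<epsilon> \<le> x" "x < m" for x
  proof -
    have "compact (Q ` {\<epsilon>..x})"
      using contQ \<epsilon> x by (intro compact_continuous_image continuous_at_imp_continuous_on) auto
    then obtain M where M: "\<And>y. y \<in> {\<epsilon>..x} \<Longrightarrow> norm (Q y) \<le> M"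
      using compact_imp_bounded bounded_iff by (metis imageI)
    have "u x \<le> exp (2 * M * (x - \<epsilon>)) * u \<epsilon>"
    proof (rule linear_growth_bound[OF x(1)])
      show "continuous_on {\<epsilon>..x} u"
        using \<epsilon> x by (intro continuous_at_imp_continuous_on ballI DERIV_isCont[OF du]) auto
      fix t assume t: "\<epsilon> < t" "t < x"
      show "(u has_real_derivative 2 * Q t * u t) (at t)" using t \<epsilon> x by (intro du) auto
      have "Q t \<le> M" using M[of t] t by auto
      then show "2 * Q t * u t \<le> 2 * M * u t" by (intro mult_right_mono) (auto simp: u_def)
    qed
    also have "\<dots> \<le> 0" using u0'[of \<epsilon>] \<epsilon>(1) by (simp add: mult_nonneg_nonpos)
    finally show ?thesis .
  qed
  have EE: "E1 x = E2 x" if "0 < x" "x < m" for x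
    using u0[of x] u0'[of x] that by (cases "x < \<epsilon>") (auto simp: u_def)
  have HH: "H1 x = H2 x" if x: "0 < x" "x < m" for x
    using H1[OF x(1) m(2)[OF x(2)]] H2[OF x(1) m(3)[OF x(2)]] EE[OF x]
    by (metis less_imp_le power2_eq_imp_eq)
  \<comment> \<open>If the limiting radii differed, the profile reaching further would still be
    positive and continuous at the smaller one, whereas \<rho> tends to 0 there along the other
    solution.\<close>
  have no: False
    if "R < R'" and "R > 0" and rR: "(r \<longlongrightarrow> R) at_top" "\<And>s. s > 0 \<Longrightarrow> 0 < r s \<and> r s < R \<and> H (r s) = \<rho> s"
      and c: "\<And>x. 0 < x \<Longrightarrow> x < R' \<Longrightarrow> 0 < H' x \<and> isCont H' x"
      and eq: "\<And>x. 0 < x \<Longrightarrow> x < R \<Longrightarrow> H x = H' x" and \<rho>: "(\<rho> \<longlongrightarrow> 0) at_top"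
    for R R' :: real and r H H' \<rho> :: "real \<Rightarrow> real"
  proof -
    have "((\<lambda>s. H' (r s)) \<longlongrightarrow> H' R) at_top"
      using c[of R] that(1,2) rR(1) by (intro isCont_tendsto_compose[of _ H']) auto
    moreover have "\<forall>\<^sub>F s in at_top. H' (r s) = \<rho> s"
      using eventually_gt_at_top[of 0] by eventually_elim (use rR(2) eq in metis)
    ultimately have "(\<rho> \<longlongrightarrow> H' R) at_top" using tendsto_cong by fastforce
    then have "H' R = 0" using \<rho> tendsto_unique trivial_limit_at_top_linorder by blast
    then show False using c[of R] that(1,2) by simp
  qed
  have \<rho>0: "(\<rho>1 \<longlongrightarrow> 0) at_top" "(\<rho>2 \<longlongrightarrow> 0) at_top"
    using toy1 toy2 by (auto simp: toy_steady_tip_growth_def)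
  have "\<not> R1 < R2"
  proof
    assume lt: "R1 < R2"
    show False
    proof (rule no[OF lt R1(1,2)])
      show "0 < r1 s \<and> r1 s < R1 \<and> H1 (r1 s) = \<rho>1 s" if "s > 0" for s using r1[OF that] by simp
      show "0 < H2 x \<and> isCont H2 x" if "0 < x" "x < R2" for x using H2[OF that] by simp
      show "H1 x = H2 x" if "0 < x" "x < R1" for x using that lt by (intro HH) (auto simp: m_def)
    qed (fact \<rho>0)
  qed
  moreover have "\<not> R2 < R1"
  proof
    assume lt: "R2 < R1"
    show False
    proof (rule no[OF lt R2(1,2)])
      show "0 < r2 s \<and> r2 s < R2 \<and> H2 (r2 s) = \<rho>2 s" if "s > 0" for s using r2[OF that] by simp
      show "0 < H1 x \<and> isCont H1 x" if "0 < x" "x < R1" for x using H1[OF that] by simp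
      show "H2 x = H1 x" if "0 < x" "x < R2" for x using that lt by (intro HH[symmetric]) (auto simp: m_def)
    qed (fact \<rho>0)
  qed
  ultimately have RR: "R1 = R2" by simp
  \<comment> \<open>Both times have derivative 1/H in the radius, and both tend to 0 at the tip,
    which fixes the constant.\<close>
  have "\<exists>c. \<forall>x\<in>{0<..<R1}. \<sigma>1 x - \<sigma>2 x = c"
  proof (rule has_field_derivative_zero_constant)
    fix x assume "x \<in> {0<..<R1}"
    then have x: "0 < x" "x < R1" "x < R2" "x < m" using RR by (auto simp: m_def)
    have "((\<lambda>x. \<sigma>1 x - \<sigma>2 x) has_real_derivative 1 / H1 x - 1 / H2 x) (at x)"
      using \<sigma>1[OF x(1,2)] \<sigma>2[OF x(1,3)] by (intro DERIV_diff) auto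
    then show "((\<lambda>x. \<sigma>1 x - \<sigma>2 x) has_real_derivative 0) (at x within {0<..<R1})"
      using HH[OF x(1,4)] by (simp add: has_field_derivative_at_within)
  qed simp
  then obtain c where c: "\<And>x. 0 < x \<Longrightarrow> x < R1 \<Longrightarrow> \<sigma>1 x - \<sigma>2 x = c" by auto
  have "((\<lambda>x. \<sigma>1 x - \<sigma>2 x) \<longlongrightarrow> 0 - 0) (at_right 0)" by (intro tendsto_intros lim1 lim2)
  moreover have "\<forall>\<^sub>F x in at_right 0. \<sigma>1 x - \<sigma>2 x = c"
    unfolding eventually_at_right_field using c R1(1) by blast
  ultimately have "((\<lambda>x::real. c) \<longlongrightarrow> 0) (at_right 0)" using tendsto_cong by fastforce
  then have "c = 0" by (simp add: tendsto_const_iff)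
  then have "\<sigma>2 (r1 s) = s" using c[of "r1 s"] r1[OF s] by simp
  then have "r2 s = r1 s" using \<sigma>2[of "r1 s"] r1[OF s] RR by auto
  moreover have "\<rho>1 s = \<rho>2 s"
    using r1[OF s] r2[OF s] HH[of "r1 s"] \<open>r2 s = r1 s\<close> RR by (simp add: m_def)
  ultimately show ?thesis by simp
qed

section \<open>Bounded Lipschitz functions and barriers\<close>

text \<open>Boundedness is bundled with the Lipschitz property because products of Lipschitz
  functions need it; the vector field can then be treated factor by factor.\<close>

definition bdd_lipschitz :: "('a::metric_space \<Rightarrow> real) \<Rightarrow> bool" where
  "bdd_lipschitz f \<longleftrightarrow> (\<exists>M. \<forall>x. \<bar>f x\<bar> \<le> M) \<and> (\<exists>L. \<forall>x y. \<bar>f x - f y\<bar> \<le> L * dist x y)"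

lemma bdd_lipschitz_const: "bdd_lipschitz (\<lambda>x. c)"
  unfolding bdd_lipschitz_def by (auto intro: exI[of _ "\<bar>c\<bar>"] exI[of _ 0])

lemma bdd_lipschitz_diff:
  assumes "bdd_lipschitz f" "bdd_lipschitz h"
  shows "bdd_lipschitz (\<lambda>x. f x - h x)"
proof -
  obtain M L M' L' where 1: "\<And>x. \<bar>f x\<bar> \<le> M" "\<And>x. \<bar>h x\<bar> \<le> M'"
    and 2: "\<And>x y. \<bar>f x - f y\<bar> \<le> L * dist x y" "\<And>x y. \<bar>h x - h y\<bar> \<le> L' * dist x y"
    using assms unfolding bdd_lipschitz_def by metis
  have "\<bar>f x - h x\<bar> \<le> M + M'" for x using 1[of x] by linarith
  moreover have "\<bar>(f x - h x) - (f y - h y)\<bar> \<le> (L + L') * dist x y" for x y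
    using 2(1)[of x y] 2(2)[of x y] unfolding distrib_right by linarith
  ultimately show ?thesis unfolding bdd_lipschitz_def by blast
qed

lemma bdd_lipschitz_mult:
  assumes "bdd_lipschitz f" "bdd_lipschitz h"
  shows "bdd_lipschitz (\<lambda>x. f x * h x)"
proof -
  obtain M L M' L' where 1: "\<And>x. \<bar>f x\<bar> \<le> M" "\<And>x. \<bar>h x\<bar> \<le> M'"
    and 2: "\<And>x y. \<bar>f x - f y\<bar> \<le> L * dist x y" "\<And>x y. \<bar>h x - h y\<bar> \<le> L' * dist x y"
    using assms unfolding bdd_lipschitz_def by metis
  have M: "M \<ge> 0" "M' \<ge> 0" using 1 abs_ge_zero order_trans by blast+
  have "\<bar>f x * h x\<bar> \<le> M * M'" for x
    unfolding abs_mult using 1 M by (intro mult_mono) auto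
  moreover have "\<bar>f x * h x - f y * h y\<bar> \<le> (M * L' + M' * L) * dist x y" for x y
  proof -
    have "f x * h x - f y * h y = f x * (h x - h y) + h y * (f x - f y)" by (simp add: algebra_simps)
    then have "\<bar>f x * h x - f y * h y\<bar> \<le> \<bar>f x\<bar> * \<bar>h x - h y\<bar> + \<bar>h y\<bar> * \<bar>f x - f y\<bar>"
      by (metis abs_mult abs_triangle_ineq)
    also have "\<dots> \<le> M * (L' * dist x y) + M' * (L * dist x y)"
      using 1 2 M by (intro add_mono mult_mono) auto
    finally show ?thesis by (simp add: algebra_simps)
  qed
  ultimately show ?thesis unfolding bdd_lipschitz_def by blast
qed

lemma bdd_lipschitz_compose:
  assumes "bdd_lipschitz f" "\<And>x y. dist (h x) (h y) \<le> dist x y"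
  shows "bdd_lipschitz (\<lambda>x. f (h x))"
proof -
  obtain M L where M: "\<And>x. \<bar>f x\<bar> \<le> M" and L: "\<And>x y. \<bar>f x - f y\<bar> \<le> L * dist x y"
    using assms unfolding bdd_lipschitz_def by metis
  have "\<bar>f (h x) - f (h y)\<bar> \<le> \<bar>L\<bar> * dist x y" for x y
  proof -
    have "\<bar>f (h x) - f (h y)\<bar> \<le> L * dist (h x) (h y)" by (rule L)
    also have "\<dots> \<le> \<bar>L\<bar> * dist (h x) (h y)" by (intro mult_right_mono) auto
    also have "\<dots> \<le> \<bar>L\<bar> * dist x y" by (intro mult_left_mono assms(2)) auto
    finally show ?thesis .
  qed
  then show ?thesis using M unfolding bdd_lipschitz_def by blast
qed

lemma derivative_bound_imp_lipschitz:
  fixes f :: "real \<Rightarrow> real"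
  assumes "convex S" "\<And>x. x \<in> S \<Longrightarrow> (f has_real_derivative f' x) (at x within S)"
    and "\<And>x. x \<in> S \<Longrightarrow> \<bar>f' x\<bar> \<le> L" "x \<in> S" "y \<in> S"
  shows "\<bar>f x - f y\<bar> \<le> L * \<bar>x - y\<bar>"
  using field_differentiable_bound[OF assms(1), of f f' L x y] assms(2-) by simp

lemma bdd_lipschitz_sin: "bdd_lipschitz (sin :: real \<Rightarrow> real)"
proof -
  have "\<bar>sin x - sin y\<bar> \<le> 1 * dist x y" for x y :: real
    unfolding dist_real_def
    by (rule derivative_bound_imp_lipschitz[where S = UNIV and f' = cos]) (auto intro!: derivative_eq_intros)
  then show ?thesis unfolding bdd_lipschitz_def using abs_sin_le_one by blast
qed

lemma bdd_lipschitz_cos: "bdd_lipschitz (cos :: real \<Rightarrow> real)"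
proof -
  have "\<bar>cos x - cos y\<bar> \<le> 1 * dist x y" for x y :: real
    unfolding dist_real_def
    by (rule derivative_bound_imp_lipschitz[where S = UNIV and f' = "\<lambda>x. - sin x"]) (auto intro!: derivative_eq_intros)
  then show ?thesis unfolding bdd_lipschitz_def using abs_cos_le_one by blast
qed

text \<open>Projection onto an interval does not increase distances, and on the compact interval the
  function and its derivative are bounded.\<close>

lemma bdd_lipschitz_clamp:
  fixes \<phi> :: "real \<Rightarrow> real"
  assumes ab: "a \<le> b" and der: "\<And>x. x \<in> {a..b} \<Longrightarrow> (\<phi> has_real_derivative \<phi>' x) (at x)"
    and cont: "continuous_on {a..b} \<phi>'"
  shows "bdd_lipschitz (\<lambda>x. \<phi> (max a (min b x)))"
proof -
  have "continuous_on {a..b} \<phi>" using der by (meson DERIV_isCont continuous_at_imp_continuous_on)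
  then have "bounded (\<phi> ` {a..b})" "bounded (\<phi>' ` {a..b})"
    using cont by (auto intro!: compact_imp_bounded compact_continuous_image)
  then obtain M L where M: "\<And>x. x \<in> {a..b} \<Longrightarrow> \<bar>\<phi> x\<bar> \<le> M" and L: "\<And>x. x \<in> {a..b} \<Longrightarrow> \<bar>\<phi>' x\<bar> \<le> L"
    unfolding bounded_iff by (metis imageI real_norm_def)
  have L0: "L \<ge> 0" using L[of a] ab abs_ge_zero[of "\<phi>' a"] order_trans by fastforce
  have in_ab: "max a (min b x) \<in> {a..b}" for x using ab by auto
  have "\<bar>\<phi> (max a (min b x)) - \<phi> (max a (min b y))\<bar> \<le> L * dist x y" for x y
  proof -
    have "\<bar>\<phi> (max a (min b x)) - \<phi> (max a (min b y))\<bar> \<le> L * \<bar>max a (min b x) - max a (min b y)\<bar>"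
      by (rule derivative_bound_imp_lipschitz[where S = "{a..b}" and f' = \<phi>'])
         (use der L in_ab in \<open>auto intro: has_field_derivative_at_within\<close>)
    also have "\<dots> \<le> L * dist x y"
      using L0 by (intro mult_left_mono) (auto simp: dist_real_def)
    finally show ?thesis .
  qed
  then show ?thesis using M in_ab unfolding bdd_lipschitz_def by blast
qed

lemma bdd_lipschitz_prod:
  fixes f1 :: "'a::real_normed_vector \<Rightarrow> real"
  assumes "bdd_lipschitz f1" "bdd_lipschitz f2" "bdd_lipschitz f3"
  obtains L M where "L > 0" "\<And>x y. norm ((f1 x, f2 x, f3 x) - (f1 y, f2 y, f3 y)) \<le> L * norm (x - y)"
    "\<And>x. norm (f1 x, f2 x, f3 x) \<le> M"
proof -
  obtain M1 L1 M2 L2 M3 L3 where M: "\<And>x. \<bar>f1 x\<bar> \<le> M1" "\<And>x. \<bar>f2 x\<bar> \<le> M2" "\<And>x. \<bar>f3 x\<bar> \<le> M3"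
    and L: "\<And>x y. \<bar>f1 x - f1 y\<bar> \<le> L1 * dist x y" "\<And>x y. \<bar>f2 x - f2 y\<bar> \<le> L2 * dist x y"
      "\<And>x y. \<bar>f3 x - f3 y\<bar> \<le> L3 * dist x y"
    using assms unfolding bdd_lipschitz_def by metis
  have tri: "norm (a, b, c) \<le> \<bar>a\<bar> + \<bar>b\<bar> + \<bar>c\<bar>" for a b c :: real
  proof -
    have "norm (a, b, c) \<le> norm a + norm (b, c)" by (rule norm_Pair_le)
    moreover have "norm (b, c) \<le> norm b + norm c" by (rule norm_Pair_le)
    ultimately show ?thesis by simp
  qed
  show thesis
  proof
    show "\<bar>L1\<bar> + \<bar>L2\<bar> + \<bar>L3\<bar> + 1 > 0" by linarith
    show "norm (f1 x, f2 x, f3 x) \<le> M1 + M2 + M3" for x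
      using tri[of "f1 x" "f2 x" "f3 x"] M(1)[of x] M(2)[of x] M(3)[of x] by linarith
    fix x y
    have "norm ((f1 x, f2 x, f3 x) - (f1 y, f2 y, f3 y)) \<le> L1 * dist x y + L2 * dist x y + L3 * dist x y"
      using tri[of "f1 x - f1 y" "f2 x - f2 y" "f3 x - f3 y"] L(1)[of x y] L(2)[of x y] L(3)[of x y] by simp
    also have "\<dots> = (L1 + L2 + L3) * dist x y" by (simp add: algebra_simps)
    also have "\<dots> \<le> (\<bar>L1\<bar> + \<bar>L2\<bar> + \<bar>L3\<bar> + 1) * dist x y" by (intro mult_right_mono) auto
    finally show "norm ((f1 x, f2 x, f3 x) - (f1 y, f2 y, f3 y)) \<le> (\<bar>L1\<bar> + \<bar>L2\<bar> + \<bar>L3\<bar> + 1) * norm (x - y)"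
      by (simp add: dist_norm)
  qed
qed

text \<open>After the last time with y \<le> c the function would be nonincreasing and yet end above
  c. The sign of the derivative is asked for only above the barrier.\<close>

lemma barrier_le:
  fixes y :: "real \<Rightarrow> real"
  assumes T: "0 \<le> T" and cont: "continuous_on {0..T} y"
    and der: "\<And>t. 0 < t \<Longrightarrow> t < T \<Longrightarrow> (y has_real_derivative y' t) (at t)"
    and le: "\<And>t. 0 < t \<Longrightarrow> t < T \<Longrightarrow> y t > c \<Longrightarrow> y' t \<le> 0" and y0: "y 0 \<le> c"
  shows "y T \<le> c"
proof (rule ccontr)
  assume "\<not> y T \<le> c"
  define S where "S = {t \<in> {0..T}. y t \<le> c}"
  have S: "closed S" unfolding S_def
    by (intro continuous_on_closed_Collect_le) (auto intro: cont continuous_intros)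
  have ne: "S \<noteq> {}" "bdd_above S" using y0 T by (auto simp: S_def intro!: bdd_aboveI[of _ T])
  define u where "u = Sup S"
  have "u \<in> S" unfolding u_def by (rule closed_contains_Sup[OF ne S])
  then have u: "0 \<le> u" "u \<le> T" "y u \<le> c" by (auto simp: S_def)
  have gt: "y t > c" if "u < t" "t \<le> T" for t
  proof (rule ccontr)
    assume "\<not> y t > c"
    then have "t \<in> S" using that u by (auto simp: S_def)
    then have "t \<le> u" unfolding u_def by (rule cSup_upper[OF _ ne(2)])
    then show False using that by simp
  qed
  have "y T \<le> y u"
  proof (rule DERIV_nonpos_imp_decreasing_open[OF u(2), where f = y])
    show "continuous_on {u..T} y" using cont by (rule continuous_on_subset) (use u in auto)
    fix t assume t: "u < t" "t < T"
    then show "\<exists>z. (y has_real_derivative z) (at t) \<and> z \<le> 0"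
      using der[of t] le[of t] gt[of t] u by auto
  qed
  then show False using u \<open>\<not> y T \<le> c\<close> by simp
qed

text \<open>The function max p (-q) is negative exactly inside the region; the exit time is its
  first zero, so both weak inequalities still hold there.\<close>

lemma first_exit_time:
  fixes p q :: "real \<Rightarrow> real"
  assumes cont: "continuous_on {0..} p" "continuous_on {0..} q" and start: "p 0 < 0" "q 0 > 0"
    and t: "t \<ge> 0" "\<not> (p t < 0 \<and> q t > 0)"
  obtains t1 where "0 < t1" "t1 \<le> t" "\<And>u. 0 \<le> u \<Longrightarrow> u < t1 \<Longrightarrow> p u < 0 \<and> q u > 0"
    "p t1 \<le> 0" "q t1 \<ge> 0" "p t1 = 0 \<or> q t1 = 0"
proof -
  define h where "h = (\<lambda>u. max (p u) (- q u))"
  have h: "h u < 0 \<longleftrightarrow> p u < 0 \<and> q u > 0" "h u \<le> 0 \<longleftrightarrow> p u \<le> 0 \<and> q u \<ge> 0" for u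
    by (auto simp: h_def)
  have conth: "continuous_on {0..} h" unfolding h_def by (intro continuous_intros cont)
  define S where "S = {u \<in> {0..t}. 0 \<le> h u}"
  have "continuous_on {0..t} h" using conth by (rule continuous_on_subset) auto
  then have S: "closed S" unfolding S_def by (intro continuous_on_closed_Collect_le) (auto intro: continuous_intros)
  have ne: "S \<noteq> {}" "bdd_below S" using h(1)[of t] t by (auto simp: S_def not_less intro!: bdd_belowI[of _ 0])
  define t1 where "t1 = Inf S"
  have "t1 \<in> S" unfolding t1_def by (rule closed_contains_Inf[OF ne S])
  then have t1: "0 \<le> t1" "t1 \<le> t" "0 \<le> h t1" by (auto simp: S_def)
  have pos: "0 < t1" using t1(1,3) h(1)[of 0] start by (cases "t1 = 0") auto
  have lt: "h u < 0" if "0 \<le> u" "u < t1" for u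
  proof (rule ccontr)
    assume "\<not> h u < 0"
    then have "u \<in> S" using that t1 by (auto simp: S_def)
    then have "t1 \<le> u" unfolding t1_def by (rule cInf_lower[OF _ ne(2)])
    then show False using that by simp
  qed
  have "h t1 \<le> 0"
  proof (rule tendsto_upperbound)
    have "isCont h t1" using conth pos by (intro continuous_on_interior[OF conth]) auto
    then show "(h \<longlongrightarrow> h t1) (at_left t1)" by (simp add: filterlim_at_split isCont_def)
    show "\<forall>\<^sub>F u in at_left t1. h u \<le> 0"
      unfolding eventually_at_left_field using lt pos by (intro exI[of _ 0]) (auto intro: less_imp_le)
  qed simp
  then have "h t1 = 0" using t1(3) by simp
  then have "p t1 \<le> 0" "q t1 \<ge> 0" "p t1 = 0 \<or> q t1 = 0"
    using h[of t1] by (auto simp: h_def max_def split: if_splits)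
  then show thesis using that[of t1] pos t1(2) lt h(1) by blast
qed

section \<open>Shooting\<close>

text \<open>The shooting argument runs in the angle \<open>\<rho> = cos \<theta>\<close>, with \<open>\<beta>\<close> as a third, constant
  coordinate; clamping \<open>r\<close> and \<open>\<beta>\<close> makes the vector field globally Lipschitz.
  The function \<open>excess\<close> is \<open>N - 1\<close>.\<close>

locale toy_shooting =
  fixes g :: "real \<Rightarrow> real" and r0 R \<beta>1 \<beta>2 :: real and \<theta>0 :: "real \<Rightarrow> real"
  assumes analytic: "real_analytic_on g UNIV"
    and pos: "\<And>v. v > 0 \<Longrightarrow> g v > 0"
    and mono: "\<And>v. v > 0 \<Longrightarrow> deriv g v \<ge> 0"
    and convex: "\<And>v. v > 0 \<Longrightarrow> deriv (deriv (\<lambda>v. v^2 * g (v^2))) v > 0"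
    and r0: "0 < r0" "r0 < 5" "5 < R" and \<beta>1: "0 < \<beta>1" "\<beta>1 \<le> \<beta>2"
    and \<beta>1_small: "\<beta>1 * (25 * g 25) \<le> 1/7"
    and \<beta>2_large: "\<beta>2 * g (144/625) * (12/25) * (4/5) \<ge> 1"
    and init: "\<And>\<beta>. \<beta> \<in> {\<beta>1..\<beta>2} \<Longrightarrow> 0 < \<theta>0 \<beta> \<and> \<theta>0 \<beta> < pi/2 \<and>
      7/24 \<le> sin (\<theta>0 \<beta>) / r0 \<and> sin (\<theta>0 \<beta>) / r0 \<le> 3/8 \<and> cos (\<theta>0 \<beta>) > 3/5 \<and>
      sin (\<theta>0 \<beta>) * (\<beta> * r0^2 * g (r0^2) + cos (\<theta>0 \<beta>)) / r0 < 1"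
    and \<theta>0_cont: "continuous_on {\<beta>1..\<beta>2} \<theta>0"
    and R_large: "\<And>\<beta>. \<beta> \<in> {\<beta>1..\<beta>2} \<Longrightarrow> sin (\<theta>0 \<beta>) * (\<beta> * R * g (R^2)) > 1"
begin

definition "cr r = max r0 (min R r)"
definition "cb \<beta> = max \<beta>1 (min \<beta>2 \<beta>)"

lemma cr_bounds: "r0 \<le> cr r" "cr r \<le> R" "0 < cr r"
  using r0 by (auto simp: cr_def)

lemma cr_ne: "cr r \<noteq> 0" using cr_bounds(3)[of r] by simp

lemma cr_id: "r0 \<le> r \<Longrightarrow> r \<le> R \<Longrightarrow> cr r = r" by (simp add: cr_def)

lemma cb_id: "\<beta> \<in> {\<beta>1..\<beta>2} \<Longrightarrow> cb \<beta> = \<beta>" by (simp add: cb_def)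

definition excess :: "real \<times> real \<times> real \<Rightarrow> real" where
  "excess = (\<lambda>(\<theta>, r, \<beta>). sin \<theta> * (cb \<beta> * (cr r)^2 * g ((cr r)^2) + cos \<theta>) / cr r - 1)"

text \<open>From \<rho> = cos \<theta> and \<eta> = sin \<theta> / r, the model gives \<theta>' =
  -(3/2) (sin \<theta> / r) (N - 1). The angle removes the square root, which is not Lipschitz at
  \<rho> = 1 and \<rho> = -1.\<close>

definition field :: "real \<times> real \<times> real \<Rightarrow> real \<times> real \<times> real" where
  "field = (\<lambda>(\<theta>, r, \<beta>). (3/2 * (sin \<theta> / cr r) * (- excess (\<theta>, r, \<beta>)), cos \<theta>, 0))"

lemma g_deriv: "(g has_real_derivative deriv g v) (at v)"
  using real_analytic_has_derivative[OF analytic] by simp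

lemma g'_deriv: "(deriv g has_real_derivative deriv (deriv g) v) (at v)"
  using real_analytic_has_derivative[OF real_analytic_deriv[OF analytic]] by simp

lemma g_cont: "isCont g v" using g_deriv by (rule DERIV_isCont)

lemma g_mono: "0 < a \<Longrightarrow> a \<le> b \<Longrightarrow> g a \<le> g b"
proof (rule DERIV_nonneg_imp_nondecreasing[where f = g])
  show "\<exists>y. (g has_real_derivative y) (at x) \<and> 0 \<le> y" if "0 < a" "a \<le> x" for x
    using g_deriv[of x] mono[of x] that by auto
qed

lemma cont_cr: "continuous_on S (\<lambda>x. cr (f x))" if "continuous_on S f"
  unfolding cr_def by (intro continuous_intros that)

lemma cont_cb: "continuous_on S (\<lambda>x. cb (f x))" if "continuous_on S f"
  unfolding cb_def by (intro continuous_intros that)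

lemma cont_g: "continuous_on S (\<lambda>x. g (f x))" if "continuous_on S f"
  by (rule continuous_on_compose2[OF _ that, of UNIV]) (auto intro: continuous_at_imp_continuous_on g_cont)

lemma excess_cont: "continuous_on S excess"
  unfolding excess_def split_beta
  by (intro continuous_intros cont_cr cont_cb cont_g) (simp add: cr_ne)

lemma field_lipschitz:
  obtains L M where "L > 0" "\<And>x y. norm (field x - field y) \<le> L * norm (x - y)" "\<And>x. norm (field x) \<le> M"
proof -
  have d: "dist (fst x) (fst y) \<le> dist x y" "dist (fst (snd x)) (fst (snd y)) \<le> dist x y"
    "dist (snd (snd x)) (snd (snd y)) \<le> dist x y" for x y :: "real \<times> real \<times> real"
    by (rule dist_fst_le order_trans[OF dist_fst_le dist_snd_le] order_trans[OF dist_snd_le dist_snd_le])+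
  have s: "bdd_lipschitz (\<lambda>x :: real \<times> real \<times> real. sin (fst x))"
    by (rule bdd_lipschitz_compose[OF bdd_lipschitz_sin d(1)])
  have c: "bdd_lipschitz (\<lambda>x :: real \<times> real \<times> real. cos (fst x))"
    by (rule bdd_lipschitz_compose[OF bdd_lipschitz_cos d(1)])
  have i: "bdd_lipschitz (\<lambda>x :: real \<times> real \<times> real. 1 / cr (fst (snd x)))"
    unfolding cr_def
    by (rule bdd_lipschitz_compose[OF bdd_lipschitz_clamp[where \<phi>' = "\<lambda>x. - (1 / x^2)"] d(2)])
       (use r0 in \<open>auto intro!: derivative_eq_intros continuous_intros simp: power2_eq_square field_simps\<close>)
  have gl: "bdd_lipschitz (\<lambda>x :: real \<times> real \<times> real. g ((cr (fst (snd x)))^2))"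
    unfolding cr_def
  proof (rule bdd_lipschitz_compose[OF bdd_lipschitz_clamp[where \<phi> = "\<lambda>x. g (x^2)" and \<phi>' = "\<lambda>x. deriv g (x^2) * (2 * x)"] d(2)])
    show "((\<lambda>x. g (x^2)) has_real_derivative deriv g (x^2) * (2 * x)) (at x)" for x
      by (rule DERIV_chain2[OF g_deriv]) (auto intro!: derivative_eq_intros)
    have "continuous_on {r0..R} (\<lambda>x. deriv g (x^2))"
      by (rule continuous_on_compose2[of UNIV])
         (auto intro!: continuous_at_imp_continuous_on continuous_intros DERIV_isCont[OF g'_deriv])
    then show "continuous_on {r0..R} (\<lambda>x. deriv g (x^2) * (2 * x))" by (intro continuous_intros)
  qed (use r0 in auto)
  have b: "bdd_lipschitz (\<lambda>x :: real \<times> real \<times> real. cb (snd (snd x)))"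
    unfolding cb_def
    by (rule bdd_lipschitz_compose[OF bdd_lipschitz_clamp[where \<phi> = "\<lambda>x. x" and \<phi>' = "\<lambda>x. 1"] d(3)]) (use \<beta>1 in auto)
  note bl = bdd_lipschitz_diff bdd_lipschitz_mult bdd_lipschitz_const s c i gl b
  \<comment> \<open>Multiplying out cancels the square of \<open>cr\<close> in front of g, so only
    bounded Lipschitz factors remain.\<close>
  define F where "F = (\<lambda>x :: real \<times> real \<times> real. 3/2 * (sin (fst x) * (1 / cr (fst (snd x)))
      - (cb (snd (snd x)) * g ((cr (fst (snd x)))^2)) * (sin (fst x) * sin (fst x))
      - (sin (fst x) * sin (fst x)) * (cos (fst x) * ((1 / cr (fst (snd x))) * (1 / cr (fst (snd x)))))))"
  have F: "bdd_lipschitz F" unfolding F_def by (intro bl)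
  have "field x = (F x, cos (fst x), 0)" for x
  proof -
    have "cr (fst (snd x)) > 0" by (rule cr_bounds)
    then show ?thesis
      by (simp add: field_def excess_def F_def split_beta field_simps power2_eq_square)
  qed
  then have eq: "field = (\<lambda>x. (F x, cos (fst x), 0))" by blast
  show thesis
    by (rule bdd_lipschitz_prod[OF F c bdd_lipschitz_const[of 0]]) (rule that[unfolded eq])
qed

section \<open>The flow and its continuity in the parameter\<close>

definition "solves x \<longleftrightarrow> (\<forall>t\<ge>0. (x has_vector_derivative field (x t)) (at t within {0..}))"

definition flow :: "real \<Rightarrow> real \<Rightarrow> real \<times> real \<times> real" where
  "flow \<beta> = (SOME x. x 0 = (\<theta>0 \<beta>, r0, \<beta>) \<and> solves x)"

lemma flow: "flow \<beta> 0 = (\<theta>0 \<beta>, r0, \<beta>)" "solves (flow \<beta>)"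
proof -
  obtain L M where "L > 0" "\<And>x y. norm (field x - field y) \<le> L * norm (x - y)" "\<And>x. norm (field x) \<le> M"
    by (rule field_lipschitz) (rule that)
  then have "\<exists>x. x 0 = (\<theta>0 \<beta>, r0, \<beta>) \<and> solves x"
    using ode_solution_exists[of L field M "(\<theta>0 \<beta>, r0, \<beta>)"] unfolding solves_def by metis
  then have "flow \<beta> 0 = (\<theta>0 \<beta>, r0, \<beta>) \<and> solves (flow \<beta>)"
    unfolding flow_def by (rule someI_ex)
  then show "flow \<beta> 0 = (\<theta>0 \<beta>, r0, \<beta>)" "solves (flow \<beta>)" by auto
qed

text \<open>Used to show that neither an equilibrium nor an invariant line is reached in finite
  time.\<close>

lemma solves_backward_unique:
  assumes "solves x" "solves y" "t \<ge> 0" "x t = y t"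
  shows "x 0 = y 0"
proof -
  obtain L M where "L > 0" "\<And>x y. norm (field x - field y) \<le> L * norm (x - y)" "\<And>x. norm (field x) \<le> M"
    by (rule field_lipschitz) (rule that)
  then have "norm (x 0 - y 0) \<le> exp (L * t) * norm (x t - y t)"
    using assms unfolding solves_def by (intro ode_gronwall(2)[where f = field]) auto
  then show ?thesis using assms(4) by simp
qed

lemma solves_cont: "solves x \<Longrightarrow> continuous_on {0..} x"
  unfolding solves_def
  by (meson atLeast_iff continuous_on_eq_continuous_within has_vector_derivative_continuous)

text \<open>As \<beta> is a coordinate of the state, dependence on the parameter is dependence on
  initial data. Gronwall controls the change of \<beta> at a fixed time, and continuity of a single
  trajectory controls the change of time.\<close>

lemma flow_continuous:
  "continuous_on ({\<beta>1..\<beta>2} \<times> {0..}) (\<lambda>p. flow (fst p) (snd p))"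
proof -
  obtain L M where L: "L > 0" "\<And>x y. norm (field x - field y) \<le> L * norm (x - y)" "\<And>x. norm (field x) \<le> M"
    by (rule field_lipschitz) (rule that)
  show ?thesis unfolding continuous_on_def
  proof
    fix p :: "real \<times> real" assume p: "p \<in> {\<beta>1..\<beta>2} \<times> {0..}"
    define b where "b = (\<lambda>q. exp (L * snd q) * norm ((\<theta>0 (fst q), r0, fst q) - (\<theta>0 (fst p), r0, fst p))
      + norm (flow (fst p) (snd q) - flow (fst p) (snd p)))"
    have "continuous_on ({\<beta>1..\<beta>2} \<times> {0..}) b"
      unfolding b_def
      by (intro continuous_intros continuous_on_compose2[OF \<theta>0_cont] continuous_on_compose2[OF solves_cont[OF flow(2)]]) auto
    then have "(b \<longlongrightarrow> b p) (at p within {\<beta>1..\<beta>2} \<times> {0..})" using p unfolding continuous_on_def by blast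
    then have b0: "(b \<longlongrightarrow> 0) (at p within {\<beta>1..\<beta>2} \<times> {0..})" by (simp add: b_def)
    have "norm (flow (fst q) (snd q) - flow (fst p) (snd p)) \<le> b q" if q: "q \<in> {\<beta>1..\<beta>2} \<times> {0..}" for q
    proof -
      have "norm (flow (fst q) (snd q) - flow (fst p) (snd q)) \<le> exp (L * snd q) * norm (flow (fst q) 0 - flow (fst p) 0)"
        using L flow(2) q unfolding solves_def by (intro ode_gronwall(1)[where f = field]) auto
      then show ?thesis
        using norm_triangle_ineq[of "flow (fst q) (snd q) - flow (fst p) (snd q)" "flow (fst p) (snd q) - flow (fst p) (snd p)"]
        by (simp add: b_def flow(1))
    qed
    then have "\<forall>\<^sub>F q in at p within {\<beta>1..\<beta>2} \<times> {0..}. norm (flow (fst q) (snd q) - flow (fst p) (snd p)) \<le> b q"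
      by (auto simp: eventually_at_filter)
    from Lim_null_comparison[OF this b0]
    show "((\<lambda>p. flow (fst p) (snd p)) \<longlongrightarrow> flow (fst p) (snd p)) (at p within {\<beta>1..\<beta>2} \<times> {0..})"
      by (simp add: Lim_null[symmetric])
  qed
qed

definition "ang \<beta> t = fst (flow \<beta> t)"
definition "rad \<beta> t = fst (snd (flow \<beta> t))"

lemma flow_third: "t \<ge> 0 \<Longrightarrow> snd (snd (flow \<beta> t)) = \<beta>"
proof -
  assume t: "t \<ge> 0"
  have "((\<lambda>t. snd (snd (flow \<beta> t))) has_vector_derivative 0) (at s within {0..})" if "s \<in> {0..}" for s
  proof -
    have "(flow \<beta> has_vector_derivative field (flow \<beta> s)) (at s within {0..})"
      using flow(2) that by (simp add: solves_def)
    from bounded_linear.has_vector_derivative[OF bounded_linear_snd bounded_linear.has_vector_derivative[OF bounded_linear_snd this]]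
    show ?thesis by (simp add: field_def split_beta)
  qed
  then obtain c where c: "\<And>s. s \<in> {0..} \<Longrightarrow> snd (snd (flow \<beta> s)) = c"
    by (rule has_vector_derivative_zero_constant[OF convex_real_interval(1)]) blast+
  then show ?thesis using t c[of t] c[of 0] by (simp add: flow(1))
qed

lemma flow_eq: "t \<ge> 0 \<Longrightarrow> flow \<beta> t = (ang \<beta> t, rad \<beta> t, \<beta>)"
  using flow_third[of t \<beta>] by (simp add: ang_def rad_def prod_eq_iff)

section \<open>Monotonicity and confinement along one trajectory\<close>

definition "exc \<beta> t = excess (flow \<beta> t)"

context
  fixes \<beta> assumes \<beta>: "\<beta> \<in> {\<beta>1..\<beta>2}"
begin

lemma \<beta>_pos: "\<beta> > 0" using \<beta> \<beta>1 by simp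

lemma exc_eq: "t \<ge> 0 \<Longrightarrow> exc \<beta> t = sin (ang \<beta> t) * (\<beta> * (cr (rad \<beta> t))^2 * g ((cr (rad \<beta> t))^2) + cos (ang \<beta> t)) / cr (rad \<beta> t) - 1"
  by (simp add: exc_def flow_eq excess_def cb_id[OF \<beta>])

lemma ang_deriv_within:
  assumes "t \<ge> 0"
  shows "(ang \<beta> has_real_derivative 3/2 * (sin (ang \<beta> t) / cr (rad \<beta> t)) * (- exc \<beta> t)) (at t within {0..})"
proof -
  have "(flow \<beta> has_vector_derivative field (flow \<beta> t)) (at t within {0..})"
    using flow(2) assms by (simp add: solves_def)
  from bounded_linear.has_vector_derivative[OF bounded_linear_fst this]
  have "(ang \<beta> has_vector_derivative fst (field (flow \<beta> t))) (at t within {0..})"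
    by (simp add: ang_def[abs_def])
  moreover have "fst (field (flow \<beta> t)) = 3/2 * (sin (ang \<beta> t) / cr (rad \<beta> t)) * (- exc \<beta> t)"
    by (simp add: field_def exc_def flow_eq[OF assms])
  ultimately show ?thesis by (simp add: has_real_derivative_iff_has_vector_derivative)
qed

lemma rad_deriv_within:
  assumes "t \<ge> 0"
  shows "(rad \<beta> has_real_derivative cos (ang \<beta> t)) (at t within {0..})"
proof -
  have "(flow \<beta> has_vector_derivative field (flow \<beta> t)) (at t within {0..})"
    using flow(2) assms by (simp add: solves_def)
  from bounded_linear.has_vector_derivative[OF bounded_linear_fst bounded_linear.has_vector_derivative[OF bounded_linear_snd this]]
  have "(rad \<beta> has_vector_derivative fst (snd (field (flow \<beta> t)))) (at t within {0..})"
    by (simp add: rad_def[abs_def])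
  moreover have "fst (snd (field (flow \<beta> t))) = cos (ang \<beta> t)"
    by (simp add: field_def flow_eq[OF assms])
  ultimately show ?thesis by (simp add: has_real_derivative_iff_has_vector_derivative)
qed

lemma ang_deriv: "t > 0 \<Longrightarrow> (ang \<beta> has_real_derivative 3/2 * (sin (ang \<beta> t) / cr (rad \<beta> t)) * (- exc \<beta> t)) (at t)"
  using ang_deriv_within[of t] by (simp add: at_within_atLeast_interior)

lemma rad_deriv: "t > 0 \<Longrightarrow> (rad \<beta> has_real_derivative cos (ang \<beta> t)) (at t)"
  using rad_deriv_within[of t] by (simp add: at_within_atLeast_interior)

lemma ang_cont: "continuous_on {0..} (ang \<beta>)"
  using ang_deriv_within by (meson DERIV_continuous atLeast_iff continuous_on_eq_continuous_within)

lemma rad_cont: "continuous_on {0..} (rad \<beta>)"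
  using rad_deriv_within by (meson DERIV_continuous atLeast_iff continuous_on_eq_continuous_within)

lemma exc_cont: "continuous_on {0..} (exc \<beta>)"
  unfolding exc_def by (rule continuous_on_compose2[OF excess_cont solves_cont[OF flow(2)]]) auto

lemma start: "ang \<beta> 0 = \<theta>0 \<beta>" "rad \<beta> 0 = r0" by (simp_all add: ang_def rad_def flow(1))

text \<open>The line \<theta> = a is invariant where sin a = 0: moving along it with constant radial
  speed cos a is an explicit solution. By backward uniqueness, a trajectory that starts off the line
  never meets it.\<close>

lemma ang_ne:
  assumes t: "t \<ge> 0" and k: "sin a = 0" and ne: "\<theta>0 \<beta> \<noteq> a"
  shows "ang \<beta> t \<noteq> a"
proof
  assume a: "ang \<beta> t = a"
  define y where "y = (\<lambda>s. (a, rad \<beta> t + cos a * (s - t), \<beta>))"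
  have "solves y" unfolding solves_def
  proof (intro allI impI)
    fix s :: real
    have "(y has_vector_derivative (0, cos a, 0)) (at s within {0..})"
      unfolding y_def by (auto intro!: derivative_eq_intros has_vector_derivative_Pair
          simp: has_real_derivative_iff_has_vector_derivative[symmetric])
    then show "(y has_vector_derivative field (y s)) (at s within {0..})"
      by (simp add: y_def field_def k)
  qed
  moreover have "flow \<beta> t = y t" using a by (simp add: y_def flow_eq[OF t])
  ultimately have "flow \<beta> 0 = y 0" using solves_backward_unique[OF flow(2) _ t] by blast
  then show False using ne by (simp add: y_def flow(1))
qed

lemma ang_range: "t \<ge> 0 \<Longrightarrow> 0 < ang \<beta> t \<and> ang \<beta> t < pi"
proof -
  assume t: "t \<ge> 0"
  have i: "0 < \<theta>0 \<beta>" "\<theta>0 \<beta> < pi" using init[OF \<beta>] pi_gt_zero by auto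
  have c: "continuous_on {0..t} (ang \<beta>)" using ang_cont by (rule continuous_on_subset) auto
  have "0 < ang \<beta> t"
  proof (rule ccontr)
    assume "\<not> 0 < ang \<beta> t"
    then obtain s where "0 \<le> s" "s \<le> t" "ang \<beta> s = 0"
      using IVT2'[of "ang \<beta>" t 0 0] c t i start by auto
    then show False using ang_ne[of s 0] i by auto
  qed
  moreover have "ang \<beta> t < pi"
  proof (rule ccontr)
    assume "\<not> ang \<beta> t < pi"
    then obtain s where "0 \<le> s" "s \<le> t" "ang \<beta> s = pi"
      using IVT'[of "ang \<beta>" 0 pi t] c t i start by auto
    then show False using ang_ne[of s pi] i by auto
  qed
  ultimately show ?thesis by simp
qed

lemma sin_pos: "t \<ge> 0 \<Longrightarrow> sin (ang \<beta> t) > 0"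
  using ang_range[of t] by (simp add: sin_gt_zero)

lemma rad_mono:
  assumes "0 \<le> a" "a \<le> b" "\<And>u. a < u \<Longrightarrow> u < b \<Longrightarrow> cos (ang \<beta> u) \<ge> 0"
  shows "rad \<beta> a \<le> rad \<beta> b"
proof (rule DERIV_nonneg_imp_increasing_open[OF assms(2), where f = "rad \<beta>"])
  show "continuous_on {a..b} (rad \<beta>)" using rad_cont by (rule continuous_on_subset) (use assms in auto)
  show "\<exists>y. (rad \<beta> has_real_derivative y) (at x) \<and> 0 \<le> y" if "a < x" "x < b" for x
    using rad_deriv[of x] assms that by auto
qed

lemma ang_mono:
  assumes "0 \<le> a" "a \<le> b" "\<And>u. a < u \<Longrightarrow> u < b \<Longrightarrow> exc \<beta> u \<le> 0"
  shows "ang \<beta> a \<le> ang \<beta> b"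
proof (rule DERIV_nonneg_imp_increasing_open[OF assms(2), where f = "ang \<beta>"])
  show "continuous_on {a..b} (ang \<beta>)" using ang_cont by (rule continuous_on_subset) (use assms in auto)
  fix x assume x: "a < x" "x < b"
  have "0 \<le> 3/2 * (sin (ang \<beta> x) / cr (rad \<beta> x)) * (- exc \<beta> x)"
    using assms x sin_pos[of x] cr_bounds(3)[of "rad \<beta> x"] by (intro mult_nonneg_nonneg divide_nonneg_pos) auto
  then show "\<exists>y. (ang \<beta> has_real_derivative y) (at x) \<and> 0 \<le> y" using ang_deriv[of x] x assms(1) by auto
qed

text \<open>While N \<le> 1 and \<rho> \<ge> 0, both r and \<theta> increase and \<theta> \<le>
  pi/2, so sin \<theta> does not drop below its initial value. Then N \<le> 1 bounds sin \<theta>0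
  times \<beta> r g(r^2) by 1, which \<open>R_large\<close> forbids at r = R. So the clamp on r
  never acts, and \<open>field\<close> is the true model.\<close>

lemma trapped:
  assumes good: "\<And>u. 0 \<le> u \<Longrightarrow> u \<le> t \<Longrightarrow> exc \<beta> u \<le> 0 \<and> cos (ang \<beta> u) \<ge> 0" and t: "t \<ge> 0"
  shows "r0 \<le> rad \<beta> t \<and> rad \<beta> t < R \<and> sin (\<theta>0 \<beta>) \<le> sin (ang \<beta> t) \<and> ang \<beta> t \<le> pi/2"
proof -
  have "rad \<beta> 0 \<le> rad \<beta> t" using good t by (intro rad_mono) auto
  then have r: "r0 \<le> rad \<beta> t" by (simp add: start)
  have "ang \<beta> 0 \<le> ang \<beta> t" using good t by (intro ang_mono) auto
  then have a: "\<theta>0 \<beta> \<le> ang \<beta> t" by (simp add: start)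
  have h: "ang \<beta> t \<le> pi/2"
  proof (rule ccontr)
    assume "\<not> ang \<beta> t \<le> pi/2"
    then have "cos (ang \<beta> t) < 0" using ang_range[OF t] cos_lt_zero_pi by auto
    then show False using good[of t] t by simp
  qed
  then have s: "sin (\<theta>0 \<beta>) \<le> sin (ang \<beta> t)" using a init[OF \<beta>] by (intro sin_monotone_2pi_le) auto
  define c where "c = cr (rad \<beta> t)"
  have c: "0 < c" "c \<le> R" using cr_bounds[of "rad \<beta> t"] by (auto simp: c_def)
  have "sin (ang \<beta> t) * (\<beta> * c * g (c^2)) \<le> 1"
  proof -
    have "sin (ang \<beta> t) * (\<beta> * c * g (c^2)) \<le> sin (ang \<beta> t) * (\<beta> * c^2 * g (c^2) + cos (ang \<beta> t)) / c"
      using c sin_pos[OF t] good[of t] t by (simp add: field_simps power2_eq_square)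
    then show ?thesis using exc_eq[OF t] good[of t] t by (simp add: c_def)
  qed
  moreover have "sin (\<theta>0 \<beta>) * (\<beta> * c * g (c^2)) \<le> sin (ang \<beta> t) * (\<beta> * c * g (c^2))"
    using s \<beta>_pos c pos[of "c^2"] by (intro mult_right_mono) auto
  ultimately have "c \<noteq> R" using R_large[OF \<beta>] by auto
  then have "rad \<beta> t < R" using r0 by (auto simp: c_def cr_def max_def min_def split: if_splits)
  then show ?thesis using r s h by simp
qed

end

end

lemma isCont_pos_nbhd:
  fixes f :: "real \<Rightarrow> real"
  assumes "isCont f a" "f a > 0"
  obtains d where "d > 0" "\<And>u. \<bar>u - a\<bar> < d \<Longrightarrow> f u > 0"
proof -
  have "\<forall>\<^sub>F u in nhds a. f u > 0"
    using assms by (intro order_tendstoD(1)[where y = "f a"]) (auto simp: isCont_def tendsto_at_iff_tendsto_nhds)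
  then show thesis using that unfolding eventually_nhds_metric dist_real_def by blast
qed

text \<open>On the compact set the function at \<open>\<beta>0\<close> has a positive minimum m, and
  nearby parameters change it by at most m/2 uniformly.\<close>

lemma tube_positive:
  fixes \<Psi> :: "real \<times> real \<Rightarrow> real"
  assumes "continuous_on (U \<times> C) \<Psi>" "compact C" "\<beta>0 \<in> U" "\<And>u. u \<in> C \<Longrightarrow> \<Psi> (\<beta>0, u) > 0"
  obtains V where "open V" "\<beta>0 \<in> V" "\<And>\<beta> u. \<beta> \<in> V \<Longrightarrow> \<beta> \<in> U \<Longrightarrow> u \<in> C \<Longrightarrow> \<Psi> (\<beta>, u) > 0"
proof (cases "C = {}")
  case True
  then show thesis using that[of UNIV] by simp
next
  case False
  have "continuous_on C (\<lambda>u. \<Psi> (\<beta>0, u))"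
    by (rule continuous_on_compose2[OF assms(1)]) (use assms(3) in \<open>auto intro!: continuous_intros\<close>)
  then obtain u0 where u0: "u0 \<in> C" "\<And>u. u \<in> C \<Longrightarrow> \<Psi> (\<beta>0, u0) \<le> \<Psi> (\<beta>0, u)"
    using continuous_attains_inf[OF assms(2) False] by blast
  define m where "m = \<Psi> (\<beta>0, u0)"
  have m: "m > 0" using assms(4) u0 by (simp add: m_def)
  obtain V where V: "\<beta>0 \<in> V" "open V" "\<forall>\<beta>\<in>V \<inter> U. \<forall>u\<in>C. dist (\<Psi> (\<beta>, u)) (\<Psi> (\<beta>0, u)) \<le> m/2"
    using continuous_on_prod_compactE[OF assms(1-3), of "m/2"] m by auto
  have "\<Psi> (\<beta>, u) > 0" if "\<beta> \<in> V" "\<beta> \<in> U" "u \<in> C" for \<beta> u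
  proof -
    have "\<bar>\<Psi> (\<beta>, u) - \<Psi> (\<beta>0, u)\<bar> \<le> m/2" using V(3) that by (auto simp: dist_real_def)
    moreover have "m \<le> \<Psi> (\<beta>0, u)" using u0(2)[OF that(3)] by (simp add: m_def)
    ultimately show ?thesis using m by linarith
  qed
  then show thesis using that V by blast
qed

text \<open>Here \<open>Z\<close> stands for the quantity \<open>gap\<close>, \<open>bf\<close> and
  \<open>bf'\<close> for \<beta> f(r) and \<beta> f'(r), and \<open>th\<close> for \<theta>'.
  Eliminating \<open>bf\<close> through \<open>Z\<close> separates a multiple of \<open>Z\<close>
  from a remainder free of it.\<close>

lemma barrier_identity:
  fixes s c r Z bf bf' th :: real
  assumes "s \<noteq> 0" "r \<noteq> 0" and Z: "Z = bf + c - r / s" and th: "th = - (3/2 * (s / r)^2 * Z)"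
  shows "bf' * c - s * th - (c * s - r * (c * th)) / s^2
    = c / r * ((r * bf' - bf) - c) + (3/2 * s ^ 3 / r^2 - c / (2 * r)) * Z"
proof -
  have bf: "bf = Z - c + r / s" using Z by simp
  have "(c * s - r * (c * th)) / s^2 = c / s + 3/2 * (c / r) * Z"
    unfolding th using assms(1,2) by (simp add: field_simps power2_eq_square)
  moreover have "s * th = - (3/2 * s ^ 3 / r^2 * Z)"
    unfolding th by (simp add: power2_eq_square power3_eq_cube)
  moreover have "c / r * ((r * bf' - bf) - c) = bf' * c - c / r * Z - c / s"
    unfolding bf using assms(1,2) by (simp add: field_simps)
  ultimately show ?thesis by (simp add: algebra_simps)
qed

section \<open>Transversality of the crossing N = 1\<close>

context toy_shooting
begin

definition "ff = (\<lambda>v. v^2 * g (v^2))"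

lemma ff_deriv: "(ff has_real_derivative deriv ff v) (at v)"
  "(deriv ff has_real_derivative deriv (deriv ff) v) (at v)"
proof -
  define f1 where "f1 = (\<lambda>v. 2 * v * g (v^2) + v^2 * (deriv g (v^2) * (2 * v)))"
  have 1: "((\<lambda>x. g (x^2)) has_real_derivative deriv g (v^2) * (2 * v)) (at v)" for v
    by (rule DERIV_chain2[OF g_deriv]) (auto intro!: derivative_eq_intros)
  have 2: "((\<lambda>x. deriv g (x^2)) has_real_derivative deriv (deriv g) (v^2) * (2 * v)) (at v)" for v
    by (rule DERIV_chain2[OF g'_deriv]) (auto intro!: derivative_eq_intros)
  have d1: "(ff has_real_derivative f1 v) (at v)" for v
    unfolding ff_def f1_def by (rule derivative_eq_intros 1 refl)+ simp
  then have eq: "deriv ff = f1" by (auto intro: DERIV_imp_deriv)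
  show "(ff has_real_derivative deriv ff v) (at v)" using d1 eq by simp
  have "\<exists>D. (f1 has_real_derivative D) (at v)"
    unfolding f1_def by (rule exI) (rule derivative_intros 1 2)+
  then show "(deriv ff has_real_derivative deriv (deriv ff) v) (at v)"
    unfolding eq using DERIV_imp_deriv by blast
qed

lemma ff_convex: "v > 0 \<Longrightarrow> deriv (deriv ff) v > 0"
  unfolding ff_def by (rule convex)

context
  fixes \<beta> assumes \<beta>: "\<beta> \<in> {\<beta>1..\<beta>2}"
begin

lemma ang_deriv_true:
  assumes "t > 0" "r0 \<le> rad \<beta> t" "rad \<beta> t \<le> R"
  shows "(ang \<beta> has_real_derivative 3/2 * (sin (ang \<beta> t) / rad \<beta> t) * (- exc \<beta> t)) (at t)"
  using ang_deriv[OF \<beta> assms(1)] cr_id[OF assms(2,3)] by simp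

lemma exc_true:
  assumes "t \<ge> 0" "r0 \<le> rad \<beta> t" "rad \<beta> t \<le> R"
  shows "exc \<beta> t = sin (ang \<beta> t) * (\<beta> * (rad \<beta> t)^2 * g ((rad \<beta> t)^2) + cos (ang \<beta> t)) / rad \<beta> t - 1"
  using exc_eq[OF \<beta> assms(1)] cr_id[OF assms(2,3)] by simp

lemma isCont_exc: "t > 0 \<Longrightarrow> isCont (exc \<beta>) t"
  using exc_cont[OF \<beta>] by (rule continuous_on_interior) simp

lemma isCont_ang: "t > 0 \<Longrightarrow> isCont (ang \<beta>) t"
  using ang_cont[OF \<beta>] by (rule continuous_on_interior) simp

lemma isCont_rad: "t > 0 \<Longrightarrow> isCont (rad \<beta>) t"
  using rad_cont[OF \<beta>] by (rule continuous_on_interior) simp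

text \<open>\<open>gap\<close> has the sign of \<open>exc\<close> and satisfies \<open>gap' = (\<rho>/r) slope + damp gap\<close>. As long as \<open>exc \<le> 0\<close>,
  convexity makes \<open>slope\<close> nondecreasing. So if \<open>slope \<le> 0\<close> at the first zero of \<open>gap\<close>, then
  \<open>gap' \<le> damp gap\<close> up to that point, and \<open>gap\<close> could not have been negative before.\<close>

definition "gap t = \<beta> * ff (rad \<beta> t) + cos (ang \<beta> t) - rad \<beta> t / sin (ang \<beta> t)"

definition "slope t = \<beta> * (rad \<beta> t * deriv ff (rad \<beta> t) - ff (rad \<beta> t)) - cos (ang \<beta> t)"

lemma exc_gap:
  assumes "t \<ge> 0" "r0 \<le> rad \<beta> t" "rad \<beta> t \<le> R"
  shows "exc \<beta> t = sin (ang \<beta> t) / rad \<beta> t * gap t"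
proof -
  have "rad \<beta> t > 0" "sin (ang \<beta> t) > 0" using assms r0 sin_pos[OF \<beta>] by auto
  then show ?thesis
    unfolding exc_true[OF assms] gap_def ff_def by (simp add: field_simps)
qed

definition "damp t = 3/2 * sin (ang \<beta> t) ^ 3 / (rad \<beta> t)^2 - cos (ang \<beta> t) / (2 * rad \<beta> t)"

lemma gap_deriv:
  assumes t: "t > 0" "r0 \<le> rad \<beta> t" "rad \<beta> t \<le> R"
  shows "(gap has_real_derivative cos (ang \<beta> t) / rad \<beta> t * slope t +
    damp t * gap t) (at t)"
proof -
  define s where "s = sin (ang \<beta> t)"
  define c where "c = cos (ang \<beta> t)"
  define r where "r = rad \<beta> t"
  define th where "th = 3/2 * (s / r) * (- exc \<beta> t)"
  have pos: "s > 0" "r > 0" using t r0 sin_pos[OF \<beta>] by (auto simp: s_def r_def)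
  have d: "(ang \<beta> has_real_derivative th) (at t)" "(rad \<beta> has_real_derivative c) (at t)"
    using ang_deriv_true[OF t] rad_deriv[OF \<beta> t(1)] by (auto simp: th_def s_def r_def c_def)
  have th: "th = - (3/2 * (s / r)^2 * gap t)"
    using t exc_gap[of t] by (simp add: th_def s_def r_def power2_eq_square)
  have ff': "((\<lambda>t. ff (rad \<beta> t)) has_real_derivative deriv ff r * c) (at t)"
    unfolding r_def by (rule DERIV_chain2[OF ff_deriv(1) d(2)])
  have "(gap has_real_derivative (\<beta> * deriv ff r) * c - s * th - (c * s - r * (c * th)) / s^2) (at t)"
    unfolding gap_def[abs_def] using pos
    by (auto intro!: derivative_eq_intros ff' d simp: s_def r_def c_def power2_eq_square)
  also have "(\<beta> * deriv ff r) * c - s * th - (c * s - r * (c * th)) / s^2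
     = c / r * ((r * (\<beta> * deriv ff r) - \<beta> * ff r) - c) + (3/2 * s ^ 3 / r^2 - c / (2 * r)) * gap t"
    by (rule barrier_identity[OF _ _ _ th]) (use pos in \<open>auto simp: gap_def s_def c_def r_def\<close>)
  finally show ?thesis by (simp add: slope_def damp_def s_def c_def r_def algebra_simps)
qed

lemma slope_deriv:
  assumes t: "t > 0" "r0 \<le> rad \<beta> t" "rad \<beta> t \<le> R"
  shows "(slope has_real_derivative \<beta> * (rad \<beta> t * deriv (deriv ff) (rad \<beta> t) * cos (ang \<beta> t))
    + sin (ang \<beta> t) * (3/2 * (sin (ang \<beta> t) / rad \<beta> t) * (- exc \<beta> t))) (at t)"
proof -
  note d = ang_deriv_true[OF t] rad_deriv[OF \<beta> t(1)]
  have ff': "((\<lambda>t. ff (rad \<beta> t)) has_real_derivative deriv ff (rad \<beta> t) * cos (ang \<beta> t)) (at t)"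
    by (rule DERIV_chain2[OF ff_deriv(1) d(2)])
  have ff'': "((\<lambda>t. deriv ff (rad \<beta> t)) has_real_derivative deriv (deriv ff) (rad \<beta> t) * cos (ang \<beta> t)) (at t)"
    by (rule DERIV_chain2[OF ff_deriv(2) d(2)])
  show ?thesis unfolding slope_def[abs_def]
    by (rule derivative_eq_intros ff' ff'' d refl)+ (simp add: algebra_simps)
qed

text \<open>At the first zero of \<open>exc\<close> with \<rho> > 0 the derivative of
  \<open>gap\<close> is (\<rho>/r) \<open>slope\<close>. Once \<open>slope\<close> is known to be
  positive there, \<open>gap\<close> turns positive immediately afterwards while \<rho> > 0 still
  holds, which puts \<beta> into the set of overshooting parameters.\<close>

lemma crosses_upward:
  assumes t1: "t1 > 0" and good: "\<And>u. 0 \<le> u \<Longrightarrow> u < t1 \<Longrightarrow> exc \<beta> u < 0 \<and> cos (ang \<beta> u) > 0"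
    and e: "exc \<beta> t1 = 0" and c: "cos (ang \<beta> t1) > 0"
  shows "\<exists>t\<ge>0. exc \<beta> t > 0 \<and> (\<forall>u\<in>{0..t}. cos (ang \<beta> u) > 0)"
proof -
  have good': "exc \<beta> u \<le> 0 \<and> cos (ang \<beta> u) > 0" if "0 \<le> u" "u \<le> t1" for u
    using good[of u] that e c by (cases "u = t1") auto
  have tr: "r0 \<le> rad \<beta> u \<and> rad \<beta> u < R" if "0 \<le> u" "u \<le> t1" for u
    using trapped[OF \<beta>, of u] good' that by (auto simp: less_imp_le)
  have zero: "gap t1 = 0"
    using exc_gap[of t1] e tr[of t1] t1 r0 sin_pos[OF \<beta>, of t1] by auto
  have neg: "gap u < 0" if "0 \<le> u" "u < t1" for u
  proof -
    have "sin (ang \<beta> u) / rad \<beta> u * gap u < 0" using exc_gap[of u] good[OF that] tr[of u] that by auto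
    moreover have "sin (ang \<beta> u) / rad \<beta> u > 0" using tr[of u] that r0 sin_pos[OF \<beta>, of u] by auto
    ultimately show ?thesis by (metis mult_less_0_iff order_less_asym)
  qed
  have cont: "isCont gap u" "isCont slope u" if "0 < u" "u \<le> t1" for u
    using gap_deriv[of u] slope_deriv[of u] tr[of u] that DERIV_isCont by (auto simp: less_imp_le)
  have "slope t1 > 0"
  proof (rule ccontr)
    assume "\<not> slope t1 > 0"
    \<comment> \<open>Two-sided continuity and derivatives are available only at positive times, so
      the comparison starts at some a > 0.\<close>
    define a where "a = t1 / 2"
    have a: "0 < a" "a < t1" using t1 by (auto simp: a_def)
    have slope_le: "slope u \<le> 0" if u: "a \<le> u" "u \<le> t1" for u
    proof -
      have "slope u \<le> slope t1"
      proof (rule DERIV_nonneg_imp_nondecreasing[where f = slope])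
        fix x assume x: "u \<le> x" "x \<le> t1"
        then have x': "0 < x" "0 \<le> x" using u a by auto
        have b: "\<beta> * (rad \<beta> x * deriv (deriv ff) (rad \<beta> x) * cos (ang \<beta> x))
            + sin (ang \<beta> x) * (3/2 * (sin (ang \<beta> x) / rad \<beta> x) * (- exc \<beta> x)) \<ge> 0"
          using \<beta>_pos[OF \<beta>] tr[OF x'(2) x(2)] r0 good'[OF x'(2) x(2)] ff_convex[of "rad \<beta> x"] sin_pos[OF \<beta> x'(2)]
          by (intro add_nonneg_nonneg mult_nonneg_nonneg divide_nonneg_nonneg) auto
        have "(slope has_real_derivative \<beta> * (rad \<beta> x * deriv (deriv ff) (rad \<beta> x) * cos (ang \<beta> x))
            + sin (ang \<beta> x) * (3/2 * (sin (ang \<beta> x) / rad \<beta> x) * (- exc \<beta> x))) (at x)"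
          using tr[OF x'(2) x(2)] by (intro slope_deriv x') auto
        then show "\<exists>y. (slope has_real_derivative y) (at x) \<and> 0 \<le> y" using b by blast
      qed (use u in simp)
      then show ?thesis using \<open>\<not> slope t1 > 0\<close> by simp
    qed
    \<comment> \<open>The rate -1/(2 r0) is a lower bound for \<open>damp\<close>; multiplied by
      \<open>gap\<close> \<le> 0 it becomes an upper bound. The resulting estimate keeps
      \<open>gap\<close> strictly negative at \<open>t1\<close>, a contradiction.\<close>
    have "gap t1 \<le> exp (- (1 / (2 * r0)) * (t1 - a)) * gap a"
    proof (rule linear_growth_bound)
      show "a \<le> t1" using a by simp
      show "continuous_on {a..t1} gap" using a cont by (intro continuous_at_imp_continuous_on) auto
      fix t assume t: "a < t" "t < t1"
      then have t': "0 < t" "0 \<le> t" "t \<le> t1" using a by auto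
      note trt = tr[OF t'(2,3)] and gt = good'[OF t'(2,3)]
      show "(gap has_real_derivative cos (ang \<beta> t) / rad \<beta> t * slope t +
        damp t * gap t) (at t)"
        using trt by (intro gap_deriv t') auto
      have "cos (ang \<beta> t) / rad \<beta> t * slope t \<le> 0"
        using slope_le[of t] t trt gt r0 by (intro mult_nonneg_nonpos divide_nonneg_nonneg) auto
      moreover have "damp t * gap t
          \<le> - (1 / (2 * r0)) * gap t"
      proof (rule mult_right_mono_neg)
        have "cos (ang \<beta> t) / (2 * rad \<beta> t) \<le> 1 / (2 * r0)"
          using trt gt r0 by (intro frac_le) auto
        moreover have "3/2 * sin (ang \<beta> t) ^ 3 / (rad \<beta> t)^2 \<ge> 0"
          using sin_pos[OF \<beta> t'(2)] by simp
        ultimately show "- (1 / (2 * r0)) \<le> damp t"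
          unfolding damp_def by linarith
        show "gap t \<le> 0" using neg[of t] t t' by simp
      qed
      ultimately show "cos (ang \<beta> t) / rad \<beta> t * slope t +
        damp t * gap t \<le> - (1 / (2 * r0)) * gap t"
        by linarith
    qed
    moreover have "exp (- (1 / (2 * r0)) * (t1 - a)) * gap a < 0"
      using neg[of a] a by (simp add: mult_pos_neg)
    ultimately show False using zero by simp
  qed
  then have "cos (ang \<beta> t1) / rad \<beta> t1 * slope t1 > 0"
    using c tr[of t1] t1 r0 by (intro mult_pos_pos divide_pos_pos) auto
  moreover have "(gap has_real_derivative cos (ang \<beta> t1) / rad \<beta> t1 * slope t1) (at t1)"
    using gap_deriv[of t1] tr[of t1] t1 zero by simp
  ultimately obtain d1 where d1: "d1 > 0" "\<And>h. 0 < h \<Longrightarrow> h < d1 \<Longrightarrow> gap t1 < gap (t1 + h)"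
    using DERIV_pos_inc_right by blast
  obtain d2 where d2: "d2 > 0" "\<And>u. \<bar>u - t1\<bar> < d2 \<Longrightarrow> cos (ang \<beta> u) > 0"
    by (rule isCont_pos_nbhd[where f = "\<lambda>u. cos (ang \<beta> u)" and a = t1])
       (use isCont_ang[OF t1] c in \<open>auto intro: isCont_cos'\<close>)
  obtain d3 where d3: "d3 > 0" "\<And>u. \<bar>u - t1\<bar> < d3 \<Longrightarrow> R - rad \<beta> u > 0"
    by (rule isCont_pos_nbhd[where f = "\<lambda>u. R - rad \<beta> u" and a = t1])
       (use isCont_rad[OF t1] tr[of t1] t1 in \<open>auto intro!: continuous_intros\<close>)
  define h where "h = min d1 (min d2 d3) / 2"
  have h: "0 < h" "h < d1" "h < d2" "h < d3" using d1 d2 d3 by (auto simp: h_def)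
  have cos_pos: "cos (ang \<beta> u) > 0" if "u \<in> {0..t1 + h}" for u
    using good'[of u] d2(2)[of u] that h by (cases "u \<le> t1") auto
  have "rad \<beta> t1 \<le> rad \<beta> (t1 + h)"
    using cos_pos t1 h by (intro rad_mono[OF \<beta>]) (auto simp: less_imp_le)
  then have r: "r0 \<le> rad \<beta> (t1 + h)" "rad \<beta> (t1 + h) \<le> R"
    using tr[of t1] t1 d3(2)[of "t1 + h"] h by auto
  have "exc \<beta> (t1 + h) = sin (ang \<beta> (t1 + h)) / rad \<beta> (t1 + h) * gap (t1 + h)"
    using t1 h by (intro exc_gap r) simp
  moreover have "sin (ang \<beta> (t1 + h)) / rad \<beta> (t1 + h) * gap (t1 + h) > 0"
    using d1(2)[OF h(1,2)] zero r r0 sin_pos[OF \<beta>, of "t1 + h"] t1 h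
    by (intro mult_pos_pos divide_pos_pos) auto
  ultimately have "exc \<beta> (t1 + h) > 0" by simp
  then show ?thesis using cos_pos t1 h by (intro exI[of _ "t1 + h"]) auto
qed

end

end

section \<open>The two sets of parameters\<close>

context toy_shooting
begin

definition "turning = {\<beta> \<in> {\<beta>1..\<beta>2}. \<exists>t\<ge>0. exc \<beta> t > 0 \<and> (\<forall>u\<in>{0..t}. cos (ang \<beta> u) > 0)}"

definition "closing = {\<beta> \<in> {\<beta>1..\<beta>2}. \<exists>t\<ge>0. cos (ang \<beta> t) < 0 \<and> (\<forall>u\<in>{0..t}. exc \<beta> u < 0)}"

lemma exc_joint_cont: "continuous_on ({\<beta>1..\<beta>2} \<times> {0..}) (\<lambda>p. exc (fst p) (snd p))"
  unfolding exc_def by (rule continuous_on_compose2[OF excess_cont flow_continuous]) auto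

lemma cos_joint_cont: "continuous_on ({\<beta>1..\<beta>2} \<times> {0..}) (\<lambda>p. cos (ang (fst p) (snd p)))"
  unfolding ang_def by (intro continuous_intros flow_continuous)

text \<open>All inequalities are strict, and \<open>\<Psi>\<close> is constrained only on a compact
  time interval, so the same t is a witness for nearby parameters.\<close>

lemma open_event:
  fixes \<Phi> \<Psi> :: "real \<Rightarrow> real \<Rightarrow> real"
  assumes \<Phi>: "continuous_on ({\<beta>1..\<beta>2} \<times> {0..}) (\<lambda>p. \<Phi> (fst p) (snd p))"
    and \<Psi>: "continuous_on ({\<beta>1..\<beta>2} \<times> {0..}) (\<lambda>p. \<Psi> (fst p) (snd p))"
  shows "openin (top_of_set {\<beta>1..\<beta>2})
    {\<beta> \<in> {\<beta>1..\<beta>2}. \<exists>t\<ge>0. \<Phi> \<beta> t > 0 \<and> (\<forall>u\<in>{0..t}. \<Psi> \<beta> u > 0)}" (is "openin _ ?S")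
proof (subst openin_subopen, intro ballI)
  fix b assume b: "b \<in> ?S"
  then obtain t where t: "t \<ge> 0" "\<Phi> b t > 0" "\<And>u. u \<in> {0..t} \<Longrightarrow> \<Psi> b u > 0" and bI: "b \<in> {\<beta>1..\<beta>2}"
    by auto
  have c: "continuous_on ({\<beta>1..\<beta>2} \<times> {0..t}) (\<lambda>p. \<Psi> (fst p) (snd p))"
    "continuous_on ({\<beta>1..\<beta>2} \<times> {t}) (\<lambda>p. \<Phi> (fst p) (snd p))"
    using t(1) by (auto intro!: continuous_on_subset[OF \<Phi>] continuous_on_subset[OF \<Psi>])
  obtain V1 where V1: "open V1" "b \<in> V1" "\<And>\<beta> u. \<beta> \<in> V1 \<Longrightarrow> \<beta> \<in> {\<beta>1..\<beta>2} \<Longrightarrow> u \<in> {0..t} \<Longrightarrow> \<Psi> \<beta> u > 0"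
    using tube_positive[OF c(1) compact_Icc bI] t by auto
  obtain V2 where V2: "open V2" "b \<in> V2" "\<And>\<beta> u. \<beta> \<in> V2 \<Longrightarrow> \<beta> \<in> {\<beta>1..\<beta>2} \<Longrightarrow> u \<in> {t} \<Longrightarrow> \<Phi> \<beta> u > 0"
    using tube_positive[OF c(2) _ bI] t by auto
  have "{\<beta>1..\<beta>2} \<inter> (V1 \<inter> V2) \<subseteq> ?S" using V1(3) V2(3) t(1) by blast
  moreover have "openin (top_of_set {\<beta>1..\<beta>2}) ({\<beta>1..\<beta>2} \<inter> (V1 \<inter> V2))"
    using V1(1) V2(1) by (intro openin_open_Int open_Int)
  ultimately show "\<exists>T. openin (top_of_set {\<beta>1..\<beta>2}) T \<and> b \<in> T \<and> T \<subseteq> ?S"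
    using V1(2) V2(2) bI by blast
qed

lemma open_turning: "openin (top_of_set {\<beta>1..\<beta>2}) turning"
  unfolding turning_def by (rule open_event[OF exc_joint_cont cos_joint_cont])

lemma open_closing: "openin (top_of_set {\<beta>1..\<beta>2}) closing"
  using open_event[OF continuous_on_minus[OF cos_joint_cont] continuous_on_minus[OF exc_joint_cont]]
  unfolding closing_def by simp

text \<open>Whichever of the two events occurs no later violates the condition that the other
  imposes up to its own time.\<close>

lemma turning_closing_disjoint: "turning \<inter> closing = {}"
proof -
  have False if "exc \<beta> t > 0" "\<forall>u\<in>{0..t}. cos (ang \<beta> u) > 0" "cos (ang \<beta> s) < 0" "\<forall>u\<in>{0..s}. exc \<beta> u < 0"
    "0 \<le> t" "0 \<le> s" for \<beta> t s
  proof (cases "t \<le> s")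
    case True
    then have "exc \<beta> t < 0" using that by auto
    then show False using that by simp
  next
    case False
    then have "cos (ang \<beta> s) > 0" using that by auto
    then show False using that by simp
  qed
  then show ?thesis unfolding turning_def closing_def by blast
qed

lemma start_good:
  assumes "\<beta> \<in> {\<beta>1..\<beta>2}"
  shows "exc \<beta> 0 < 0" "cos (ang \<beta> 0) > 3/5"
  using init[OF assms] exc_true[OF assms, of 0] start[OF assms] r0 by auto

text \<open>There are three ways to leave the region first. N = 1 with \<rho> > 0 leads into
  \<open>turning\<close> by transversality. \<rho> = 0 with N < 1 leads into \<open>closing\<close>,
  because \<theta>' > 0 there. Both equalities at once mean an equilibrium, from which backward
  uniqueness would make the whole trajectory constant.\<close>

lemma neither_stays:
  assumes \<beta>: "\<beta> \<in> {\<beta>1..\<beta>2}" and nA: "\<beta> \<notin> turning" and nB: "\<beta> \<notin> closing" and t: "t \<ge> 0"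
  shows "exc \<beta> t < 0 \<and> cos (ang \<beta> t) > 0"
proof (rule ccontr)
  assume bad: "\<not> (exc \<beta> t < 0 \<and> cos (ang \<beta> t) > 0)"
  have cc: "continuous_on {0..} (\<lambda>t. cos (ang \<beta> t))" by (intro continuous_intros ang_cont[OF \<beta>])
  obtain t1 where t1: "0 < t1" and good: "\<And>u. 0 \<le> u \<Longrightarrow> u < t1 \<Longrightarrow> exc \<beta> u < 0 \<and> cos (ang \<beta> u) > 0"
    and at1: "exc \<beta> t1 \<le> 0" "cos (ang \<beta> t1) \<ge> 0" "exc \<beta> t1 = 0 \<or> cos (ang \<beta> t1) = 0"
    using first_exit_time[OF exc_cont[OF \<beta>] cc _ _ t bad] start_good[OF \<beta>] by auto
  consider "exc \<beta> t1 = 0" "cos (ang \<beta> t1) > 0" | "exc \<beta> t1 = 0" "cos (ang \<beta> t1) = 0"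
    | "exc \<beta> t1 < 0" "cos (ang \<beta> t1) = 0" using at1 by linarith
  then show False
  proof cases
    case 1
    then show False using crosses_upward[OF \<beta> t1 good] nA \<beta> by (auto simp: turning_def)
  next
    case 2
    have "field (flow \<beta> t1) = 0"
      using 2 t1 by (simp add: exc_def field_def flow_eq zero_prod_def)
    then have "solves (\<lambda>_. flow \<beta> t1)" by (simp add: solves_def)
    then have "flow \<beta> 0 = flow \<beta> t1" using solves_backward_unique[OF flow(2), of _ t1 \<beta>] t1 by auto
    then have "ang \<beta> 0 = ang \<beta> t1" by (simp add: ang_def)
    then show False using 2 start_good[OF \<beta>] by simp
  next
    case 3
    have ang1: "ang \<beta> t1 = pi/2"
      using ang_range[OF \<beta>, of t1] t1 3(2) cos_gt_zero_pi[of "ang \<beta> t1"] cos_lt_zero_pi[of "ang \<beta> t1"]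
      by (cases "ang \<beta> t1" "pi/2" rule: linorder_cases) auto
    have "3/2 * (sin (ang \<beta> t1) / cr (rad \<beta> t1)) * (- exc \<beta> t1) > 0"
      using sin_pos[OF \<beta>, of t1] t1 cr_bounds(3) 3 by (intro mult_pos_pos divide_pos_pos) auto
    then obtain d1 where d1: "d1 > 0" "\<And>h. 0 < h \<Longrightarrow> h < d1 \<Longrightarrow> ang \<beta> t1 < ang \<beta> (t1 + h)"
      using DERIV_pos_inc_right[OF ang_deriv[OF \<beta> t1]] by blast
    obtain d2 where d2: "d2 > 0" "\<And>u. \<bar>u - t1\<bar> < d2 \<Longrightarrow> - exc \<beta> u > 0"
      by (rule isCont_pos_nbhd[where f = "\<lambda>u. - exc \<beta> u" and a = t1])
         (use isCont_exc[OF \<beta> t1] 3 in \<open>auto intro!: continuous_intros\<close>)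
    define h where "h = min d1 d2 / 2"
    have h: "0 < h" "h < d1" "h < d2" using d1 d2 by (auto simp: h_def)
    have "cos (ang \<beta> (t1 + h)) < 0"
      using d1(2)[OF h(1,2)] ang1 ang_range[OF \<beta>, of "t1 + h"] t1 h by (intro cos_lt_zero_pi) auto
    moreover have "exc \<beta> u < 0" if "u \<in> {0..t1 + h}" for u
      using good[of u] d2(2)[of u] that h by (cases "u < t1") auto
    ultimately show False using nB \<beta> t1 h unfolding closing_def by (auto intro!: exI[of _ "t1 + h"])
  qed
qed

text \<open>Where \<open>cos \<theta> = 3/5\<close>, \<open>exc < 0\<close> would force both \<open>r > 12/25\<close> and \<open>(4/5) \<beta>2 r g(r\<^sup>2) < 1\<close>.\<close>

lemma \<beta>2_not_closing: "\<beta>2 \<notin> closing"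
proof
  assume "\<beta>2 \<in> closing"
  then obtain t where t: "t \<ge> 0" "cos (ang \<beta>2 t) < 0" "\<And>u. u \<in> {0..t} \<Longrightarrow> exc \<beta>2 u < 0"
    by (auto simp: closing_def)
  have \<beta>: "\<beta>2 \<in> {\<beta>1..\<beta>2}" using \<beta>1 by simp
  have "continuous_on {0..t} (\<lambda>t. cos (ang \<beta>2 t))"
    by (intro continuous_intros continuous_on_subset[OF ang_cont[OF \<beta>]]) auto
  then obtain u where u: "0 \<le> u" "u \<le> t" "cos (ang \<beta>2 u) = 3/5"
    using IVT2'[of "\<lambda>t. cos (ang \<beta>2 t)" t "3/5" 0] start_good[OF \<beta>] t by auto
  define c where "c = cr (rad \<beta>2 u)"
  have c: "c > 0" using cr_bounds(3) by (simp add: c_def)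
  have "(sin (ang \<beta>2 u))^2 = (4/5)^2"
    unfolding sin_squared_eq u(3) by (simp add: power2_eq_square)
  then have s: "sin (ang \<beta>2 u) = 4/5" using sin_pos[OF \<beta> u(1)] by (simp add: power2_eq_iff)
  have "4/5 * (\<beta>2 * c^2 * g (c^2) + 3/5) / c < 1"
    using t(3)[of u] u exc_eq[OF \<beta> u(1)] s by (simp add: c_def)
  \<comment> \<open>The number 12/25 is sin \<theta> cos \<theta> = (4/5)(3/5), and
    \<open>\<beta>2_large\<close> evaluates g at its square 144/625.\<close>
  then have lt: "4/5 * (\<beta>2 * c^2 * g (c^2)) + 12/25 < c" using c by (simp add: field_simps)
  moreover have "\<beta>2 * c^2 * g (c^2) > 0" using \<beta>_pos[OF \<beta>] c pos[of "c^2"] by simp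
  ultimately have c2: "12/25 < c" by simp
  have "(12/25)^2 \<le> c^2" using c2 by (intro power_mono) auto
  then have "g (144/625) \<le> g (c^2)" by (intro g_mono) (auto simp: power2_eq_square)
  moreover have "g (144/625) > 0" by (rule pos) simp
  ultimately have "\<beta>2 * g (144/625) * (12/25) * (4/5) \<le> \<beta>2 * g (c^2) * c * (4/5)"
    using \<beta>_pos[OF \<beta>] c2 by (intro mult_mono mult_nonneg_nonneg) auto
  then have "1 \<le> \<beta>2 * g (c^2) * c * (4/5)" using \<beta>2_large by linarith
  then have "1 * c \<le> \<beta>2 * g (c^2) * c * (4/5) * c" using c by (intro mult_right_mono) auto
  then show False using lt by (simp add: power2_eq_square mult_ac)
qed

lemma eta_deriv:
  assumes \<beta>: "\<beta> \<in> {\<beta>1..\<beta>2}" and t: "t > 0" "r0 \<le> rad \<beta> t" "rad \<beta> t \<le> R"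
  shows "((\<lambda>t. sin (ang \<beta> t) / rad \<beta> t) has_real_derivative
    cos (ang \<beta> t) * (sin (ang \<beta> t) / rad \<beta> t) * (1 - 3 * (exc \<beta> t + 1)) / (2 * rad \<beta> t)) (at t)"
proof -
  have r: "rad \<beta> t > 0" using t r0 by simp
  show ?thesis
    using ang_deriv_true[OF \<beta> t] rad_deriv[OF \<beta> t(1)] r
    by (auto intro!: derivative_eq_intros simp: field_simps power2_eq_square)
qed

text \<open>While \<open>r \<le> 5\<close>, smallness of \<open>\<beta>1\<close> makes \<open>7/24\<close> a lower barrier for \<open>\<eta>\<close>; since \<open>r \<eta> = sin \<theta> \<le> 1\<close>,
  the radius never reaches \<open>5\<close>. Then \<open>3/8\<close> is an upper barrier for \<open>\<eta> \<rho>\<close>, so \<open>N = \<eta> \<rho> + \<eta> \<beta>1 f(r) < 1\<close>.\<close>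

lemma \<beta>1_not_turning: "\<beta>1 \<notin> turning"
proof
  assume "\<beta>1 \<in> turning"
  then obtain t where t: "t \<ge> 0" "exc \<beta>1 t > 0" "\<And>u. u \<in> {0..t} \<Longrightarrow> cos (ang \<beta>1 u) > 0"
    by (auto simp: turning_def)
  have \<beta>: "\<beta>1 \<in> {\<beta>1..\<beta>2}" using \<beta>1 by simp
  have cc: "continuous_on {0..} (\<lambda>t. cos (ang \<beta>1 t))" by (intro continuous_intros ang_cont[OF \<beta>])
  \<comment> \<open>Since \<rho> > 0 up to t, the region can only be left through N = 1; the rest of
    the proof shows N < 1 at this first time.\<close>
  obtain t1 where t1: "0 < t1" "t1 \<le> t" and good: "\<And>u. 0 \<le> u \<Longrightarrow> u < t1 \<Longrightarrow> exc \<beta>1 u < 0 \<and> cos (ang \<beta>1 u) > 0"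
    and at1: "exc \<beta>1 t1 \<le> 0" "exc \<beta>1 t1 = 0 \<or> cos (ang \<beta>1 t1) = 0"
    using first_exit_time[OF exc_cont[OF \<beta>] cc _ _ t(1)] start_good[OF \<beta>] t(2) by auto
  have cpos: "cos (ang \<beta>1 u) > 0" if "0 \<le> u" "u \<le> t1" for u using t(3)[of u] t1 that by auto
  have e1: "exc \<beta>1 t1 = 0" using at1 cpos[of t1] t1 by auto
  have eneg: "exc \<beta>1 u \<le> 0" if "0 \<le> u" "u \<le> t1" for u
    using good[of u] e1 that by (cases "u = t1") auto
  have tr: "r0 \<le> rad \<beta>1 u" "rad \<beta>1 u \<le> R" if "0 \<le> u" "u \<le> t1" for u
    using trapped[OF \<beta>, of u] eneg cpos that by (auto simp: less_imp_le)
  have rpos: "rad \<beta>1 u > 0" if "0 \<le> u" "u \<le> t1" for u using tr[OF that] r0 by simp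
  define \<eta> where "\<eta> = (\<lambda>t. sin (ang \<beta>1 t) / rad \<beta>1 t)"
  define \<eta>' where "\<eta>' = (\<lambda>u. cos (ang \<beta>1 u) * \<eta> u * (1 - 3 * (exc \<beta>1 u + 1)) / (2 * rad \<beta>1 u))"
  define w where "w = (\<lambda>u. \<beta>1 * (rad \<beta>1 u)^2 * g ((rad \<beta>1 u)^2))"
  have \<eta>pos: "\<eta> u > 0" if "0 \<le> u" "u \<le> t1" for u
    using rpos[OF that] sin_pos[OF \<beta>, of u] that by (simp add: \<eta>_def)
  have \<eta>cont: "continuous_on {0..u} \<eta>" if "u \<le> t1" for u
    unfolding \<eta>_def using that rpos
    by (intro continuous_intros continuous_on_subset[OF ang_cont[OF \<beta>]] continuous_on_subset[OF rad_cont[OF \<beta>]]) force+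
  have \<eta>der: "(\<eta> has_real_derivative \<eta>' u) (at u)"
    if "0 < u" "u \<le> t1" for u
    unfolding \<eta>'_def unfolding \<eta>_def using that tr[of u] by (intro eta_deriv[OF \<beta>]) auto
  have exc\<eta>: "exc \<beta>1 u + 1 = \<eta> u * w u + \<eta> u * cos (ang \<beta>1 u)"
    if "0 \<le> u" "u \<le> t1" for u
    using exc_true[OF \<beta> that(1) tr[OF that]] rpos[OF that] by (simp add: \<eta>_def w_def field_simps)
  have g25: "g 25 > 0" by (rule pos) simp
  have small: "w u \<le> 1/7"
    if "0 \<le> u" "u \<le> t1" "rad \<beta>1 u \<le> 5" for u
  proof -
    have "(rad \<beta>1 u)^2 \<le> 5^2" using that rpos[of u] by (intro power_mono) auto
    then have r25: "(rad \<beta>1 u)^2 \<le> 25" by simp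
    then have "g ((rad \<beta>1 u)^2) \<le> g 25" using rpos[of u] that by (intro g_mono) auto
    then have "(rad \<beta>1 u)^2 * g ((rad \<beta>1 u)^2) \<le> 25 * g 25" using r25 g25 pos[of "(rad \<beta>1 u)^2"] rpos[of u] that
      by (intro mult_mono) auto
    then have "\<beta>1 * ((rad \<beta>1 u)^2 * g ((rad \<beta>1 u)^2)) \<le> \<beta>1 * (25 * g 25)" using \<beta>1 by (intro mult_left_mono) auto
    then show ?thesis using \<beta>1_small by (simp add: w_def mult.assoc)
  qed
  have w_nonneg: "0 \<le> w u" if "0 \<le> u" "u \<le> t1" for u
    using \<beta>1 pos[of "(rad \<beta>1 u)^2"] rpos[OF that] by (simp add: w_def)
  have r5: "rad \<beta>1 t1 < 5"
  proof (rule ccontr)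
    assume "\<not> rad \<beta>1 t1 < 5"
    moreover have "continuous_on {0..t1} (rad \<beta>1)" using rad_cont[OF \<beta>] by (rule continuous_on_subset) auto
    ultimately obtain t5 where t5: "0 \<le> t5" "t5 \<le> t1" "rad \<beta>1 t5 = 5"
      using IVT'[of "rad \<beta>1" 0 5 t1] start[OF \<beta>] r0 t1 by auto
    have "- \<eta> t5 \<le> - (7/24)"
    proof (rule barrier_le[where y = "\<lambda>t. - \<eta> t"])
      show "continuous_on {0..t5} (\<lambda>t. - \<eta> t)" by (intro continuous_intros \<eta>cont t5)
      show "- \<eta> 0 \<le> - (7/24)" using init[OF \<beta>] start[OF \<beta>] by (simp add: \<eta>_def)
      fix u assume u: "0 < u" "u < t5"
      then have u': "0 \<le> u" "u \<le> t1" using t5 by auto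
      show "((\<lambda>t. - \<eta> t) has_real_derivative - \<eta>' u) (at u)"
        using \<eta>der[OF u(1) u'(2)] by (rule DERIV_minus)
      assume "- \<eta> u > - (7/24)"
      then have "\<eta> u \<le> 7/24" by simp
      moreover have "rad \<beta>1 u \<le> 5" using rad_mono[OF \<beta>, of u t5] cpos u u' t5 by (simp add: less_imp_le)
      \<comment> \<open>The right-hand side is exactly 1/3, the value of N at which \<eta>' changes
        sign.\<close>
      ultimately have "\<eta> u * w u + \<eta> u * cos (ang \<beta>1 u) \<le> 7/24 * (1/7) + 7/24 * 1"
        using small[OF u'] \<eta>pos[OF u'] cpos[OF u'] w_nonneg[OF u'] by (intro add_mono mult_mono) auto
      then have "1 - 3 * (exc \<beta>1 u + 1) \<ge> 0" unfolding exc\<eta>[OF u'] by simp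
      then show "- \<eta>' u \<le> 0"
        using \<eta>pos[OF u'] cpos[OF u'] rpos[OF u'] by (simp add: \<eta>'_def divide_nonneg_pos)
    qed (use t5 in auto)
    then have "7/24 \<le> sin (ang \<beta>1 t5) / 5" by (simp add: \<eta>_def t5(3))
    \<comment> \<open>At radius 5 the barrier would give sin \<theta> \<ge> 35/24 > 1.\<close>
    then show False using sin_le_one[of "ang \<beta>1 t5"] by linarith
  qed
  define m where "m = (\<lambda>t. \<eta> t * cos (ang \<beta>1 t))"
  have "m t1 \<le> 3/8"
  proof (rule barrier_le[where y = m])
    show "continuous_on {0..t1} m" unfolding m_def
      by (intro continuous_intros \<eta>cont continuous_on_subset[OF ang_cont[OF \<beta>]]) auto
    have "\<eta> 0 * cos (ang \<beta>1 0) \<le> 3/8 * 1"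
      using init[OF \<beta>] start[OF \<beta>] by (intro mult_mono) (auto simp: \<eta>_def)
    then show "m 0 \<le> 3/8" by (simp add: m_def)
    fix u assume u: "0 < u" "u < t1"
    then have u': "0 \<le> u" "u \<le> t1" by auto
    define \<theta>' where "\<theta>' = 3/2 * (sin (ang \<beta>1 u) / rad \<beta>1 u) * (- exc \<beta>1 u)"
    have \<theta>': "(ang \<beta>1 has_real_derivative \<theta>') (at u)"
      unfolding \<theta>'_def by (rule ang_deriv_true[OF \<beta> u(1) tr[OF u']])
    show "(m has_real_derivative \<eta>' u * cos (ang \<beta>1 u)
        - \<eta> u * (sin (ang \<beta>1 u) * \<theta>')) (at u)"
      unfolding m_def using \<eta>der[OF u(1) u'(2)] \<theta>' by (auto intro!: derivative_eq_intros)
    assume mu: "m u > 3/8"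
    have "0 \<le> \<eta> u * w u"
      using \<eta>pos[OF u'] w_nonneg[OF u'] by simp
    \<comment> \<open>Here N \<ge> \<eta> \<rho> > 3/8 > 1/3, so \<eta>' \<le> 0; the second term of
      the derivative has the right sign because \<rho> does not increase while N \<le> 1.\<close>
    then have "1 - 3 * (exc \<beta>1 u + 1) \<le> 0" using mu unfolding exc\<eta>[OF u'] m_def by simp
    then have "\<eta>' u * cos (ang \<beta>1 u) \<le> 0"
      using \<eta>pos[OF u'] cpos[OF u'] rpos[OF u'] unfolding \<eta>'_def
      by (intro mult_nonpos_nonneg divide_nonpos_pos mult_nonneg_nonpos) auto
    moreover have "0 \<le> \<eta> u * (sin (ang \<beta>1 u) * \<theta>')"
      using \<eta>pos[OF u'] sin_pos[OF \<beta> u'(1)] eneg[OF u'] rpos[OF u'] unfolding \<theta>'_def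
      by (intro mult_nonneg_nonneg divide_nonneg_pos) auto
    ultimately show "\<eta>' u * cos (ang \<beta>1 u)
        - \<eta> u * (sin (ang \<beta>1 u) * \<theta>') \<le> 0" by linarith
  qed (use t1 in simp)
  moreover have "\<eta> t1 * w t1 \<le> 1/35"
  proof -
    have r: "0 < rad \<beta>1 t1" using rpos[of t1] t1 by simp
    then have "(rad \<beta>1 t1)^2 \<le> 5^2" using r5 by (intro power_mono) auto
    then have "g ((rad \<beta>1 t1)^2) \<le> g 25" using r by (intro g_mono) auto
    then have "sin (ang \<beta>1 t1) * (\<beta>1 * (rad \<beta>1 t1 * g ((rad \<beta>1 t1)^2))) \<le> 1 * (\<beta>1 * (5 * g 25))"
      using r r5 \<beta>1 g25 pos[of "(rad \<beta>1 t1)^2"] by (intro mult_mono mult_nonneg_nonneg) auto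
    moreover have "\<eta> t1 * w t1
        = sin (ang \<beta>1 t1) * (\<beta>1 * (rad \<beta>1 t1 * g ((rad \<beta>1 t1)^2)))"
      using r by (simp add: \<eta>_def w_def power2_eq_square)
    moreover have "\<beta>1 * (5 * g 25) \<le> 1/35" using \<beta>1_small by simp
    ultimately show ?thesis by linarith
  qed
  \<comment> \<open>N = 1 is incompatible with N \<le> 3/8 + 1/35.\<close>
  ultimately show False using exc\<eta>[of t1] e1 t1 by (simp add: m_def)
qed

lemma shooting_parameter:
  obtains \<beta> where "\<beta> \<in> {\<beta>1..\<beta>2}" "\<And>t. t \<ge> 0 \<Longrightarrow> exc \<beta> t < 0 \<and> cos (ang \<beta> t) > 0"
proof -
  have "\<not> {\<beta>1..\<beta>2} \<subseteq> turning \<union> closing"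
  proof
    assume cover: "{\<beta>1..\<beta>2} \<subseteq> turning \<union> closing"
    have "\<beta>2 \<in> turning" "\<beta>1 \<in> closing"
      using cover \<beta>1 \<beta>1_not_turning \<beta>2_not_closing by auto
    then have "turning \<noteq> {}" "closing \<noteq> {}" by auto
    moreover have "\<not> (\<exists>E1 E2. openin (top_of_set {\<beta>1..\<beta>2}) E1 \<and> openin (top_of_set {\<beta>1..\<beta>2}) E2 \<and>
        {\<beta>1..\<beta>2} \<subseteq> E1 \<union> E2 \<and> E1 \<inter> E2 = {} \<and> E1 \<noteq> {} \<and> E2 \<noteq> {})"
      using connected_Icc[of \<beta>1 \<beta>2] unfolding connected_openin .
    ultimately show False
      using open_turning open_closing turning_closing_disjoint cover by metis
  qed
  then obtain \<beta> where "\<beta> \<in> {\<beta>1..\<beta>2}" "\<beta> \<notin> turning" "\<beta> \<notin> closing" by blast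
  then show thesis using that[of \<beta>] neither_stays[of \<beta>] by simp
qed

text \<open>The radius is increasing and bounded, hence convergent. \<rho> is decreasing and
  positive, and a positive lower bound e would let r grow linearly beyond R.\<close>

lemma global_limits:
  assumes \<beta>: "\<beta> \<in> {\<beta>1..\<beta>2}" and good: "\<And>t. t \<ge> 0 \<Longrightarrow> exc \<beta> t < 0 \<and> cos (ang \<beta> t) > 0"
  obtains l where "l > 0" "(rad \<beta> \<longlongrightarrow> l) at_top" "((\<lambda>t. cos (ang \<beta> t)) \<longlongrightarrow> 0) at_top"
    "\<And>t. t \<ge> 0 \<Longrightarrow> r0 \<le> rad \<beta> t \<and> rad \<beta> t < R"
proof -
  have tr: "r0 \<le> rad \<beta> t \<and> rad \<beta> t < R" if "t \<ge> 0" for t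
    using trapped[OF \<beta> _ that] good by (auto simp: less_imp_le)
  have inc: "rad \<beta> u \<le> rad \<beta> w" if "0 \<le> u" "u \<le> w" for u w
    using that good by (intro rad_mono[OF \<beta>]) (auto simp: less_imp_le)
  have dec: "cos (ang \<beta> w) \<le> cos (ang \<beta> u)" if "0 \<le> u" "u \<le> w" for u w
  proof -
    have "ang \<beta> u \<le> ang \<beta> w" using that good by (intro ang_mono[OF \<beta>]) (auto simp: less_imp_le)
    then show ?thesis using ang_range[OF \<beta>, of u] ang_range[OF \<beta>, of w] that by (intro cos_monotone_0_pi_le) auto
  qed
  define l where "l = Sup (rad \<beta> ` {0..})"
  have bdd: "bdd_above (rad \<beta> ` {0..})" using tr by (auto intro!: bdd_aboveI[of _ R] less_imp_le)
  have le_l: "rad \<beta> t \<le> l" if "t \<ge> 0" for t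
    unfolding l_def using that by (intro cSup_upper bdd) auto
  have "(rad \<beta> \<longlongrightarrow> l) at_top"
  proof (rule increasing_tendsto)
    show "\<forall>\<^sub>F t in at_top. rad \<beta> t \<le> l"
      using eventually_ge_at_top[of 0] by eventually_elim (rule le_l)
    fix x assume "x < l"
    then obtain t where t: "t \<ge> 0" "x < rad \<beta> t"
      unfolding l_def using less_cSup_iff[OF _ bdd] by auto
    show "\<forall>\<^sub>F w in at_top. x < rad \<beta> w"
      using eventually_ge_at_top[of t] by eventually_elim (use t inc[of t] in fastforce)
  qed
  moreover have "((\<lambda>t. cos (ang \<beta> t)) \<longlongrightarrow> 0) at_top"
  proof (rule decreasing_tendsto)
    show "\<forall>\<^sub>F t in at_top. 0 \<le> cos (ang \<beta> t)"
      using eventually_ge_at_top[of 0] by eventually_elim (use good in \<open>auto simp: less_imp_le\<close>)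
    fix e :: real assume e: "0 < e"
    have "\<exists>t\<ge>0. cos (ang \<beta> t) < e"
    proof (rule ccontr)
      assume "\<not> (\<exists>t\<ge>0. cos (ang \<beta> t) < e)"
      then have ge: "e \<le> cos (ang \<beta> t)" if "t \<ge> 0" for t using that by (meson not_less)
      \<comment> \<open>With speed at least e, a distance R is covered by this time.\<close>
      define T where "T = R / e"
      have T: "T \<ge> 0" using r0 e by (simp add: T_def)
      have "rad \<beta> 0 - e * 0 \<le> rad \<beta> T - e * T"
      proof (rule DERIV_nonneg_imp_increasing_open[OF T, where f = "\<lambda>t. rad \<beta> t - e * t"])
        show "continuous_on {0..T} (\<lambda>t. rad \<beta> t - e * t)"
          by (intro continuous_intros continuous_on_subset[OF rad_cont[OF \<beta>]]) auto
        fix x assume x: "0 < x" "x < T"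
        have "((\<lambda>t. rad \<beta> t - e * t) has_real_derivative cos (ang \<beta> x) - e) (at x)"
          using rad_deriv[OF \<beta> x(1)] by (auto intro!: derivative_eq_intros)
        then show "\<exists>y. ((\<lambda>t. rad \<beta> t - e * t) has_real_derivative y) (at x) \<and> 0 \<le> y"
          using ge[of x] x by (intro exI[of _ "cos (ang \<beta> x) - e"]) auto
      qed
      then show False using tr[OF T] tr[of 0] r0 e by (simp add: T_def)
    qed
    then obtain t where t: "t \<ge> 0" "cos (ang \<beta> t) < e" by blast
    show "\<forall>\<^sub>F w in at_top. cos (ang \<beta> w) < e"
      using eventually_ge_at_top[of t] by eventually_elim (use t dec[of t] in fastforce)
  qed
  moreover have "l > 0" using le_l[of 0] tr[of 0] r0 by simp
  ultimately show thesis using that[of l] tr by simp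
qed

end

section \<open>Existence\<close>

lemma toy_rhs_eta:
  assumes "r > 0" "1 - \<rho>^2 = r^2 * \<eta>^2" "\<eta> \<ge> 0"
  shows "toy_rhs g \<beta> \<rho> r = 3/2 * r * \<eta>^2 * (\<eta> * (\<beta> * r^2 * g (r^2) + \<rho>) - 1)"
proof -
  have "sqrt (1 - \<rho>^2) = r * \<eta>" unfolding assms(2) using assms(1,3) by (simp add: real_sqrt_mult)
  then show ?thesis unfolding toy_rhs_def assms(2) using assms(1) by (simp add: field_simps power2_eq_square)
qed

text \<open>At the seam the left derivative comes from f and the right one from h. Only a one-sided
  derivative of h at 0 is assumed, which is all that the flow on the half-line provides.\<close>

lemma glue_has_derivative:
  fixes f h D1 D2 :: "real \<Rightarrow> real"
  assumes c: "c > 0" and f: "\<And>s. 0 < s \<Longrightarrow> s \<le> c \<Longrightarrow> (f has_real_derivative D1 s) (at s)"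
    and h: "\<And>t. t \<ge> 0 \<Longrightarrow> (h has_real_derivative D2 t) (at t within {0..})"
    and eq: "f c = h 0" "D1 c = D2 0" and s: "s > 0"
  shows "((\<lambda>s. if s \<le> c then f s else h (s - c)) has_real_derivative (if s \<le> c then D1 s else D2 (s - c))) (at s)"
    (is "(?F has_real_derivative _) _")
proof -
  have shift: "((\<lambda>s. h (s - c)) has_real_derivative D2 (s - c)) (at s within {c..})" if "s \<ge> c" for s
  proof -
    have "((\<lambda>s. s - c) has_real_derivative 1) (at s within {c..})" by (auto intro!: derivative_eq_intros)
    moreover have "(\<lambda>s. s - c) ` {c..} = {0..}" by (auto simp: image_iff intro!: bexI[of _ "_ + c"])
    ultimately have "(h \<circ> (\<lambda>s. s - c) has_real_derivative D2 (s - c) * 1) (at s within {c..})"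
      using h[of "s - c"] that by (intro DERIV_image_chain) auto
    then show ?thesis by (simp add: o_def)
  qed
  consider "s < c" | "s > c" | "s = c" by linarith
  then show ?thesis
  proof cases
    case 1
    have "(?F has_real_derivative D1 s) (at s)"
      by (rule has_field_derivative_transform_within_open[OF f[OF s], of "{..<c}"]) (use 1 in auto)
    then show ?thesis using 1 by simp
  next
    case 2
    have "((\<lambda>s. h (s - c)) has_real_derivative D2 (s - c)) (at s)"
      using shift[of s] 2 by (simp add: at_within_atLeast_interior)
    then have "(?F has_real_derivative D2 (s - c)) (at s)"
      by (rule has_field_derivative_transform_within_open[of _ _ _ "{c<..}"]) (use 2 in auto)
    then show ?thesis using 2 by simp
  next
    case 3
    have "(?F has_real_derivative D1 c) (at c within {..c})"
      by (rule has_field_derivative_transform_within[OF has_field_derivative_at_within[OF f[OF c order_refl]], of 1]) auto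
    moreover have "(?F has_real_derivative D1 c) (at c within {c..})"
    proof (rule has_field_derivative_transform_within)
      show "((\<lambda>s. h (s - c)) has_real_derivative D1 c) (at c within {c..})" using shift[of c] eq(2) by simp
      show "h (x - c) = ?F x" if "x \<in> {c..}" for x using that eq(1) by (cases "x = c") auto
    qed (rule zero_less_one, simp)
    ultimately have "(?F has_real_derivative D1 c) (at c within ({..c} \<union> {c..}))"
      unfolding has_field_derivative_iff by (simp only: Lim_within_Un)
    moreover have "{..c} \<union> {c..} = UNIV" by auto
    ultimately show ?thesis using 3 by simp
  qed
qed


text \<open>Implicit differentiation of G^2 = 1 - v e^2. Along \<rho> = G(r^2) with r' = \<rho> one
  has \<rho>' = r (2 G G'), so this identity is the first model equation on the tip curve.\<close>

lemma local_profile_derivative: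
  fixes e G :: "real \<Rightarrow> real"
  assumes v: "0 < v" "v < \<delta>"
    and e': "(e has_real_derivative e v / (4 * v) * (1 - 3 * e v * (\<beta> * v * g v + G v))) (at v)"
    and G': "(G has_real_derivative D) (at v)" and Gpos: "G v > 0"
    and sq: "\<And>v. \<bar>v\<bar> < \<delta> \<Longrightarrow> (G v)^2 = 1 - v * (e v)^2"
  shows "2 * G v * D = 3/2 * (e v)^2 * (e v * (\<beta> * v * g v + G v) - 1)"
proof -
  define X where "X = \<beta> * v * g v + G v"
  have "((\<lambda>v. (G v)^2) has_real_derivative 2 * G v * D) (at v)"
    using G' by (auto intro!: derivative_eq_intros)
  moreover have "((\<lambda>v. 1 - v * (e v)^2) has_real_derivative
      - ((e v)^2 + v * (2 * e v * (e v / (4 * v) * (1 - 3 * e v * X))))) (at v)"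
    unfolding X_def by (rule derivative_eq_intros e' refl)+ (simp add: algebra_simps)
  then have "((\<lambda>v. (G v)^2) has_real_derivative
      - ((e v)^2 + v * (2 * e v * (e v / (4 * v) * (1 - 3 * e v * X))))) (at v)"
    by (rule has_field_derivative_transform_within_open[of _ _ _ "{-\<delta><..<\<delta>}"]) (use v sq in auto)
  ultimately have "2 * G v * D = - ((e v)^2 + v * (2 * e v * (e v / (4 * v) * (1 - 3 * e v * X))))"
    by (rule DERIV_unique)
  also have "v * (2 * e v * (e v / (4 * v) * (1 - 3 * e v * X))) = 1/2 * (e v)^2 * (1 - 3 * e v * X)"
    using v(1) by (simp add: field_simps power2_eq_square)
  finally show ?thesis unfolding X_def[symmetric] by (simp add: field_simps)
qed

text \<open>On the tip curve \<rho> = G(r^2), and r' = G(r^2) is regular at r = 0, unlike the full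
  system, so it can be started there. Clamping to [0, r0] allows the global existence result, and G
  \<ge> 95/96 > 1/2 guarantees that r0 is reached by time 2 r0.\<close>

lemma radial_start:
  fixes G :: "real \<Rightarrow> real"
  assumes r0: "0 < r0" "r0^2 < \<delta>" and an: "real_analytic_on G {-\<delta><..<\<delta>}"
    and Gge: "\<And>v. \<bar>v\<bar> < \<delta> \<Longrightarrow> 95/96 \<le> G v"
  obtains q c where "c > 0" "q 0 = 0" "q c = r0" "(q \<longlongrightarrow> 0) (at_right 0)"
    "\<And>s. 0 < s \<Longrightarrow> s \<le> c \<Longrightarrow> 0 < q s \<and> q s \<le> r0 \<and> (q has_real_derivative G ((q s)^2)) (at s)"
proof -
  define \<Phi> where "\<Phi> = (\<lambda>x. G ((max 0 (min r0 x))^2))"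
  have ran: "x^2 \<in> {-\<delta><..<\<delta>}" if "x \<in> {0..r0}" for x
  proof -
    have "x^2 \<le> r0^2" using that by (intro power_mono) auto
    then show ?thesis
      using r0 zero_le_power2[of x] zero_le_power2[of r0] unfolding greaterThanLessThan_iff by linarith
  qed
  have "bdd_lipschitz \<Phi>"
    unfolding \<Phi>_def
  proof (rule bdd_lipschitz_clamp[where \<phi> = "\<lambda>x. G (x^2)" and \<phi>' = "\<lambda>x. deriv G (x^2) * (2 * x)"])
    show "((\<lambda>x. G (x^2)) has_real_derivative deriv G (x^2) * (2 * x)) (at x)" if "x \<in> {0..r0}" for x
      by (rule DERIV_chain2[where f = G and g = "\<lambda>x. x^2", OF real_analytic_has_derivative[OF an ran[OF that]]]) (auto intro!: derivative_eq_intros)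
    have "continuous_on {-\<delta><..<\<delta>} (deriv G)"
      using real_analytic_has_derivative[OF real_analytic_deriv[OF an]]
      by (intro continuous_at_imp_continuous_on ballI) (auto intro: DERIV_isCont)
    then have "continuous_on {0..r0} (\<lambda>x. deriv G (x^2))"
      by (rule continuous_on_compose2) (use ran in \<open>auto intro!: continuous_intros\<close>)
    then show "continuous_on {0..r0} (\<lambda>x. deriv G (x^2) * (2 * x))" by (intro continuous_intros)
  qed (use r0 in simp)
  then obtain M L where M: "\<And>x. \<bar>\<Phi> x\<bar> \<le> M" and L: "\<And>x y. \<bar>\<Phi> x - \<Phi> y\<bar> \<le> L * dist x y"
    unfolding bdd_lipschitz_def by blast
  have L': "norm (\<Phi> x - \<Phi> y) \<le> (\<bar>L\<bar> + 1) * norm (x - y)" for x y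
  proof -
    have "L * dist x y \<le> (\<bar>L\<bar> + 1) * dist x y" by (intro mult_right_mono) auto
    then show ?thesis using L[of x y] by (simp add: dist_norm)
  qed
  obtain q where q0: "q 0 = 0"
    and q: "\<And>t. t \<ge> 0 \<Longrightarrow> (q has_vector_derivative \<Phi> (q t)) (at t within {0..})"
    by (rule ode_solution_exists[of "\<bar>L\<bar> + 1" \<Phi> M 0]) (use L' M in auto)
  have dq: "(q has_real_derivative \<Phi> (q t)) (at t)" if "t > 0" for t
    using q[of t] that by (simp add: at_within_atLeast_interior has_real_derivative_iff_has_vector_derivative)
  have cq: "continuous_on {0..} q"
    using q by (meson atLeast_iff continuous_on_eq_continuous_within has_vector_derivative_continuous)
  have \<Phi>ge: "95/96 \<le> \<Phi> x" for x
    unfolding \<Phi>_def using ran[of "max 0 (min r0 x)"] r0 by (intro Gge) (auto simp: abs_less_iff)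
  have growth: "q a + 1/2 * (b - a) \<le> q b" if "0 \<le> a" "a \<le> b" for a b
  proof -
    have "q a - 1/2 * a \<le> q b - 1/2 * b"
    proof (rule DERIV_nonneg_imp_increasing_open[OF that(2), where f = "\<lambda>t. q t - 1/2 * t"])
      show "continuous_on {a..b} (\<lambda>t. q t - 1/2 * t)"
        by (intro continuous_intros continuous_on_subset[OF cq]) (use that in auto)
      fix x assume "a < x" "x < b"
      then have "((\<lambda>t. q t - 1/2 * t) has_real_derivative \<Phi> (q x) - 1/2) (at x)"
        using dq[of x] that by (auto intro!: derivative_eq_intros)
      then show "\<exists>y. ((\<lambda>t. q t - 1/2 * t) has_real_derivative y) (at x) \<and> 0 \<le> y"
        using \<Phi>ge[of "q x"] by (intro exI[of _ "\<Phi> (q x) - 1/2"]) auto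
    qed
    then show ?thesis by (simp add: field_simps)
  qed
  have "continuous_on {0..2 * r0} q" using cq by (rule continuous_on_subset) auto
  then obtain c where c: "0 \<le> c" "q c = r0"
    using IVT'[of q 0 r0 "2 * r0"] growth[of 0 "2 * r0"] q0 r0 by auto
  have "c \<noteq> 0" using c q0 r0 by auto
  then have cpos: "c > 0" using c by simp
  have qr: "0 < q s" if "0 < s" for s using growth[of 0 s] that q0 by simp
  show thesis
  proof (rule that[OF cpos q0 c(2)])
    have "(q \<longlongrightarrow> q 0) (at 0 within {0..})" using cq by (simp add: continuous_on_def)
    then show "(q \<longlongrightarrow> 0) (at_right 0)" unfolding q0 by (rule tendsto_within_subset) auto
    fix s assume s: "0 < s" "s \<le> c"
    have "q s \<le> r0" using growth[OF less_imp_le[OF s(1)] s(2)] s(2) c(2) by (simp add: field_simps)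
    then show "0 < q s \<and> q s \<le> r0 \<and> (q has_real_derivative G ((q s)^2)) (at s)"
      using qr[OF s(1)] dq[OF s(1)] by (simp add: \<Phi>_def)
  qed
qed


lemma tip_solution_exists:
  fixes g :: "real \<Rightarrow> real"
  assumes analytic: "real_analytic_on g UNIV"
    and pos: "\<And>v. v > 0 \<Longrightarrow> g v > 0"
    and mono: "\<And>v. v > 0 \<Longrightarrow> deriv g v \<ge> 0"
    and convex: "\<And>v. v > 0 \<Longrightarrow> deriv (deriv (\<lambda>v. v^2 * g (v^2))) v > 0"
    and lim: "filterlim (\<lambda>v. v * g (v^2)) at_top at_top"
  obtains \<beta> \<rho> r where "\<beta> > 0" "toy_steady_tip_growth g \<beta> \<rho> r"
proof -
  \<comment> \<open>Chosen so that \<beta>1 times 25 g(25) is exactly 1/7, as 175 = 7 * 25.\<close>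
  define \<beta>1 where "\<beta>1 = 1 / (175 * g 25)"
  \<comment> \<open>The factor 125/48 is the inverse of (12/25)(4/5); the other entries secure
    \<beta>1 \<le> \<beta>2 and the bound B \<ge> 1 assumed at the tip.\<close>
  define \<beta>2 where "\<beta>2 = max (max \<beta>1 1) (125 / (48 * g (144/625)))"
  have g0: "g 25 > 0" "g (144/625) > 0" by (rule pos; simp)+
  have \<beta>1: "0 < \<beta>1" "\<beta>1 \<le> \<beta>2" "1 \<le> \<beta>2" "\<beta>1 * (25 * g 25) \<le> 1/7"
    using g0 by (auto simp: \<beta>1_def \<beta>2_def)
  have "125 / (48 * g (144/625)) * g (144/625) \<le> \<beta>2 * g (144/625)"
    using g0 by (intro mult_right_mono) (auto simp: \<beta>2_def)
  then have \<beta>2: "1 \<le> \<beta>2 * g (144/625) * (12/25) * (4/5)" using g0 by simp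
  obtain \<delta> e G where "tip_family g \<beta>2 \<delta> e G" by (rule local_tip_solution[OF analytic \<beta>1(3)])
  then interpret tip_family g \<beta>2 \<delta> e G .
  have N_less: "e \<beta> v * (\<beta> * v * g v + G \<beta> v) < 1" if "0 \<le> \<beta>" "\<beta> \<le> \<beta>2" "\<bar>v\<bar> < \<delta>" for \<beta> v
  proof -
    have "\<beta> * v * g v + G \<beta> v \<le> 33/32" "0 \<le> \<beta> * v * g v + G \<beta> v"
      using \<kappa>[OF that] unfolding abs_le_iff by linarith+
    then have "e \<beta> v * (\<beta> * v * g v + G \<beta> v) \<le> 3/8 * (33/32)" using e[OF that] by (intro mult_mono) auto
    then show ?thesis by simp
  qed
  define v0 where "v0 = \<delta> / 2"
  define r0 where "r0 = sqrt v0"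
  have v0: "0 < v0" "v0 < \<delta>" "\<bar>v0\<bar> < \<delta>" using \<delta> by (auto simp: v0_def)
  have rv: "0 < r0" "r0^2 = v0" using v0 by (auto simp: r0_def)
  have "r0 < 1" unfolding r0_def using \<delta> by (simp add: v0_def)
  \<comment> \<open>The angle of the tip solution at radius r0: sin \<theta> = r \<eta>, and the
    cosine is G because G is positive.\<close>
  define \<theta>0 where "\<theta>0 = (\<lambda>\<beta>. arcsin (r0 * e \<beta> v0))"
  have s0: "0 < r0 * e \<beta> v0" "r0 * e \<beta> v0 < 1" "sin (\<theta>0 \<beta>) = r0 * e \<beta> v0" "cos (\<theta>0 \<beta>) = G \<beta> v0"
    if "\<beta> \<in> {\<beta>1..\<beta>2}" for \<beta>
  proof -
    have b: "0 \<le> \<beta>" "\<beta> \<le> \<beta>2" using that \<beta>1 by auto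
    have ee: "7/24 \<le> e \<beta> v0" "e \<beta> v0 \<le> 3/8" using e[OF b v0(3)] by auto
    show 1: "0 < r0 * e \<beta> v0" using rv ee by simp
    have "r0 * e \<beta> v0 \<le> 1 * (3/8)" using rv \<open>r0 < 1\<close> ee by (intro mult_mono) auto
    then show 2: "r0 * e \<beta> v0 < 1" by simp
    show "sin (\<theta>0 \<beta>) = r0 * e \<beta> v0" using 1 2 by (simp add: \<theta>0_def)
    have "cos (\<theta>0 \<beta>) = sqrt (1 - (r0 * e \<beta> v0)^2)" unfolding \<theta>0_def using 1 2 by (intro cos_arcsin) auto
    also have "\<dots> = sqrt ((G \<beta> v0)^2)" using G[OF b v0(3)] rv by (simp add: power_mult_distrib)
    also have "\<dots> = G \<beta> v0" by (rule real_sqrt_unique) (use G[OF b v0(3)] in auto)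
    finally show "cos (\<theta>0 \<beta>) = G \<beta> v0" .
  qed
  \<comment> \<open>As sin \<theta>0 = r0 \<eta> \<ge> (7/24) r0 and \<beta> \<ge> \<beta>1, the
    condition R g(R^2) > K yields \<open>R_large\<close> for all \<beta> at once.\<close>
  define K where "K = 1 / (r0 * (7/24) * \<beta>1)"
  have "\<forall>\<^sub>F v in at_top. K < v * g (v^2)" using lim by (simp add: filterlim_at_top_dense)
  then have "\<forall>\<^sub>F v in at_top. K < v * g (v^2) \<and> 5 < v" using eventually_gt_at_top[of 5] by (rule eventually_conj)
  then obtain R where R: "K < R * g (R^2)" "5 < R" using eventually_happens'[OF trivial_limit_at_top_linorder] by blast
  interpret toy_shooting g r0 R \<beta>1 \<beta>2 \<theta>0
  proof
    show "continuous_on {\<beta>1..\<beta>2} \<theta>0" unfolding \<theta>0_def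
    proof (rule continuous_on_arcsin)
      have "2-lipschitz_on {\<beta>1..\<beta>2} (\<lambda>\<beta>. e \<beta> v0)"
        using e_par[OF _ _ _ _ v0(3)] \<beta>1 by (auto simp: lipschitz_on_def dist_real_def)
      then have "continuous_on {\<beta>1..\<beta>2} (\<lambda>\<beta>. e \<beta> v0)" by (rule lipschitz_on_continuous_on)
      then show "continuous_on {\<beta>1..\<beta>2} (\<lambda>\<beta>. r0 * e \<beta> v0)" by (intro continuous_intros)
      show "\<forall>\<beta>\<in>{\<beta>1..\<beta>2}. - 1 \<le> r0 * e \<beta> v0 \<and> r0 * e \<beta> v0 \<le> 1" using s0(1,2) by fastforce
    qed
    fix \<beta> assume b: "\<beta> \<in> {\<beta>1..\<beta>2}"
    then have b': "0 \<le> \<beta>" "\<beta> \<le> \<beta>2" using \<beta>1 by auto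
    have "0 < \<theta>0 \<beta>" "\<theta>0 \<beta> < pi/2"
      using s0(1,2)[OF b] arcsin_less_mono[of 0 "r0 * e \<beta> v0"] arcsin_less_mono[of "r0 * e \<beta> v0" 1]
      by (auto simp: \<theta>0_def)
    moreover have "sin (\<theta>0 \<beta>) / r0 = e \<beta> v0" using s0(3)[OF b] rv by simp
    moreover have "sin (\<theta>0 \<beta>) * (\<beta> * r0^2 * g (r0^2) + cos (\<theta>0 \<beta>)) / r0 = e \<beta> v0 * (\<beta> * v0 * g v0 + G \<beta> v0)"
      unfolding s0(3,4)[OF b] rv(2) using rv(1) by simp
    ultimately show "0 < \<theta>0 \<beta> \<and> \<theta>0 \<beta> < pi/2 \<and>
      7/24 \<le> sin (\<theta>0 \<beta>) / r0 \<and> sin (\<theta>0 \<beta>) / r0 \<le> 3/8 \<and> cos (\<theta>0 \<beta>) > 3/5 \<and>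
      sin (\<theta>0 \<beta>) * (\<beta> * r0^2 * g (r0^2) + cos (\<theta>0 \<beta>)) / r0 < 1"
      using e[OF b' v0(3)] G[OF b' v0(3)] N_less[OF b' v0(3)] s0(4)[OF b] by simp
    have gR: "0 < g (R^2)" using R by (intro pos) simp
    have "1 = r0 * (7/24) * (\<beta>1 * K)" using rv \<beta>1 by (simp add: K_def)
    also have "\<dots> < r0 * (7/24) * (\<beta>1 * (R * g (R^2)))"
      using R rv \<beta>1 by (intro mult_strict_left_mono) auto
    also have "\<dots> \<le> (r0 * e \<beta> v0) * (\<beta> * (R * g (R^2)))"
      using e[OF b' v0(3)] b b' rv \<beta>1 R(2) gR by (intro mult_mono mult_nonneg_nonneg) auto
    finally show "1 < sin (\<theta>0 \<beta>) * (\<beta> * R * g (R^2))" using s0(3)[OF b] by (simp add: mult.assoc)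
  qed (use analytic pos mono convex rv \<open>r0 < 1\<close> R \<beta>1 \<beta>2 in auto)
  obtain \<beta> where b: "\<beta> \<in> {\<beta>1..\<beta>2}" and good: "\<And>t. t \<ge> 0 \<Longrightarrow> exc \<beta> t < 0 \<and> cos (ang \<beta> t) > 0"
    by (rule shooting_parameter) (rule that)
  obtain l where l: "l > 0" "(rad \<beta> \<longlongrightarrow> l) at_top" "((\<lambda>t. cos (ang \<beta> t)) \<longlongrightarrow> 0) at_top"
    and tr: "\<And>t. t \<ge> 0 \<Longrightarrow> r0 \<le> rad \<beta> t \<and> rad \<beta> t < R"
    by (rule global_limits[OF b good]) (auto intro: that)
  have b': "0 \<le> \<beta>" "\<beta> \<le> \<beta>2" "0 < \<beta>" using b \<beta>1 by auto
  have Gge: "95/96 \<le> G \<beta> v" and Gsq: "(G \<beta> v)^2 = 1 - v * (e \<beta> v)^2" if "\<bar>v\<bar> < \<delta>" for v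
    using G[OF b'(1,2) that] by auto
  have "r0^2 < \<delta>" using rv v0 by simp
  obtain q c where c: "c > 0" and q0: "q 0 = 0" and qc: "q c = r0" and q_lim: "(q \<longlongrightarrow> 0) (at_right 0)"
    and q: "\<And>s. 0 < s \<Longrightarrow> s \<le> c \<Longrightarrow> 0 < q s \<and> q s \<le> r0 \<and> (q has_real_derivative G \<beta> ((q s)^2)) (at s)"
    by (rule radial_start[OF rv(1) \<open>r0\<^sup>2 < \<delta>\<close> G_an[OF b'(1,2)] Gge]) (auto intro: that)
  have q2: "0 < (q s)^2" "(q s)^2 < \<delta>" "\<bar>(q s)^2\<bar> < \<delta>" if "0 < s" "s \<le> c" for s
  proof -
    have "(q s)^2 \<le> r0^2" using q[OF that] by (intro power_mono) auto
    then show "(q s)^2 < \<delta>" "\<bar>(q s)^2\<bar> < \<delta>" using \<open>r0\<^sup>2 < \<delta>\<close> by auto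
    show "0 < (q s)^2" using q[OF that] by simp
  qed
  define \<rho>1 where "\<rho>1 = (\<lambda>s. G \<beta> ((q s)^2))"
  have \<rho>1_rhs: "toy_rhs g \<beta> (\<rho>1 s) (q s) = 3/2 * q s * (e \<beta> ((q s)^2))^2 *
      (e \<beta> ((q s)^2) * (\<beta> * (q s)^2 * g ((q s)^2) + \<rho>1 s) - 1)" if "0 < s" "s \<le> c" for s
    using q[OF that] q2[OF that] Gsq[OF q2(3)[OF that]] e[OF b'(1,2) q2(3)[OF that]]
    by (intro toy_rhs_eta) (auto simp: \<rho>1_def)
  have \<rho>1': "(\<rho>1 has_real_derivative toy_rhs g \<beta> (\<rho>1 s) (q s)) (at s)" if s: "0 < s" "s \<le> c" for s
  proof -
    define D where "D = deriv (G \<beta>) ((q s)^2)"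
    have "(q s)^2 \<in> {-\<delta><..<\<delta>}"
      using q2(1,2)[OF s] \<delta>(1) unfolding greaterThanLessThan_iff by linarith
    then have dG: "(G \<beta> has_real_derivative D) (at ((q s)^2))"
      unfolding D_def by (rule real_analytic_has_derivative[OF G_an[OF b'(1,2)]])
    have "((\<lambda>s. (q s)^2) has_real_derivative 2 * q s * \<rho>1 s) (at s)"
      using q[OF s] by (auto intro!: derivative_eq_intros simp: \<rho>1_def)
    from DERIV_chain2[where f = "G \<beta>" and g = "\<lambda>s. (q s)^2", OF dG this]
    have "(\<rho>1 has_real_derivative D * (2 * q s * \<rho>1 s)) (at s)" by (simp add: \<rho>1_def)
    moreover have "2 * G \<beta> ((q s)^2) * D = 3/2 * (e \<beta> ((q s)^2))^2 *
        (e \<beta> ((q s)^2) * (\<beta> * (q s)^2 * g ((q s)^2) + G \<beta> ((q s)^2)) - 1)"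
      using Gge[OF q2(3)[OF s]]
      by (intro local_profile_derivative[where e = "e \<beta>" and G = "G \<beta>" and \<delta> = \<delta>]
          q2(1,2)[OF s] e'[OF b'(1,2) q2(1,2)[OF s]] dG Gsq) auto
    then have "D * (2 * q s * \<rho>1 s) = toy_rhs g \<beta> (\<rho>1 s) (q s)"
      unfolding \<rho>1_rhs[OF s] by (simp add: \<rho>1_def mult_ac)
    ultimately show ?thesis by simp
  qed
  have \<rho>1_bounds: "95/96 \<le> \<rho>1 s" "\<rho>1 s < 1" "toy_rhs g \<beta> (\<rho>1 s) (q s) < 0"
    "sqrt (1 - (\<rho>1 s)^2) / q s = e \<beta> ((q s)^2)" if s: "0 < s" "s \<le> c" for s
  proof -
    have ee: "7/24 \<le> e \<beta> ((q s)^2)" using e[OF b'(1,2) q2(3)[OF s]] by simp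
    have qs: "q s > 0" using q[OF s] by simp
    show "95/96 \<le> \<rho>1 s" unfolding \<rho>1_def by (rule Gge[OF q2(3)[OF s]])
    have sq: "(\<rho>1 s)^2 = 1 - (q s)^2 * (e \<beta> ((q s)^2))^2" unfolding \<rho>1_def by (rule Gsq[OF q2(3)[OF s]])
    have "(q s)^2 * (e \<beta> ((q s)^2))^2 > 0" using qs ee by simp
    then have "(\<rho>1 s)^2 < 1^2" using sq by simp
    then show "\<rho>1 s < 1" by (rule power2_less_imp_less) simp
    have "sqrt (1 - (\<rho>1 s)^2) = q s * e \<beta> ((q s)^2)" unfolding sq using qs ee by (simp add: real_sqrt_mult)
    then show "sqrt (1 - (\<rho>1 s)^2) / q s = e \<beta> ((q s)^2)" using qs by simp
    show "toy_rhs g \<beta> (\<rho>1 s) (q s) < 0"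
      unfolding \<rho>1_rhs[OF s] using qs ee N_less[OF b'(1,2) q2(3)[OF s]]
      by (intro mult_pos_neg mult_pos_pos) (auto simp: \<rho>1_def)
  qed
  define \<rho>2 where "\<rho>2 = (\<lambda>t. cos (ang \<beta> t))"
  have \<rho>2_rhs: "toy_rhs g \<beta> (\<rho>2 t) (rad \<beta> t) = 3/2 * rad \<beta> t * (sin (ang \<beta> t) / rad \<beta> t)^2 * exc \<beta> t"
    if t: "t \<ge> 0" for t
  proof -
    have r: "rad \<beta> t > 0" using tr[OF t] rv by simp
    have "toy_rhs g \<beta> (\<rho>2 t) (rad \<beta> t) = 3/2 * rad \<beta> t * (sin (ang \<beta> t) / rad \<beta> t)^2 *
        (sin (ang \<beta> t) / rad \<beta> t * (\<beta> * (rad \<beta> t)^2 * g ((rad \<beta> t)^2) + \<rho>2 t) - 1)"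
      using r sin_pos[OF b t] by (intro toy_rhs_eta) (auto simp: \<rho>2_def sin_squared_eq power_divide)
    also have "sin (ang \<beta> t) / rad \<beta> t * (\<beta> * (rad \<beta> t)^2 * g ((rad \<beta> t)^2) + \<rho>2 t) - 1 = exc \<beta> t"
      using exc_true[OF b t] tr[OF t] by (simp add: \<rho>2_def)
    finally show ?thesis .
  qed
  have \<rho>2': "(\<rho>2 has_real_derivative toy_rhs g \<beta> (\<rho>2 t) (rad \<beta> t)) (at t within {0..})" if t: "t \<ge> 0" for t
  proof -
    have r: "rad \<beta> t > 0" "cr (rad \<beta> t) = rad \<beta> t" using tr[OF t] rv by (auto intro: cr_id)
    have "(\<rho>2 has_real_derivative - sin (ang \<beta> t) * (3/2 * (sin (ang \<beta> t) / rad \<beta> t) * (- exc \<beta> t))) (at t within {0..})"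
      unfolding \<rho>2_def using ang_deriv_within[OF b t] r(2) by (auto intro!: derivative_eq_intros)
    moreover have "- sin (ang \<beta> t) * (3/2 * (sin (ang \<beta> t) / rad \<beta> t) * (- exc \<beta> t)) = toy_rhs g \<beta> (\<rho>2 t) (rad \<beta> t)"
      unfolding \<rho>2_rhs[OF t] using r(1) by (simp add: power2_eq_square)
    ultimately show ?thesis by simp
  qed
  have \<rho>2_bounds: "0 < \<rho>2 t" "\<rho>2 t < 1" "toy_rhs g \<beta> (\<rho>2 t) (rad \<beta> t) < 0" if t: "t \<ge> 0" for t
  proof -
    have r: "rad \<beta> t > 0" using tr[OF t] rv by simp
    show "0 < \<rho>2 t" using good[OF t] by (simp add: \<rho>2_def)
    have "(\<rho>2 t)^2 < 1^2" using sin_pos[OF b t] by (simp add: \<rho>2_def cos_squared_eq)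
    then show "\<rho>2 t < 1" by (rule power2_less_imp_less) simp
    show "toy_rhs g \<beta> (\<rho>2 t) (rad \<beta> t) < 0"
      unfolding \<rho>2_rhs[OF t] using r sin_pos[OF b t] good[OF t] by (intro mult_pos_neg mult_pos_pos) auto
  qed
  \<comment> \<open>The tip curve covers times up to c, where it has radius r0; the shooting
    trajectory follows, shifted by c. The states agree at c, hence also the derivatives, which are
    given by the vector field.\<close>
  define \<rho> where "\<rho> = (\<lambda>s. if s \<le> c then \<rho>1 s else \<rho>2 (s - c))"
  define r where "r = (\<lambda>s. if s \<le> c then q s else rad \<beta> (s - c))"
  have join: "q c = rad \<beta> 0" "\<rho>1 c = \<rho>2 0"
    using qc start[OF b] s0(4)[OF b] rv(2) by (auto simp: \<rho>1_def \<rho>2_def)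
  have d\<rho>: "(\<rho> has_real_derivative toy_rhs g \<beta> (\<rho> s) (r s)) (at s)" if "s > 0" for s
  proof -
    have "(\<rho> has_real_derivative (if s \<le> c then toy_rhs g \<beta> (\<rho>1 s) (q s) else toy_rhs g \<beta> (\<rho>2 (s - c)) (rad \<beta> (s - c)))) (at s)"
      unfolding \<rho>_def by (rule glue_has_derivative[OF c \<rho>1' \<rho>2' _ _ that]) (use join in auto)
    then show ?thesis by (simp add: \<rho>_def r_def split: if_splits)
  qed
  have dr: "(r has_real_derivative \<rho> s) (at s)" if "s > 0" for s
  proof -
    have "(r has_real_derivative (if s \<le> c then \<rho>1 s else \<rho>2 (s - c))) (at s)"
      unfolding r_def
      by (rule glue_has_derivative[OF c _ _ _ _ that]) (use q join rad_deriv_within[OF b] in \<open>auto simp: \<rho>1_def \<rho>2_def\<close>)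
    then show ?thesis by (simp add: \<rho>_def)
  qed
  have bounds: "0 < \<rho> s" "\<rho> s < 1" "0 < r s" "toy_rhs g \<beta> (\<rho> s) (r s) < 0" if "s > 0" for s
  proof -
    show "0 < \<rho> s" using \<rho>1_bounds(1)[of s] \<rho>2_bounds(1)[of "s - c"] that by (cases "s \<le> c") (auto simp: \<rho>_def)
    show "\<rho> s < 1" using \<rho>1_bounds(2)[of s] \<rho>2_bounds(2)[of "s - c"] that by (cases "s \<le> c") (auto simp: \<rho>_def)
    show "0 < r s" using q[of s] tr[of "s - c"] rv that by (cases "s \<le> c") (auto simp: r_def)
    show "toy_rhs g \<beta> (\<rho> s) (r s) < 0"
      using \<rho>1_bounds(3)[of s] \<rho>2_bounds(3)[of "s - c"] that by (cases "s \<le> c") (auto simp: \<rho>_def r_def)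
  qed
  have ev: "\<forall>\<^sub>F s in at_right 0. 0 < s \<and> s \<le> c"
    unfolding eventually_at_right_field using c by (intro exI[of _ c]) auto
  have q2_lim: "((\<lambda>s. (q s)^2) \<longlongrightarrow> 0) (at_right 0)" using tendsto_power[OF q_lim, of 2] by simp
  have G0: "G \<beta> 0 = 1"
  proof -
    have "(G \<beta> 0)^2 = 1^2" "0 \<le> G \<beta> 0" using Gsq[of 0] Gge[of 0] \<delta> by auto
    then show ?thesis using power2_eq_imp_eq zero_le_one by blast
  qed
  have "isCont (G \<beta>) 0"
    using \<delta> by (intro DERIV_isCont[OF real_analytic_has_derivative[OF G_an[OF b'(1,2)]]]) auto
  from isCont_tendsto_compose[OF this q2_lim] have "(\<rho>1 \<longlongrightarrow> 1) (at_right 0)" by (simp add: \<rho>1_def G0)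
  then have lim_\<rho>: "(\<rho> \<longlongrightarrow> 1) (at_right 0)"
    by (rule Lim_transform_eventually) (use ev in \<open>auto elim!: eventually_mono simp: \<rho>_def\<close>)
  have lim_r: "(r \<longlongrightarrow> 0) (at_right 0)"
    using q_lim by (rule Lim_transform_eventually) (use ev in \<open>auto elim!: eventually_mono simp: r_def\<close>)
  have "((\<lambda>s. e \<beta> ((q s)^2)) \<longlongrightarrow> 1/3) (at_right 0)"
    using isCont_tendsto_compose[OF e_cont[OF b'(1,2), of 0] q2_lim] \<delta> e0[OF b'(1,2)] by simp
  then have lim_\<eta>: "((\<lambda>s. sqrt (1 - \<rho> s ^ 2) / r s) \<longlongrightarrow> 1/3) (at_right 0)"
    by (rule Lim_transform_eventually) (use ev \<rho>1_bounds(4) in \<open>auto elim!: eventually_mono simp: \<rho>_def r_def\<close>)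
  have sh: "filterlim (\<lambda>s. s - c) at_top at_top"
    using filterlim_tendsto_add_at_top[OF tendsto_const[of "-c"] filterlim_ident[of at_top]] by simp
  have ev': "\<forall>\<^sub>F s in at_top. c < s" by (rule eventually_gt_at_top)
  have inf_\<rho>: "(\<rho> \<longlongrightarrow> 0) at_top"
    by (rule Lim_transform_eventually[OF filterlim_compose[OF l(3) sh]])
       (rule eventually_mono[OF ev'], simp add: \<rho>_def \<rho>2_def)
  have inf_r: "(r \<longlongrightarrow> l) at_top"
    by (rule Lim_transform_eventually[OF filterlim_compose[OF l(2) sh]])
       (rule eventually_mono[OF ev'], simp add: r_def)
  \<comment> \<open>With s0 = c, (S2) asks for analyticity on (-v0, v0), which lies inside the
    interval (-\<delta>, \<delta>) of the tip solution.\<close>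
  have rc: "r c ^ 2 = v0" using qc rv by (simp add: r_def)
  have "real_analytic_on (G \<beta>) {- v0<..<v0}"
    using G_an[OF b'(1,2)] by (rule real_analytic_on_subset) (use v0 in auto)
  moreover have "G \<beta> v > 0" if "v \<in> {- v0<..<v0}" for v
  proof -
    have "\<bar>v\<bar> < \<delta>" using that v0 by (auto simp: abs_less_iff)
    from Gge[OF this] show ?thesis by simp
  qed
  moreover have "\<rho> s = G \<beta> (r s ^ 2)" if "s \<in> {0<..<c}" for s
    using that by (simp add: \<rho>_def r_def \<rho>1_def)
  ultimately have S2: "\<exists>s0>0. \<exists>G. real_analytic_on G {- (r s0 ^ 2)<..<r s0 ^ 2}
        \<and> (\<forall>v\<in>{- (r s0 ^ 2)<..<r s0 ^ 2}. G v > 0)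
        \<and> (\<forall>s\<in>{0<..<s0}. \<rho> s = G (r s ^ 2))"
    using c rc by (intro exI[of _ c] exI[of _ "G \<beta>"] conjI) auto
  have S3: "deriv \<rho> s < 0 \<and> \<rho> s > 0" if "s > 0" for s
    using DERIV_imp_deriv[OF d\<rho>[OF that]] bounds[OF that] by simp
  have ode: "-1 < \<rho> s \<and> \<rho> s < 1 \<and> 0 < r s \<and>
        (\<rho> has_real_derivative toy_rhs g \<beta> (\<rho> s) (r s)) (at s) \<and>
        (r has_real_derivative \<rho> s) (at s)" if "s > 0" for s
    using bounds[OF that] d\<rho>[OF that] dr[OF that] by simp
  have "toy_steady_tip_growth g \<beta> \<rho> r"
    unfolding toy_steady_tip_growth_def
    by (intro conjI allI impI ode lim_\<rho> lim_r S2 S3 inf_\<rho> exI[of _ "1/3"] lim_\<eta> exI[of _ l] inf_r l(1)) (simp_all add: S3 ode)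
  then show thesis using that b'(3) by blast
qed

theorem theorem3p1:
  fixes g :: "real \<Rightarrow> real"
  assumes analytic: "real_analytic_on g UNIV"
    and pos: "\<And>v. v > 0 \<Longrightarrow> g v > 0"
    and mono: "\<And>v. v > 0 \<Longrightarrow> deriv g v \<ge> 0"
    and convex: "\<And>v. v > 0 \<Longrightarrow> deriv (deriv (\<lambda>v. v^2 * g (v^2))) v > 0"
    and lim: "filterlim (\<lambda>v. v * g (v^2)) at_top at_top"
  shows "\<exists>\<beta>>0. \<exists>\<rho> r. toy_steady_tip_growth g \<beta> \<rho> r \<and>
           (\<forall>\<rho>' r'. toy_steady_tip_growth g \<beta> \<rho>' r' \<longrightarrow>
              (\<forall>s>0. \<rho>' s = \<rho> s \<and> r' s = r s))"
proof -
  obtain \<beta> \<rho> r where \<beta>: "\<beta> > 0" "toy_steady_tip_growth g \<beta> \<rho> r"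
    by (rule tip_solution_exists[OF assms])
  have "isCont g x" for x using real_analytic_has_derivative[OF analytic, of x] DERIV_isCont by simp
  then show ?thesis using \<beta> toy_solutions_equal[where g = g and \<beta> = \<beta>] by blast
qed

end
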